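(* Let $\mathscr{L}=\{+,\cdot,\copyright,!,\exp_2,0,1\}$ and let $\Omega$ be the set of equations $$1\cdot x\approx x\cdot 1\approx x,\quad x\mathbin{\copyright}0\approx 1\approx 0\mathbin{\copyright}x,\quad 0+x\approx x+0\approx x,\quad 0\cdot x\approx x\cdot 0\approx 0,$$ $$0!\approx 1,\quad 1!\approx 1,\quad \exp_2(0)\approx 1,\quad \exp_2(1)\approx 1+1\approx(1+1)!.$$ The equational logical entailment operator $\vdash$ for finite antecedents true on the natural numbers is decidable, provided that the laws in $\Omega$ are known consequences. That is, there is an algorithm which, given any finite set $\Sigma$ of $\mathscr{L}$-equations valid in $\langle\mathbb{N}_0,+,\cdot,\copyright,!,\exp_2,0,1\rangle$ for which it is known that $\Sigma\vdash\Omega$, and any $\mathscr{L}$-terms $t_1,t_2$, decides whether $\Sigma\vdash t_1\approx t_2$.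
   Context: $\mathbb{N}_0=\{0,1,2,\dots\}$. The signature $\mathscr{L}$ has binary operation symbols $+,\cdot,\copyright$, unary operation symbols $!,\exp_2$ and constants $0,1$. On $\mathbb{N}_0$ these are interpreted as usual addition and multiplication, $x\mathbin{\copyright}y:=\binom{x+y}{y}$, factorial, $\exp_2(x):=2^x$, and the numbers $0,1$. Equations are understood as universally quantified over their variables; $\vdash$ is equational logical entailment. The conditions that $\Sigma$ is valid on $\mathbb{N}_0$ and that $\Sigma\vdash\Omega$ are given about the input (the algorithm need not check them). *)

theory Defs
  imports "HOL-Library.Nat_Bijection"
begin

datatype trm =
    Var nat
  | Zero
  | One
  | Add trm trm
  | Mul trm trm
  | Bin trm trm
  | Fac trm
  | Exp2 trm

type_synonym eqn = "trm \<times> trm"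

primrec subst :: "(nat \<Rightarrow> trm) \<Rightarrow> trm \<Rightarrow> trm" where
  "subst \<sigma> (Var n) = \<sigma> n"
| "subst \<sigma> Zero = Zero"
| "subst \<sigma> One = One"
| "subst \<sigma> (Add s t) = Add (subst \<sigma> s) (subst \<sigma> t)"
| "subst \<sigma> (Mul s t) = Mul (subst \<sigma> s) (subst \<sigma> t)"
| "subst \<sigma> (Bin s t) = Bin (subst \<sigma> s) (subst \<sigma> t)"
| "subst \<sigma> (Fac s) = Fac (subst \<sigma> s)"
| "subst \<sigma> (Exp2 s) = Exp2 (subst \<sigma> s)"

primrec nat_val :: "(nat \<Rightarrow> nat) \<Rightarrow> trm \<Rightarrow> nat" where
  "nat_val \<rho> (Var n) = \<rho> n"
| "nat_val \<rho> Zero = 0"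
| "nat_val \<rho> One = 1"
| "nat_val \<rho> (Add s t) = nat_val \<rho> s + nat_val \<rho> t"
| "nat_val \<rho> (Mul s t) = nat_val \<rho> s * nat_val \<rho> t"
| "nat_val \<rho> (Bin s t) = (nat_val \<rho> s + nat_val \<rho> t) choose (nat_val \<rho> t)"
| "nat_val \<rho> (Fac s) = fact (nat_val \<rho> s)"
| "nat_val \<rho> (Exp2 s) = 2 ^ nat_val \<rho> s"

definition nat_valid :: "eqn \<Rightarrow> bool" where
  "nat_valid e \<longleftrightarrow> (\<forall>\<rho>. nat_val \<rho> (fst e) = nat_val \<rho> (snd e))"

text \<open>Entailment is derivability in Birkhoff's equational calculus.\<close>

inductive entails :: "eqn set \<Rightarrow> eqn \<Rightarrow> bool" (infix "\<turnstile>" 50)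
  for \<Sigma> :: "eqn set" where
  ax: "(s, t) \<in> \<Sigma> \<Longrightarrow> \<Sigma> \<turnstile> (subst \<sigma> s, subst \<sigma> t)"
| refl: "\<Sigma> \<turnstile> (t, t)"
| sym: "\<Sigma> \<turnstile> (s, t) \<Longrightarrow> \<Sigma> \<turnstile> (t, s)"
| trans: "\<Sigma> \<turnstile> (s, t) \<Longrightarrow> \<Sigma> \<turnstile> (t, u) \<Longrightarrow> \<Sigma> \<turnstile> (s, u)"
| cong_Add: "\<Sigma> \<turnstile> (s, s') \<Longrightarrow> \<Sigma> \<turnstile> (t, t') \<Longrightarrow> \<Sigma> \<turnstile> (Add s t, Add s' t')"
| cong_Mul: "\<Sigma> \<turnstile> (s, s') \<Longrightarrow> \<Sigma> \<turnstile> (t, t') \<Longrightarrow> \<Sigma> \<turnstile> (Mul s t, Mul s' t')"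
| cong_Bin: "\<Sigma> \<turnstile> (s, s') \<Longrightarrow> \<Sigma> \<turnstile> (t, t') \<Longrightarrow> \<Sigma> \<turnstile> (Bin s t, Bin s' t')"
| cong_Fac: "\<Sigma> \<turnstile> (s, s') \<Longrightarrow> \<Sigma> \<turnstile> (Fac s, Fac s')"
| cong_Exp2: "\<Sigma> \<turnstile> (s, s') \<Longrightarrow> \<Sigma> \<turnstile> (Exp2 s, Exp2 s')"

text \<open>A chain \<open>s \<approx> t \<approx> u\<close> is read as the two equations \<open>s \<approx> t\<close> and \<open>t \<approx> u\<close>;
  the variable \<open>x\<close> is \<open>Var 0\<close>.\<close>

definition Omega :: "eqn set" where
  "Omega = (let x = Var 0; two = Add One One in
    {(Mul One x, Mul x One), (Mul x One, x),
     (Bin x Zero, One), (One, Bin Zero x),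
     (Add Zero x, Add x Zero), (Add x Zero, x),
     (Mul Zero x, Mul x Zero), (Mul x Zero, Zero),
     (Fac Zero, One),
     (Fac One, One),
     (Exp2 Zero, One),
     (Exp2 One, two), (two, Fac two)})"

text \<open>Kleene's schemes. Arities are not tracked syntactically; a program simply has no value
  on an argument list to which none of the rules below applies. On lists of each fixed
  length exactly the partial recursive functions of that arity are computed.\<close>

datatype recf =
    RZero
  | RSuc
  | RProj nat
  | RComp recf "recf list"
  | RPrim recf recf
  | RMu recf

inductive computes :: "recf \<Rightarrow> nat list \<Rightarrow> nat \<Rightarrow> bool" where
  zero: "computes RZero xs 0"
| suc: "computes RSuc [x] (Suc x)"
| proj: "i < length xs \<Longrightarrow> computes (RProj i) xs (xs ! i)"
| comp: "length ys = length gs \<Longrightarrow> (\<forall>i < length gs. computes (gs ! i) xs (ys ! i)) \<Longrightarrow>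
    computes f ys z \<Longrightarrow> computes (RComp f gs) xs z"
| prim_0: "computes f xs z \<Longrightarrow> computes (RPrim f g) (0 # xs) z"
| prim_Suc: "computes (RPrim f g) (n # xs) y \<Longrightarrow> computes g (n # y # xs) z \<Longrightarrow>
    computes (RPrim f g) (Suc n # xs) z"
| mu: "computes f (n # xs) 0 \<Longrightarrow> (\<forall>m < n. \<exists>k. computes f (m # xs) (Suc k)) \<Longrightarrow>
    computes (RMu f) xs n"

lemma computes_unique: "computes p xs y \<Longrightarrow> computes p xs z \<Longrightarrow> y = z"
proof (induction arbitrary: z rule: computes.induct)
  case (zero xs)
  then show ?case by cases auto
next
  case (suc x)
  then show ?case by cases auto
next
  case (proj i xs)
  from proj.prems show ?case by cases simp
next
  case (comp ys gs xs f w)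
  from comp.prems obtain ys' where ys': "length ys' = length gs"
    "\<forall>i < length gs. computes (gs ! i) xs (ys' ! i)" "computes f ys' z"
    by cases auto
  have "ys = ys'"
  proof (rule nth_equalityI)
    show "length ys = length ys'" using comp.hyps(1) ys'(1) by simp
    show "ys ! i = ys' ! i" if "i < length ys" for i
      using comp.IH(1) comp.hyps(1) ys'(2) that by metis
  qed
  with ys'(3) comp.IH(2) show ?case by blast
next
  case (prim_0 f xs y g)
  from prim_0.prems have "computes f xs z" by cases
  then show ?case by (rule prim_0.IH)
next
  case (prim_Suc f g n xs y w)
  from prim_Suc.prems obtain y' where
    "computes (RPrim f g) (n # xs) y'" "computes g (n # y' # xs) z" by cases
  with prim_Suc.IH show ?case by blast
next
  case (mu f n xs)
  from mu.prems have z: "computes f (z # xs) 0" "\<forall>m < z. \<exists>k. computes f (m # xs) (Suc k)"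
    by (cases, blast)+
  show ?case
  proof (rule linorder_cases[of n z])
    assume "n < z"
    then obtain k where "computes f (n # xs) (Suc k)" using z(2) by blast
    then have "0 = Suc k" by (rule mu.IH(1))
    then show ?thesis by simp
  next
    assume "z < n"
    then obtain k where "\<forall>w. computes f (z # xs) w \<longrightarrow> Suc k = w" using mu.IH(2) by blast
    then have "Suc k = 0" using z(1) by blast
    then show ?thesis by simp
  qed simp
qed

primrec trm_code :: "trm \<Rightarrow> nat" where
  "trm_code (Var n) = prod_encode (0, n)"
| "trm_code Zero = prod_encode (1, 0)"
| "trm_code One = prod_encode (2, 0)"
| "trm_code (Add s t) = prod_encode (3, prod_encode (trm_code s, trm_code t))"
| "trm_code (Mul s t) = prod_encode (4, prod_encode (trm_code s, trm_code t))"
| "trm_code (Bin s t) = prod_encode (5, prod_encode (trm_code s, trm_code t))"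
| "trm_code (Fac s) = prod_encode (6, trm_code s)"
| "trm_code (Exp2 s) = prod_encode (7, trm_code s)"

lemma inj_trm_code: "inj trm_code"
proof (rule injI)
  fix s t show "trm_code s = trm_code t \<Longrightarrow> s = t"
    by (induction s arbitrary: t; case_tac t; simp)
qed

definition eqn_code :: "eqn \<Rightarrow> nat" where
  "eqn_code e = prod_encode (trm_code (fst e), trm_code (snd e))"

definition eqns_code :: "eqn list \<Rightarrow> nat" where
  "eqns_code es = list_encode (map eqn_code es)"

end

theory Submission
  imports Defs
begin

text \<open>Entailment is recursively enumerable, so it is enough to refute every non-entailed equation
  \<open>a \<approx> b\<close> in a finite model. The syntactic congruence of the class of \<open>a\<close> separates \<open>a\<close> from
  \<open>b\<close>, and it has finite index as soon as the class contains only finitely many terms in normal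
  form with respect to \<^const>\<open>Omega\<close>. Validity on the natural numbers fixes the value of these normal
  forms when all variables are \<open>3\<close>, and it fixes their variables. This bounds
  everything except the leaves \<open>((1 \<copyright> 1)!)\<dots>!\<close>, which all have value \<open>2\<close>. If two of them are
  equivalent, they can be reduced to finitely many. If not, the number of factorials is
  bounded by a growth argument: replacing \<open>1 \<copyright> 1\<close> by a large number \<open>Y\<close> above a gap between the occurring
  numbers of factorials keeps the laws of \<open>\<Sigma>\<close> true, so along a derivation the growth rate
  in \<open>Y\<close>, and with it the largest number of factorials, stays within bounds.\<close>

section \<open>Computable functions\<close>

text \<open>Why the bound survives derivations of any length: the valuation restarted at level h
  fails to be a homomorphism only at a factorial of \<open>Bn (h - 1)\<close>. One law instance
  meets at most as many such levels as the laws have subterms, and a normal form of value N has at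
  most N leaf indices. So each step has a usable h with a gap below it, and h stays below a
  constant. But h changes from step to step. All steps are therefore compared in the valuation V_0
  with h = 0, at the price of passing from Y to Y + 1. For a step from u to v, V_0(Y, v) <= V_h(Y +
  1, v) = V_h(Y + 1, u) <= V_0(Y + 1, u). The first inequality needs the gap: terms built from
  leaves below it are so small that the gain of the leaves above it absorbs them. After d steps the
  total loss is a shift by d, and Y + d < Y! for large Y, so the loss is less than one factorial,
  whatever d is.\<close>

text \<open>Functions and relations of arity \<open>n\<close> are written as functions of an environment; variable \<open>i\<close>
  is \<open>e i\<close>. Under a binder or in a recursion step the new values are put in front, so the
  premises of the closure rules speak about the shifted environment \<open>\<lambda>i. e (Suc i)\<close>, and the
  rules apply by plain resolution.\<close>

definition computable :: "nat \<Rightarrow> ((nat \<Rightarrow> nat) \<Rightarrow> nat) \<Rightarrow> bool" where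
  "computable n f \<longleftrightarrow> (\<exists>p. \<forall>xs. length xs = n \<longrightarrow> computes p xs (f (nth xs)))"

definition decidable :: "nat \<Rightarrow> ((nat \<Rightarrow> nat) \<Rightarrow> bool) \<Rightarrow> bool" where
  "decidable n P \<longleftrightarrow> computable n (\<lambda>e. if P e then 1 else 0)"

lemma computable_var: "i < n \<Longrightarrow> computable n (\<lambda>e. e i)"
  unfolding computable_def by (rule exI[of _ "RProj i"]) (auto intro: computes.proj)

lemma computable_zero: "computable n (\<lambda>e. 0)"
  unfolding computable_def by (rule exI[of _ RZero]) (auto intro: computes.zero)

lemma computable_comp1:
  assumes "computable 1 (\<lambda>e. g (e 0))" "computable n f"
  shows "computable n (\<lambda>e. g (f e))"
proof -
  obtain p where p: "\<And>xs. length xs = 1 \<Longrightarrow> computes p xs (g (xs ! 0))"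
    using assms(1) unfolding computable_def by blast
  obtain q where q: "\<And>xs. length xs = n \<Longrightarrow> computes q xs (f (nth xs))"
    using assms(2) unfolding computable_def by blast
  show ?thesis unfolding computable_def
  proof (intro exI[of _ "RComp p [q]"] allI impI)
    fix xs :: "nat list" assume "length xs = n"
    then show "computes (RComp p [q]) xs (g (f (nth xs)))"
      using p[of "[f (nth xs)]"] q by (intro computes.comp[of "[f (nth xs)]"]) auto
  qed
qed

text \<open>Lets a recursion be verified once on bare variables. With arbitrary operands in place,
  \<open>computable_rec\<close> would ask for them in the environment extended by counter and
  accumulator.\<close>

lemma computable_comp2:
  assumes "computable 2 (\<lambda>e. g (e 0) (e (Suc 0)))" "computable n f1" "computable n f2"
  shows "computable n (\<lambda>e. g (f1 e) (f2 e))"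
proof -
  obtain p where p: "\<And>xs. length xs = 2 \<Longrightarrow> computes p xs (g (xs ! 0) (xs ! Suc 0))"
    using assms(1) unfolding computable_def by blast
  obtain q1 where q1: "\<And>xs. length xs = n \<Longrightarrow> computes q1 xs (f1 (nth xs))"
    using assms(2) unfolding computable_def by blast
  obtain q2 where q2: "\<And>xs. length xs = n \<Longrightarrow> computes q2 xs (f2 (nth xs))"
    using assms(3) unfolding computable_def by blast
  show ?thesis unfolding computable_def
  proof (intro exI[of _ "RComp p [q1, q2]"] allI impI)
    fix xs :: "nat list" assume "length xs = n"
    then show "computes (RComp p [q1, q2]) xs (g (f1 (nth xs)) (f2 (nth xs)))"
      using p[of "[f1 (nth xs), f2 (nth xs)]"] q1 q2
      by (intro computes.comp[of "[f1 (nth xs), f2 (nth xs)]"]) (auto simp: nth_Cons less_Suc_eq)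
  qed
qed

lemma computable_Suc: assumes "computable n f" shows "computable n (\<lambda>e. Suc (f e))"
proof (rule computable_comp1[OF _ assms])
  show "computable 1 (\<lambda>e. Suc (e 0))"
    unfolding computable_def by (rule exI[of _ RSuc]) (auto simp: length_Suc_conv intro: computes.suc)
qed

lemma computable_const: "computable n (\<lambda>e. c)"
  by (induction c) (auto intro: computable_zero computable_Suc)

lemma computable_rec:
  assumes z: "computable n z" and s: "computable (Suc (Suc n)) (\<lambda>e. s (\<lambda>i. e (Suc (Suc i))) (e 0) (e (Suc 0)))"
    and b: "computable n b"
  shows "computable n (\<lambda>e. rec_nat (z e) (\<lambda>k y. s e k y) (b e))"
proof -
  obtain p where p: "\<And>xs. length xs = n \<Longrightarrow> computes p xs (z (nth xs))"
    using z unfolding computable_def by blast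
  obtain q where q: "\<And>xs. length xs = Suc (Suc n) \<Longrightarrow>
      computes q xs (s (\<lambda>i. xs ! Suc (Suc i)) (xs ! 0) (xs ! Suc 0))"
    using s unfolding computable_def by blast
  obtain r where r: "\<And>xs. length xs = n \<Longrightarrow> computes r xs (b (nth xs))"
    using b unfolding computable_def by blast
  have prim: "computes (RPrim p q) (k # xs) (rec_nat (z (nth xs)) (s (nth xs)) k)"
    if "length xs = n" for k xs
  proof (induction k)
    case 0 then show ?case using p that by (auto intro: computes.prim_0)
  next
    case (Suc k)
    have "computes q (k # rec_nat (z (nth xs)) (s (nth xs)) k # xs)
      (rec_nat (z (nth xs)) (s (nth xs)) (Suc k))"
      using q[of "k # rec_nat (z (nth xs)) (s (nth xs)) k # xs"] that by simp
    with Suc show ?case by (rule computes.prim_Suc)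
  qed
  show ?thesis unfolding computable_def
  \<comment> \<open>The recursion counter comes first; the projections pass the whole environment on
    as parameters.\<close>
  proof (intro exI[of _ "RComp (RPrim p q) (r # map RProj [0..<n])"] allI impI)
    fix xs :: "nat list" assume l: "length xs = n"
    show "computes (RComp (RPrim p q) (r # map RProj [0..<n])) xs
        (rec_nat (z (nth xs)) (s (nth xs)) (b (nth xs)))"
    proof (rule computes.comp[of "b (nth xs) # xs"])
      show "\<forall>i<length (r # map RProj [0..<n]).
        computes ((r # map RProj [0..<n]) ! i) xs ((b (nth xs) # xs) ! i)"
        using l r by (auto simp: nth_Cons split: nat.splits intro: computes.proj)
    qed (use l prim in auto)
  qed
qed

lemma computable_cong: "computable n f \<Longrightarrow> (\<And>e. f e = g e) \<Longrightarrow> computable n g"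
  by (metis ext)

lemma rec_nat_add: "rec_nat (a :: nat) (\<lambda>k y. Suc y) b = a + b"
  by (induction b) auto

lemma rec_nat_mult: "rec_nat (0 :: nat) (\<lambda>k y. y + a) b = a * b"
  by (induction b) auto

lemma rec_nat_power: "rec_nat (1 :: nat) (\<lambda>k y. y * a) b = a ^ b"
  by (induction b) auto

lemma rec_nat_triangle: "rec_nat 0 (\<lambda>k y. y + Suc k) b = triangle b"
  by (induction b) auto

lemma rec_nat_not: "rec_nat (1 :: nat) (\<lambda>k y. 0) b = (if b = 0 then 1 else 0)"
  by (cases b) auto

lemma rec_nat_pred: "rec_nat (0 :: nat) (\<lambda>k y. k) b = b - 1"
  by (cases b) auto

lemma rec_nat_diff: "rec_nat (a :: nat) (\<lambda>k y. y - 1) b = a - b"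
  by (induction b) auto

lemma rec_nat_Ex:
  "rec_nat (0 :: nat) (\<lambda>k y. if P k then 1 else y) (Suc b) = (if \<exists>z\<le>b. P z then 1 else 0)"
  by (induction b) (auto simp: le_Suc_eq)

lemma computable_add: assumes "computable n f" "computable n g" shows "computable n (\<lambda>e. f e + g e)"
  unfolding rec_nat_add[symmetric] by (intro computable_rec computable_Suc computable_var assms) simp_all

lemma computable_mult: assumes "computable n f" "computable n g" shows "computable n (\<lambda>e. f e * g e)"
proof (rule computable_comp2[OF _ assms])
  show "computable 2 (\<lambda>e. e 0 * e (Suc 0))"
    unfolding rec_nat_mult[symmetric] by (intro computable_rec computable_add computable_const computable_var) simp_all
qed

lemma computable_power: assumes "computable n f" "computable n g" shows "computable n (\<lambda>e. f e ^ g e)"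
proof (rule computable_comp2[OF _ assms])
  show "computable 2 (\<lambda>e. e 0 ^ e (Suc 0))"
    unfolding rec_nat_power[symmetric] by (intro computable_rec computable_mult computable_const computable_var) simp_all
qed

lemma computable_diff: assumes "computable n f" "computable n g" shows "computable n (\<lambda>e. f e - g e)"
proof (rule computable_comp2[OF _ assms])
  have pred: "computable k (\<lambda>e. h e - 1)" if "computable k h" for k h
    unfolding rec_nat_pred[symmetric] by (intro computable_rec computable_const computable_var that) simp_all
  have "computable 2 (\<lambda>e. rec_nat (e 0) (\<lambda>k y. y - 1) (e (Suc 0)))"
    by (intro computable_rec pred computable_var) simp_all
  then show "computable 2 (\<lambda>e. e 0 - e (Suc 0))"
    unfolding rec_nat_diff .
qed

lemma computable_pair: assumes "computable n f" "computable n g" shows "computable n (\<lambda>e. prod_encode (f e, g e))"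
proof -
  have tri: "computable n (\<lambda>e. triangle (h e))" if "computable n h" for h
    unfolding rec_nat_triangle[symmetric] by (intro computable_rec computable_add computable_Suc computable_const computable_var that) simp_all
  show ?thesis
    unfolding prod_encode_def prod.case by (intro computable_add tri assms)
qed

lemma decidable_not: "decidable n P \<Longrightarrow> decidable n (\<lambda>e. \<not> P e)"
  unfolding decidable_def
proof -
  assume *: "computable n (\<lambda>e. if P e then 1 else 0)"
  have "computable n (\<lambda>e. 1 - (if P e then 1 else 0))"
    by (intro computable_diff computable_const *)
  then show "computable n (\<lambda>e. if \<not> P e then 1 else 0)"
    by (rule computable_cong) auto
qed

lemma decidable_and: assumes "decidable n P" "decidable n Q" shows "decidable n (\<lambda>e. P e \<and> Q e)"
  unfolding decidable_def
  by (rule computable_cong[OF computable_mult[OF assms[unfolded decidable_def]]]) auto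

lemma decidable_or: assumes "decidable n P" "decidable n Q" shows "decidable n (\<lambda>e. P e \<or> Q e)"
  using decidable_not[OF decidable_and[OF decidable_not[OF assms(1)] decidable_not[OF assms(2)]]] by simp

lemma decidable_eq_0: "computable n f \<Longrightarrow> decidable n (\<lambda>e. f e = 0)"
  unfolding decidable_def rec_nat_not[symmetric] by (intro computable_rec computable_const)

lemma decidable_le: assumes "computable n f" "computable n g" shows "decidable n (\<lambda>e. f e \<le> g e)"
  using decidable_eq_0[OF computable_diff[OF assms]] by simp

lemma decidable_less: assumes "computable n f" "computable n g" shows "decidable n (\<lambda>e. f e < g e)"
  using decidable_le[OF computable_Suc[OF assms(1)] assms(2)] by (simp add: Suc_le_eq)

lemma decidable_eq: assumes "computable n f" "computable n g" shows "decidable n (\<lambda>e. f e = g e)"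
  using decidable_and[OF decidable_le[OF assms] decidable_le[OF assms(2,1)]] by (simp only: order.eq_iff)

lemma computable_if: assumes "decidable n P" "computable n f" "computable n g" shows "computable n (\<lambda>e. if P e then f e else g e)"
proof (rule computable_cong)
  show "computable n (\<lambda>e. (if P e then 1 else 0) * f e + (if \<not> P e then 1 else 0) * g e)"
    by (intro computable_add computable_mult assms assms(1)[unfolded decidable_def] decidable_not[OF assms(1), unfolded decidable_def])
qed auto

text \<open>Bounded search is a recursion whose step sees the accumulator between the counter and
  the environment; the program for \<open>Q\<close> has to skip that entry.\<close>

lemma decidable_shift2:
  assumes "decidable (Suc n) (\<lambda>e. Q (\<lambda>i. e (Suc i)) (e 0))"
  shows "decidable (Suc (Suc n)) (\<lambda>e. Q (\<lambda>i. e (Suc (Suc i))) (e 0))"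
proof -
  obtain p where p: "\<And>xs. length xs = Suc n \<Longrightarrow>
      computes p xs (if Q (\<lambda>i. xs ! Suc i) (xs ! 0) then 1 else 0)"
    using assms unfolding decidable_def computable_def by blast
  let ?gs = "RProj 0 # map (\<lambda>i. RProj (Suc (Suc i))) [0..<n]"
  show ?thesis unfolding decidable_def computable_def
  proof (intro exI[of _ "RComp p ?gs"] allI impI)
    fix xs :: "nat list" assume l: "length xs = Suc (Suc n)"
    then obtain x y zs where xs: "xs = x # y # zs" "length zs = n"
      by (auto simp: length_Suc_conv)
    have *: "computes (?gs ! i) xs ((x # zs) ! i)" if "i < length ?gs" for i
    proof (cases i)
      case 0 then show ?thesis using computes.proj[of 0 xs] xs by simp
    next
      case (Suc j) then show ?thesis using that computes.proj[of "Suc (Suc j)" xs] xs by simp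
    qed
    show "computes (RComp p ?gs) xs (if Q (\<lambda>i. xs ! Suc (Suc i)) (xs ! 0) then 1 else 0)"
    proof (rule computes.comp[of "x # zs"])
      show "length (x # zs) = length ?gs" using xs by simp
      show "\<forall>i<length ?gs. computes (?gs ! i) xs ((x # zs) ! i)" using * by blast
      show "computes p (x # zs) (if Q (\<lambda>i. xs ! Suc (Suc i)) (xs ! 0) then 1 else 0)"
        using p[of "x # zs"] xs by simp
    qed
  qed
qed

lemma decidable_ex_le:
  assumes b: "computable n b" and Q: "decidable (Suc n) (\<lambda>e. Q (\<lambda>i. e (Suc i)) (e 0))"
  shows "decidable n (\<lambda>e. \<exists>z\<le>b e. Q e z)"
proof -
  have "computable (Suc (Suc n)) (\<lambda>e. if Q (\<lambda>i. e (Suc (Suc i))) (e 0) then 1 else e (Suc 0))"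
    by (rule computable_if[OF decidable_shift2[where Q = Q, OF Q]]) (simp_all add: computable_const computable_var)
  from computable_rec[where s = "\<lambda>e k y. if Q e k then 1 else y" and z = "\<lambda>e. 0", OF computable_const this computable_Suc[OF b]]
  show ?thesis
    unfolding decidable_def rec_nat_Ex .
qed

lemma decidable_all_le:
  assumes b: "computable n b" and Q: "decidable (Suc n) (\<lambda>e. Q (\<lambda>i. e (Suc i)) (e 0))"
  shows "decidable n (\<lambda>e. \<forall>z\<le>b e. Q e z)"
proof -
  have "decidable n (\<lambda>e. \<not> (\<exists>z\<le>b e. \<not> Q e z))"
    using decidable_not[OF decidable_ex_le[where Q = "\<lambda>e z. \<not> Q e z", OF b decidable_not[where P = "\<lambda>e. Q (\<lambda>i. e (Suc i)) (e 0)", OF Q]]] .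
  then show ?thesis by (simp only: not_ex not_not de_Morgan_conj imp_conv_disj)
qed

lemmas computable_intros = computable_var computable_const computable_Suc computable_add computable_mult computable_power computable_pair
  decidable_not decidable_and decidable_or decidable_le decidable_less decidable_eq decidable_ex_le decidable_all_le

text \<open>Unbounded search in the form of the final algorithm: \<open>P\<close> recognizes a
  conclusive certificate, \<open>Q\<close> reads the answer off the least one. Nothing is claimed
  for inputs without a witness.\<close>

lemma computes_search:
  assumes P: "decidable (Suc n) (\<lambda>e. P (\<lambda>i. e (Suc i)) (e 0))"
    and Q: "decidable (Suc n) (\<lambda>e. Q (\<lambda>i. e (Suc i)) (e 0))"
  shows "\<exists>p. \<forall>xs. length xs = n \<longrightarrow> (\<exists>w. P (nth xs) w) \<longrightarrow>
    computes p xs (if Q (nth xs) (LEAST w. P (nth xs) w) then 1 else 0)"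
proof -
  \<comment> \<open>\<open>RMu\<close> stops at the value 0, so it is given the program for the
    negation of \<open>P\<close>.\<close>
  obtain p where p: "\<And>xs. length xs = Suc n \<Longrightarrow>
      computes p xs (if \<not> P (\<lambda>i. xs ! Suc i) (xs ! 0) then 1 else 0)"
    using decidable_not[where P = "\<lambda>e. P (\<lambda>i. e (Suc i)) (e 0)", OF P] unfolding decidable_def computable_def by blast
  obtain q where q: "\<And>xs. length xs = Suc n \<Longrightarrow>
      computes q xs (if Q (\<lambda>i. xs ! Suc i) (xs ! 0) then 1 else 0)"
    using Q unfolding decidable_def computable_def by blast
  show ?thesis
  proof (intro exI[of _ "RComp q (RMu p # map RProj [0..<n])"] allI impI)
    fix xs :: "nat list" assume l: "length xs = n" and ex: "\<exists>w. P (nth xs) w"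
    define w where "w = (LEAST w. P (nth xs) w)"
    have w: "P (nth xs) w" "\<And>v. v < w \<Longrightarrow> \<not> P (nth xs) v"
      using LeastI_ex[OF ex] not_less_Least unfolding w_def by blast+
    have mu: "computes (RMu p) xs w"
    proof (rule computes.mu)
      show "computes p (w # xs) 0" using p[of "w # xs"] l w(1) by simp
      show "\<forall>m<w. \<exists>k. computes p (m # xs) (Suc k)"
      proof (intro allI impI)
        fix m assume "m < w"
        then have "computes p (m # xs) (Suc 0)" using p[of "m # xs"] l w(2) by simp
        then show "\<exists>k. computes p (m # xs) (Suc k)" ..
      qed
    qed
    show "computes (RComp q (RMu p # map RProj [0..<n])) xs
        (if Q (nth xs) (LEAST w. P (nth xs) w) then 1 else 0)"
    proof (rule computes.comp[of "w # xs"])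
      show "\<forall>i<length (RMu p # map RProj [0..<n]).
        computes ((RMu p # map RProj [0..<n]) ! i) xs ((w # xs) ! i)"
        using l mu by (auto simp: nth_Cons split: nat.splits intro: computes.proj)
    qed (use l q[of "w # xs"] w_def in auto)
  qed
qed

section \<open>A semidecidable calculus for entailment and refutation\<close>

text \<open>Three premises suffice for every rule of the calculus below; a rule with fewer premises
  is fed repetitions.\<close>

inductive der :: "(nat \<Rightarrow> bool) \<Rightarrow> (nat \<Rightarrow> nat \<Rightarrow> nat \<Rightarrow> nat \<Rightarrow> bool) \<Rightarrow> nat \<Rightarrow> bool"
  for A R where
  der_ax: "A f \<Longrightarrow> der A R f"
| der_step: "der A R p \<Longrightarrow> der A R q \<Longrightarrow> der A R r \<Longrightarrow> R p q r f \<Longrightarrow> der A R f"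

abbreviation pr :: "nat \<Rightarrow> nat \<Rightarrow> nat" where
  "pr x y \<equiv> prod_encode (x, y)"

text \<open>Bit \<open>f\<close> of \<open>w\<close>: numbers serve as finite sets, as in
  \<open>set_decode\<close>. Bounded witnesses replace division, so that the closure rules
  apply.\<close>

definition mem :: "nat \<Rightarrow> nat \<Rightarrow> bool" where
  "mem f w \<longleftrightarrow> (\<exists>q\<le>w. \<exists>r\<le>w. w = Suc (2 * q) * 2 ^ f + r \<and> r < 2 ^ f)"

lemma mem_iff: "mem f w \<longleftrightarrow> f \<in> set_decode w"
proof
  assume "mem f w"
  then obtain q r where "w = r + Suc (2 * q) * 2 ^ f" "r < 2 ^ f"
    unfolding mem_def by (auto simp: add.commute)
  then have "w div 2 ^ f = Suc (2 * q)"
    by (simp only: div_mult_self1[OF power_not_zero] zero_neq_numeral[symmetric]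
        not_False_eq_True div_less)
  then show "f \<in> set_decode w" by (simp add: set_decode_def)
next
  assume "f \<in> set_decode w"
  then obtain q where q: "w div 2 ^ f = Suc (2 * q)"
    by (auto simp: set_decode_def elim: oddE)
  have w: "w = Suc (2 * q) * 2 ^ f + w mod 2 ^ f"
    using q div_mult_mod_eq[of w "2 ^ f"] by metis
  moreover have "q \<le> w"
    using q div_le_dividend[of w "2 ^ f"] by simp
  ultimately show "mem f w" unfolding mem_def by (metis mod_le_divisor mod_less_eq_dividend
        mod_less_divisor zero_less_numeral zero_less_power)
qed

lemma mem_less: assumes "mem f w" shows "f < w"
proof -
  obtain q r where "w = Suc (2 * q) * 2 ^ f + r" using assms unfolding mem_def by blast
  then have "2 ^ f \<le> w" by simp
  then show ?thesis using less_exp[of f] by linarith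
qed

text \<open>A certificate is a finite set of pairs of a stage and a fact. The stages make justifications
  well-founded, and they let certificates be combined by union.\<close>

definition cert :: "(nat \<Rightarrow> bool) \<Rightarrow> (nat \<Rightarrow> nat \<Rightarrow> nat \<Rightarrow> nat \<Rightarrow> bool) \<Rightarrow> nat \<Rightarrow> bool" where
  "cert A R w \<longleftrightarrow> (\<forall>i\<le>w. \<forall>f\<le>w. \<not> mem (pr i f) w \<or> A f \<or>
    (\<exists>p\<le>w. \<exists>q\<le>w. \<exists>r\<le>w. R p q r f \<and> (\<exists>j\<le>w. j < i \<and> mem (pr j p) w) \<and>
      (\<exists>j\<le>w. j < i \<and> mem (pr j q) w) \<and> (\<exists>j\<le>w. j < i \<and> mem (pr j r) w)))"

lemma mem_pr_le: "mem (pr i f) w \<Longrightarrow> i \<le> w \<and> f \<le> w"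
  using mem_less[of "pr i f" w] le_prod_encode_1[of i f] le_prod_encode_2[of f i] by linarith

definition justified :: "(nat \<Rightarrow> bool) \<Rightarrow> (nat \<Rightarrow> nat \<Rightarrow> nat \<Rightarrow> nat \<Rightarrow> bool) \<Rightarrow> nat set \<Rightarrow> bool" where
  "justified A R W \<longleftrightarrow> (\<forall>i f. pr i f \<in> W \<longrightarrow> A f \<or>
    (\<exists>p q r j k l. R p q r f \<and> j < i \<and> pr j p \<in> W \<and> k < i \<and> pr k q \<in> W \<and> l < i \<and> pr l r \<in> W))"

lemma cert_iff: "cert A R w \<longleftrightarrow> justified A R (set_decode w)"
proof
  assume c: "cert A R w"
  show "justified A R (set_decode w)"
    unfolding justified_def mem_iff[symmetric]
  proof (intro allI impI)
    fix i f assume m: "mem (pr i f) w"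
    then have "i \<le> w" "f \<le> w" using mem_pr_le by blast+
    with c m show "A f \<or> (\<exists>p q r j k l. R p q r f \<and> j < i \<and> mem (pr j p) w \<and>
        k < i \<and> mem (pr k q) w \<and> l < i \<and> mem (pr l r) w)"
      unfolding cert_def by blast
  qed
next
  assume j: "justified A R (set_decode w)"
  show "cert A R w"
    unfolding cert_def
  proof (intro allI impI)
    fix i f assume "i \<le> w" "f \<le> w"
    show "\<not> mem (pr i f) w \<or> A f \<or>
      (\<exists>p\<le>w. \<exists>q\<le>w. \<exists>r\<le>w. R p q r f \<and> (\<exists>j\<le>w. j < i \<and> mem (pr j p) w) \<and>
        (\<exists>j\<le>w. j < i \<and> mem (pr j q) w) \<and> (\<exists>j\<le>w. j < i \<and> mem (pr j r) w))"
    proof (cases "mem (pr i f) w \<and> \<not> A f")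
      case True
      then obtain p q r j k l where *: "R p q r f" "j < i" "mem (pr j p) w" "k < i" "mem (pr k q) w"
        "l < i" "mem (pr l r) w"
        using j unfolding justified_def mem_iff[symmetric] by blast
      then show ?thesis using mem_pr_le by blast
    qed blast
  qed
qed

lemma justified_mono:
  assumes "justified A R V" "V \<subseteq> W" "pr i f \<in> V"
  shows "A f \<or> (\<exists>p q r j k l. R p q r f \<and> j < i \<and> pr j p \<in> W \<and> k < i \<and> pr k q \<in> W \<and>
    l < i \<and> pr l r \<in> W)"
  using assms unfolding justified_def by (meson subsetD)

lemma justified_Un: "justified A R V \<Longrightarrow> justified A R W \<Longrightarrow> justified A R (V \<union> W)"
  unfolding justified_def[of _ _ "V \<union> W"]
  using justified_mono[of A R V "V \<union> W"] justified_mono[of A R W "V \<union> W"] by blast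

lemma justified_sound: "justified A R W \<Longrightarrow> pr i f \<in> W \<Longrightarrow> der A R f"
proof (induction i arbitrary: f rule: less_induct)
  case (less i)
  from justified_mono[OF less.prems(1) order_refl less.prems(2)] show ?case
    using less.IH[OF _ less.prems(1)] by (blast intro: der.intros)
qed

lemma justified_complete: "der A R f \<Longrightarrow> \<exists>W i. finite W \<and> justified A R W \<and> pr i f \<in> W"
proof (induction rule: der.induct)
  case (der_ax f)
  then have "justified A R {pr 0 f}" unfolding justified_def by simp
  then show ?case by blast
next
  case (der_step p q r f)
  then obtain P i Q j S k where W: "finite P" "justified A R P" "pr i p \<in> P"
    "finite Q" "justified A R Q" "pr j q \<in> Q" "finite S" "justified A R S" "pr k r \<in> S" by blast
  define W where "W = P \<union> Q \<union> S"
  \<comment> \<open>A stage later than those of all three premises.\<close>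
  define n where "n = Suc (i + j + k)"
  have "justified A R W" unfolding W_def by (intro justified_Un W)
  have prem: "i < n" "pr i p \<in> W" "j < n" "pr j q \<in> W" "k < n" "pr k r \<in> W"
    using W unfolding W_def n_def by auto
  have "justified A R (insert (pr n f) W)"
    unfolding justified_def
  proof (intro allI impI)
    fix i' f' assume "pr i' f' \<in> insert (pr n f) W"
    then consider "i' = n" "f' = f" | "pr i' f' \<in> W" by auto
    then show "A f' \<or> (\<exists>p q r j k l. R p q r f' \<and> j < i' \<and> pr j p \<in> insert (pr n f) W \<and>
      k < i' \<and> pr k q \<in> insert (pr n f) W \<and> l < i' \<and> pr l r \<in> insert (pr n f) W)"
    proof cases
      case 1
      then show ?thesis using prem der_step.hyps(4) by blast
    next
      case 2
      with justified_mono[OF \<open>justified A R W\<close> subset_insertI] show ?thesis by blast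
    qed
  qed
  moreover have "finite (insert (pr n f) W)" using W unfolding W_def by simp
  ultimately show ?case by (intro exI[of _ "insert (pr n f) W"] exI[of _ n]) simp
qed

lemma der_cert: "der A R f \<longleftrightarrow> (\<exists>w. cert A R w \<and> (\<exists>i\<le>w. mem (pr i f) w))"
proof
  assume "der A R f"
  then obtain W i where W: "finite W" "justified A R W" "pr i f \<in> W"
    using justified_complete by blast
  then have "cert A R (set_encode W) \<and> mem (pr i f) (set_encode W)"
    by (simp add: cert_iff mem_iff)
  then show "\<exists>w. cert A R w \<and> (\<exists>i\<le>w. mem (pr i f) w)" using mem_pr_le by blast
next
  assume "\<exists>w. cert A R w \<and> (\<exists>i\<le>w. mem (pr i f) w)"
  then show "der A R f" by (metis cert_iff justified_sound mem_iff)
qed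

section \<open>Finite sequences as digits of a number\<close>

definition digit :: "nat \<Rightarrow> nat \<Rightarrow> nat \<Rightarrow> nat" where
  "digit m c n = c div m ^ n mod m"

text \<open>Two Euclidean divisions with bounded witnesses, hence decidable by the closure rules;
  \<open>d < m\<close> excludes the base 0.\<close>

definition is_digit :: "nat \<Rightarrow> nat \<Rightarrow> nat \<Rightarrow> nat \<Rightarrow> bool" where
  "is_digit m c n d \<longleftrightarrow> (\<exists>q\<le>c. \<exists>r\<le>c. \<exists>s\<le>c.
    c = q * m ^ n + r \<and> r < m ^ n \<and> q = s * m + d \<and> d < m)"

lemma is_digit_iff: "is_digit m c n d \<longleftrightarrow> m > 0 \<and> d = digit m c n"
proof
  assume "is_digit m c n d"
  then obtain q r s where *: "c = q * m ^ n + r" "r < m ^ n" "q = s * m + d" "d < m"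
    unfolding is_digit_def by blast
  then have "c div m ^ n = q" by simp
  then show "m > 0 \<and> d = digit m c n" using * unfolding digit_def by simp
next
  assume *: "m > 0 \<and> d = digit m c n"
  define q r s where "q = c div m ^ n" and "r = c mod m ^ n" and "s = q div m"
  have "q \<le> c" "r \<le> c" unfolding q_def r_def by simp_all
  moreover have "s \<le> c" unfolding s_def using \<open>q \<le> c\<close> div_le_dividend order_trans by blast
  moreover have "c = q * m ^ n + r" unfolding q_def r_def by (rule div_mult_mod_eq[symmetric])
  moreover have "r < m ^ n" "d < m" unfolding r_def using * by (simp_all add: digit_def)
  moreover have "q = s * m + d"
    unfolding s_def using * div_mult_mod_eq[of q m] by (simp only: digit_def q_def)
  ultimately show "is_digit m c n d" unfolding is_digit_def by blast
qed

lemma digit_less: "m > 0 \<Longrightarrow> digit m c n < m"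
  by (simp add: digit_def)

text \<open>The induction puts a leading digit \<open>g B\<close> in front. The bound
  \<open>m ^ B\<close> matters because a refutation checks only the assignments coded below
  \<open>m ^ e\<close>.\<close>

lemma digits_exist:
  assumes "m > 0" "\<And>i. i < B \<Longrightarrow> g i < m"
  shows "\<exists>c < m ^ B. \<forall>i<B. digit m c i = g i"
  using assms(2)
proof (induction B)
  case 0
  then show ?case by simp
next
  case (Suc B)
  then obtain c where c: "c < m ^ B" "\<forall>i<B. digit m c i = g i"
    by (meson less_Suc_eq)
  have "c + g B * m ^ B < m ^ B + g B * m ^ B" using c by simp
  also have "\<dots> = Suc (g B) * m ^ B" by simp
  also have "\<dots> \<le> m * m ^ B" using Suc.prems[of B] by (intro mult_right_mono) auto
  finally have 1: "c + g B * m ^ B < m ^ Suc B" by simp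
  have "digit m (c + g B * m ^ B) i = g i" if "i < Suc B" for i
  proof (cases "i = B")
    case True
    then show ?thesis using c Suc.prems[of B] assms(1) by (simp add: digit_def)
  next
    case False
    then have "i < B" using that by simp
    then obtain k where B: "B = i + Suc k" by (metis less_imp_Suc_add add_Suc_right)
    have "m ^ B = m ^ i * (m * m ^ k)" by (simp add: B power_add)
    then have "c + g B * m ^ B = c + m ^ i * (g B * m ^ k * m)"
      by (simp only: ac_simps)
    moreover have "(c + m ^ i * (g B * m ^ k * m)) div m ^ i = g B * m ^ k * m + c div m ^ i"
      using assms(1) by (intro div_mult_self2) simp
    ultimately have "digit m (c + g B * m ^ B) i = (g B * m ^ k * m + c div m ^ i) mod m"
      by (simp only: digit_def)
    also have "\<dots> = digit m c i"
      by (simp add: digit_def)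
    finally have "digit m (c + g B * m ^ B) i = digit m c i" .
    then show ?thesis using c(2) \<open>i < B\<close> by metis
  qed
  with 1 show ?case by blast
qed

section \<open>The calculus of facts and its bounded form\<close>

abbreviation "fsuffix l \<equiv> pr 0 l"
abbreviation "frel k s t \<equiv> pr 6 (pr k (pr s t))"
abbreviation "feval M \<rho> s v \<equiv> pr 2 (pr M (pr \<rho> (pr s v)))"
abbreviation "fok M \<rho> l \<equiv> pr 3 (pr M (pr \<rho> l))"
abbreviation "fall M r \<equiv> pr 4 (pr M r)"
abbreviation "fneg s t \<equiv> pr 5 (pr s t)"

text \<open>Both entailment and its refutation by a finite algebra are derivations in one calculus on
  numbers. The relation \<open>frel 0\<close> is provable equality and \<open>frel (Suc (pr b c))\<close> relates a
  term to its instance under the substitution whose values are the base-\<open>b\<close> digits of \<open>c\<close>.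
  The algebra \<open>pr m T\<close> has carrier \<open>{..<m}\<close> and its operation tables are the base-\<open>m\<close> digits
  of \<open>T\<close>. Only variables smaller than \<open>e\<close> occur in the equations coded by \<open>e\<close>, hence all
  assignments are among the digit sequences of the numbers below \<open>m ^ e\<close>.\<close>

inductive prov :: "nat \<Rightarrow> nat \<Rightarrow> bool" for e where
  suffix_all: "prov e (fsuffix e)"
| suffix_tl: "prov e (fsuffix (Suc (pr c l))) \<Longrightarrow> prov e (fsuffix l)"
| rel_const: "c = 1 \<or> c = 2 \<Longrightarrow> prov e (frel k (pr c 0) (pr c 0))"
| rel_bin: "prov e (frel k s s') \<Longrightarrow> prov e (frel k t t') \<Longrightarrow> 3 \<le> c \<Longrightarrow> c \<le> 5 \<Longrightarrow>
    prov e (frel k (pr c (pr s t)) (pr c (pr s' t')))"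
| rel_un: "prov e (frel k s s') \<Longrightarrow> 6 \<le> c \<Longrightarrow> c \<le> 7 \<Longrightarrow> prov e (frel k (pr c s) (pr c s'))"
| rel_var: "prov e (frel 0 (pr 0 n) (pr 0 n))"
| rel_sym: "prov e (frel 0 s t) \<Longrightarrow> prov e (frel 0 t s)"
| rel_trans: "prov e (frel 0 s t) \<Longrightarrow> prov e (frel 0 t u) \<Longrightarrow> prov e (frel 0 s u)"
| rel_ax: "prov e (fsuffix (Suc (pr (pr s t) l))) \<Longrightarrow> prov e (frel (Suc k) s s') \<Longrightarrow>
    prov e (frel (Suc k) t t') \<Longrightarrow> prov e (frel 0 s' t')"
| subst_var: "prov e (frel 0 t t) \<Longrightarrow> is_digit b c n t \<Longrightarrow> prov e (frel (Suc (pr b c)) (pr 0 n) t)"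
| eval_var: "is_digit m \<rho> n v \<Longrightarrow> prov e (feval (pr m T) \<rho> (pr 0 n) v)"
| eval_const: "c = 1 \<or> c = 2 \<Longrightarrow> is_digit m T (pr c (pr 0 0)) v \<Longrightarrow>
    prov e (feval (pr m T) \<rho> (pr c 0) v)"
| eval_bin: "prov e (feval (pr m T) \<rho> s x) \<Longrightarrow> prov e (feval (pr m T) \<rho> t y) \<Longrightarrow>
    3 \<le> c \<Longrightarrow> c \<le> 5 \<Longrightarrow> is_digit m T (pr c (pr x y)) v \<Longrightarrow>
    prov e (feval (pr m T) \<rho> (pr c (pr s t)) v)"
| eval_un: "prov e (feval (pr m T) \<rho> s x) \<Longrightarrow> 6 \<le> c \<Longrightarrow> c \<le> 7 \<Longrightarrow>
    is_digit m T (pr c (pr x 0)) v \<Longrightarrow> prov e (feval (pr m T) \<rho> (pr c s) v)"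
| ok_Nil: "prov e (fok M \<rho> 0)"
| ok_Cons: "prov e (fok M \<rho> l) \<Longrightarrow> prov e (feval M \<rho> s v) \<Longrightarrow> prov e (feval M \<rho> t v) \<Longrightarrow>
    prov e (fok M \<rho> (Suc (pr (pr s t) l)))"
| all_0: "prov e (fall M 0)"
| all_Suc: "prov e (fall M \<rho>) \<Longrightarrow> prov e (fok M \<rho> e) \<Longrightarrow> prov e (fall M (Suc \<rho>))"
| neg: "prov e (fall (pr m T) (m ^ e)) \<Longrightarrow> prov e (feval (pr m T) \<rho> s x) \<Longrightarrow>
    prov e (feval (pr m T) \<rho> t y) \<Longrightarrow> x \<noteq> y \<Longrightarrow> prov e (fneg s t)"

text \<open>\<open>axs\<close> and \<open>rules\<close> restate \<open>prov\<close> with every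
  quantifier bounded, which makes \<open>cert\<close> decidable. The bounds lose nothing, because a
  pair is at least as large as its components.\<close>

definition axs :: "nat \<Rightarrow> nat \<Rightarrow> bool" where
  "axs e f \<longleftrightarrow> f = fsuffix e
  \<or> (\<exists>k\<le>f. \<exists>c\<le>2. (c = 1 \<or> c = 2) \<and> f = frel k (pr c 0) (pr c 0))
  \<or> (\<exists>n\<le>f. f = frel 0 (pr 0 n) (pr 0 n))
  \<or> (\<exists>m\<le>f. \<exists>T\<le>f. \<exists>\<rho>\<le>f. \<exists>n\<le>f. \<exists>v\<le>f. f = feval (pr m T) \<rho> (pr 0 n) v \<and> is_digit m \<rho> n v)
  \<or> (\<exists>m\<le>f. \<exists>T\<le>f. \<exists>\<rho>\<le>f. \<exists>c\<le>2. \<exists>v\<le>f. f = feval (pr m T) \<rho> (pr c 0) v \<and> (c = 1 \<or> c = 2)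
      \<and> is_digit m T (pr c (pr 0 0)) v)
  \<or> (\<exists>M\<le>f. \<exists>\<rho>\<le>f. f = fok M \<rho> 0)
  \<or> (\<exists>M\<le>f. f = fall M 0)"

definition rules :: "nat \<Rightarrow> nat \<Rightarrow> nat \<Rightarrow> nat \<Rightarrow> nat \<Rightarrow> bool" where
  "rules e p q r f \<longleftrightarrow> (\<exists>l\<le>f. \<exists>c\<le>p. f = fsuffix l \<and> p = fsuffix (Suc (pr c l)))
  \<or> (\<exists>k\<le>f. \<exists>s\<le>f. \<exists>s'\<le>f. \<exists>t\<le>f. \<exists>t'\<le>f. \<exists>c\<le>5. f = frel k (pr c (pr s t)) (pr c (pr s' t'))
      \<and> 3 \<le> c \<and> p = frel k s s' \<and> q = frel k t t')
  \<or> (\<exists>k\<le>f. \<exists>s\<le>f. \<exists>s'\<le>f. \<exists>c\<le>7. f = frel k (pr c s) (pr c s') \<and> 6 \<le> c \<and> p = frel k s s')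
  \<or> (\<exists>s\<le>f. \<exists>t\<le>f. f = frel 0 t s \<and> p = frel 0 s t)
  \<or> (\<exists>s\<le>f. \<exists>u\<le>f. \<exists>t\<le>p. f = frel 0 s u \<and> p = frel 0 s t \<and> q = frel 0 t u)
  \<or> (\<exists>s'\<le>f. \<exists>t'\<le>f. \<exists>s\<le>p. \<exists>t\<le>p. \<exists>l\<le>p. \<exists>k\<le>q. f = frel 0 s' t'
      \<and> p = fsuffix (Suc (pr (pr s t) l)) \<and> q = frel (Suc k) s s' \<and> r = frel (Suc k) t t')
  \<or> (\<exists>b\<le>f. \<exists>c\<le>f. \<exists>n\<le>f. \<exists>t\<le>f. f = frel (Suc (pr b c)) (pr 0 n) t
      \<and> is_digit b c n t \<and> p = frel 0 t t)
  \<or> (\<exists>m\<le>f. \<exists>T\<le>f. \<exists>\<rho>\<le>f. \<exists>s\<le>f. \<exists>t\<le>f. \<exists>v\<le>f. \<exists>c\<le>5. \<exists>x\<le>p. \<exists>y\<le>q.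
      f = feval (pr m T) \<rho> (pr c (pr s t)) v \<and> 3 \<le> c \<and> is_digit m T (pr c (pr x y)) v
      \<and> p = feval (pr m T) \<rho> s x \<and> q = feval (pr m T) \<rho> t y)
  \<or> (\<exists>m\<le>f. \<exists>T\<le>f. \<exists>\<rho>\<le>f. \<exists>s\<le>f. \<exists>v\<le>f. \<exists>c\<le>7. \<exists>x\<le>p.
      f = feval (pr m T) \<rho> (pr c s) v \<and> 6 \<le> c \<and> is_digit m T (pr c (pr x 0)) v
      \<and> p = feval (pr m T) \<rho> s x)
  \<or> (\<exists>M\<le>f. \<exists>\<rho>\<le>f. \<exists>l\<le>f. \<exists>s\<le>f. \<exists>t\<le>f. \<exists>v\<le>q. f = fok M \<rho> (Suc (pr (pr s t) l))
      \<and> p = fok M \<rho> l \<and> q = feval M \<rho> s v \<and> r = feval M \<rho> t v)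
  \<or> (\<exists>M\<le>f. \<exists>\<rho>\<le>f. f = fall M (Suc \<rho>) \<and> p = fall M \<rho> \<and> q = fok M \<rho> e)
  \<or> (\<exists>s\<le>f. \<exists>t\<le>f. \<exists>m\<le>p. \<exists>T\<le>p. \<exists>\<rho>\<le>q. \<exists>x\<le>q. \<exists>y\<le>r. f = fneg s t \<and> x \<noteq> y
      \<and> p = fall (pr m T) (m ^ e) \<and> q = feval (pr m T) \<rho> s x \<and> r = feval (pr m T) \<rho> t y)"

lemma le_pr: "x \<le> a \<Longrightarrow> x \<le> pr a b" "x \<le> b \<Longrightarrow> x \<le> pr a b"
  using le_prod_encode_1[of a b] le_prod_encode_2[of b a] by auto

lemma der_prov: "der (axs e) (rules e) f \<Longrightarrow> prov e f"
proof (induction rule: der.induct)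
  case (der_ax f)
  then show ?case unfolding axs_def
    apply (elim disjE exE conjE)
    subgoal by (simp only:) (rule prov.suffix_all; (assumption | simp))
    subgoal by (simp only:) (rule prov.rel_const; (assumption | simp))
    subgoal by (simp only:) (rule prov.rel_const; (assumption | simp))
    subgoal by (simp only:) (rule prov.rel_var; (assumption | simp))
    subgoal by (simp only:) (rule prov.eval_var; (assumption | simp))
    subgoal by (simp only:) (rule prov.eval_const; (assumption | simp))
    subgoal by (simp only:) (rule prov.eval_const; (assumption | simp))
    subgoal by (simp only:) (rule prov.ok_Nil; (assumption | simp))
    subgoal by (simp only:) (rule prov.all_0; (assumption | simp))
    done
next
  case (der_step p q r f)
  from der_step.hyps(4) der_step.IH show ?case unfolding rules_def
    apply (elim disjE exE conjE)
    subgoal by (simp only:) (rule prov.suffix_tl)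
    subgoal by (simp only:) (rule prov.rel_bin)
    subgoal by (simp only:) (rule prov.rel_un)
    subgoal by (simp only:) (rule prov.rel_sym)
    subgoal by (simp only:) (rule prov.rel_trans)
    subgoal by (simp only:) (rule prov.rel_ax)
    subgoal by (simp only:) (rule prov.subst_var)
    subgoal by (simp only:) (rule prov.eval_bin)
    subgoal by (simp only:) (rule prov.eval_un)
    subgoal by (simp only:) (rule prov.ok_Cons)
    subgoal by (simp only:) (rule prov.all_Suc)
    subgoal by (simp only:) (rule prov.neg)
    done
qed

lemma prov_der: "prov e f \<Longrightarrow> der (axs e) (rules e) f"
proof (induction rule: prov.induct)
  case suffix_all show ?case by (rule der_ax) (simp add: axs_def)
next
  case (suffix_tl c l)
  from suffix_tl.IH suffix_tl.IH suffix_tl.IH show ?case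
    by (rule der_step) (simp add: rules_def le_pr le_SucI)
next
  case (rel_const c k)
  then show ?case by (intro der_ax) (auto simp: axs_def le_pr)
next
  case (rel_bin k s s' t t' c)
  from rel_bin.IH rel_bin.IH(1) show ?case
    by (rule der_step) (use rel_bin.hyps in \<open>simp add: rules_def le_pr\<close>)
next
  case (rel_un k s s' c)
  from rel_un.IH rel_un.IH rel_un.IH show ?case
    by (rule der_step) (use rel_un.hyps in \<open>simp add: rules_def le_pr\<close>)
next
  case (rel_var n)
  show ?case by (intro der_ax) (simp add: axs_def le_pr)
next
  case (rel_sym s t)
  from rel_sym.IH rel_sym.IH rel_sym.IH show ?case
    by (rule der_step) (simp add: rules_def le_pr)
next
  case (rel_trans s t u)
  from rel_trans.IH rel_trans.IH(1) show ?case
    by (rule der_step) (simp add: rules_def le_pr)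
next
  case (rel_ax s t l k s' t')
  from rel_ax.IH show ?case
    by (rule der_step) (simp add: rules_def le_pr le_SucI)
next
  case (subst_var t b c n)
  from subst_var.IH subst_var.IH subst_var.IH show ?case
    by (rule der_step) (use subst_var.hyps in \<open>simp add: rules_def le_pr le_SucI\<close>)
next
  case (eval_var m \<rho> n v T)
  then show ?case by (intro der_ax) (simp add: axs_def le_pr)
next
  case (eval_const c m T v \<rho>)
  then show ?case by (intro der_ax) (auto simp add: axs_def le_pr)
next
  case (eval_bin m T \<rho> s x t y c v)
  from eval_bin.IH eval_bin.IH(1) show ?case
    by (rule der_step) (use eval_bin.hyps in \<open>simp add: rules_def le_pr; blast intro: le_pr order_refl\<close>)
next
  case (eval_un m T \<rho> s x c v)
  from eval_un.IH eval_un.IH eval_un.IH show ?case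
    by (rule der_step) (use eval_un.hyps in \<open>simp add: rules_def le_pr; blast intro: le_pr order_refl\<close>)
next
  case (ok_Nil M \<rho>)
  show ?case by (intro der_ax) (simp add: axs_def le_pr)
next
  case (ok_Cons M \<rho> l s v t)
  from ok_Cons.IH show ?case
    by (rule der_step) (simp add: rules_def le_pr le_SucI)
next
  case (all_0 M)
  show ?case by (intro der_ax) (simp add: axs_def le_pr)
next
  case (all_Suc M \<rho>)
  from all_Suc.IH all_Suc.IH(1) show ?case
    by (rule der_step) (simp add: rules_def le_pr le_SucI)
next
  case (neg m T \<rho> s x t y)
  from neg.IH show ?case
    by (rule der_step) (use neg.hyps in \<open>simp add: rules_def le_pr; blast intro: le_pr order_refl\<close>)
qed

section \<open>Decidability of certificates and the search program\<close>

lemma computable_comp4: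
  assumes g: "computable 4 (\<lambda>e. g (e 0) (e (Suc 0)) (e (Suc (Suc 0))) (e (Suc (Suc (Suc 0)))))"
    and f: "computable n f1" "computable n f2" "computable n f3" "computable n f4"
  shows "computable n (\<lambda>e. g (f1 e) (f2 e) (f3 e) (f4 e))"
proof -
  obtain p where p: "\<And>xs. length xs = 4 \<Longrightarrow>
      computes p xs (g (xs ! 0) (xs ! Suc 0) (xs ! Suc (Suc 0)) (xs ! Suc (Suc (Suc 0))))"
    using g unfolding computable_def by blast
  obtain q1 q2 q3 q4 where q: "\<And>xs. length xs = n \<Longrightarrow> computes q1 xs (f1 (nth xs))"
    "\<And>xs. length xs = n \<Longrightarrow> computes q2 xs (f2 (nth xs))"
    "\<And>xs. length xs = n \<Longrightarrow> computes q3 xs (f3 (nth xs))"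
    "\<And>xs. length xs = n \<Longrightarrow> computes q4 xs (f4 (nth xs))"
    using f unfolding computable_def by blast
  show ?thesis unfolding computable_def
  proof (intro exI[of _ "RComp p [q1, q2, q3, q4]"] allI impI)
    fix xs :: "nat list" assume "length xs = n"
    then show "computes (RComp p [q1, q2, q3, q4]) xs
        (g (f1 (nth xs)) (f2 (nth xs)) (f3 (nth xs)) (f4 (nth xs)))"
      using p[of "[f1 (nth xs), f2 (nth xs), f3 (nth xs), f4 (nth xs)]"] q
      by (intro computes.comp[of "[f1 (nth xs), f2 (nth xs), f3 (nth xs), f4 (nth xs)]"])
        (auto simp: nth_Cons less_Suc_eq)
  qed
qed

lemma decidable_mem: assumes "computable n f" "computable n g" shows "decidable n (\<lambda>e. mem (f e) (g e))"
  unfolding decidable_def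
proof (rule computable_comp2[OF _ assms])
  show "computable 2 (\<lambda>e. if mem (e 0) (e (Suc 0)) then 1 else 0)"
    unfolding decidable_def[symmetric] mem_def by (intro computable_intros; simp)
qed

lemma decidable_is_digit:
  assumes "computable n f1" "computable n f2" "computable n f3" "computable n f4"
  shows "decidable n (\<lambda>e. is_digit (f1 e) (f2 e) (f3 e) (f4 e))"
  unfolding decidable_def
proof (rule computable_comp4[OF _ assms])
  show "computable 4 (\<lambda>e. if is_digit (e 0) (e (Suc 0)) (e (Suc (Suc 0))) (e (Suc (Suc (Suc 0)))) then 1 else 0)"
    unfolding decidable_def[symmetric] is_digit_def by (intro computable_intros; simp)
qed

text \<open>Search for a certificate that contains either fact. By hypothesis exactly one of them is
  derivable, so no certificate can contain the wrong one.\<close>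

lemma decider:
  "\<exists>p. \<forall>e a b. prov e (frel 0 a b) \<noteq> prov e (fneg a b) \<longrightarrow>
    computes p [e, a, b] (if prov e (frel 0 a b) then 1 else 0)"
proof -
  define C where "C env w \<longleftrightarrow> cert (axs (env 0)) (rules (env 0)) w" for env :: "nat \<Rightarrow> nat" and w
  define P where "P env w \<longleftrightarrow> (\<exists>i\<le>w. mem (pr i (frel 0 (env (Suc 0)) (env (Suc (Suc 0))))) w)"
    for env :: "nat \<Rightarrow> nat" and w
  define N where "N env w \<longleftrightarrow> (\<exists>i\<le>w. mem (pr i (fneg (env (Suc 0)) (env (Suc (Suc 0))))) w)"
    for env :: "nat \<Rightarrow> nat" and w
  have C: "decidable (Suc 3) (\<lambda>v. C (\<lambda>i. v (Suc i)) (v 0))"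
    unfolding C_def cert_def axs_def rules_def
    by (intro computable_intros decidable_mem decidable_is_digit) simp_all
  have P: "decidable (Suc 3) (\<lambda>v. P (\<lambda>i. v (Suc i)) (v 0))"
    and N: "decidable (Suc 3) (\<lambda>v. N (\<lambda>i. v (Suc i)) (v 0))"
    unfolding P_def N_def by (intro computable_intros decidable_mem; simp)+
  have CPN: "decidable (Suc 3) (\<lambda>v. C (\<lambda>i. v (Suc i)) (v 0) \<and>
      (P (\<lambda>i. v (Suc i)) (v 0) \<or> N (\<lambda>i. v (Suc i)) (v 0)))"
    by (intro decidable_and decidable_or C P N)
  obtain p where p: "\<And>xs. length xs = 3 \<Longrightarrow>
      \<exists>w. C (nth xs) w \<and> (P (nth xs) w \<or> N (nth xs) w) \<Longrightarrow>
      computes p xs (if P (nth xs) (LEAST w. C (nth xs) w \<and> (P (nth xs) w \<or> N (nth xs) w)) then 1 else 0)"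
    using computes_search[where P = "\<lambda>env w. C env w \<and> (P env w \<or> N env w)" and Q = P, OF CPN P]
    by blast
  have "computes p [e, a, b] (if prov e (frel 0 a b) then 1 else 0)"
    if *: "prov e (frel 0 a b) \<noteq> prov e (fneg a b)" for e a b
  proof -
    let ?xs = "[e, a, b]"
    have pos: "prov e (frel 0 a b) \<longleftrightarrow> (\<exists>w. C (nth ?xs) w \<and> P (nth ?xs) w)"
      and neg: "prov e (fneg a b) \<longleftrightarrow> (\<exists>w. C (nth ?xs) w \<and> N (nth ?xs) w)"
      unfolding C_def P_def N_def using der_prov prov_der der_cert
      by (metis (no_types, lifting) nth_Cons_0 nth_Cons_Suc)+
    have ex: "\<exists>w. C (nth ?xs) w \<and> (P (nth ?xs) w \<or> N (nth ?xs) w)"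
      using * pos neg by blast
    let ?w = "LEAST w. C (nth ?xs) w \<and> (P (nth ?xs) w \<or> N (nth ?xs) w)"
    have "C (nth ?xs) ?w \<and> (P (nth ?xs) ?w \<or> N (nth ?xs) ?w)"
      by (rule LeastI_ex[OF ex])
    then have "P (nth ?xs) ?w \<longleftrightarrow> prov e (frel 0 a b)"
      using * pos neg by blast
    then show ?thesis using p[of ?xs, OF _ ex] by simp
  qed
  then show ?thesis by blast
qed

section \<open>Evaluation in finite algebras and soundness of the calculus\<close>

primrec vars :: "trm \<Rightarrow> nat set" where
  "vars (Var n) = {n}"
| "vars Zero = {}"
| "vars One = {}"
| "vars (Add s t) = vars s \<union> vars t"
| "vars (Mul s t) = vars s \<union> vars t"
| "vars (Bin s t) = vars s \<union> vars t"
| "vars (Fac s) = vars s"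
| "vars (Exp2 s) = vars s"

text \<open>A finite algebra is packed into one ternary operation: the first argument is the tag that
  \<^const>\<open>trm_code\<close> gives to the function symbol, and missing operands are \<open>0\<close>.\<close>

primrec meval :: "(nat \<Rightarrow> nat \<Rightarrow> nat \<Rightarrow> nat) \<Rightarrow> (nat \<Rightarrow> nat) \<Rightarrow> trm \<Rightarrow> nat" where
  "meval F \<rho> (Var n) = \<rho> n"
| "meval F \<rho> Zero = F 1 0 0"
| "meval F \<rho> One = F 2 0 0"
| "meval F \<rho> (Add s t) = F 3 (meval F \<rho> s) (meval F \<rho> t)"
| "meval F \<rho> (Mul s t) = F 4 (meval F \<rho> s) (meval F \<rho> t)"
| "meval F \<rho> (Bin s t) = F 5 (meval F \<rho> s) (meval F \<rho> t)"
| "meval F \<rho> (Fac s) = F 6 (meval F \<rho> s) 0"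
| "meval F \<rho> (Exp2 s) = F 7 (meval F \<rho> s) 0"

lemma meval_cong: "(\<And>n. n \<in> vars t \<Longrightarrow> \<rho> n = \<rho>' n) \<Longrightarrow> meval F \<rho> t = meval F \<rho>' t"
  by (induction t) auto

lemma meval_subst: "meval F \<rho> (subst \<sigma> t) = meval F (\<lambda>n. meval F \<rho> (\<sigma> n)) t"
  by (induction t) auto

lemma meval_sound:
  assumes "\<Sigma> \<turnstile> e" "\<And>s t \<rho>. (s, t) \<in> \<Sigma> \<Longrightarrow> (\<And>n. \<rho> n < m) \<Longrightarrow> meval F \<rho> s = meval F \<rho> t"
    "\<And>k x y. F k x y < m" "\<And>n. \<rho> n < m"
  shows "meval F \<rho> (fst e) = meval F \<rho> (snd e)"
  using assms(1)
proof induction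
  case (ax s t \<sigma>)
  have "meval F \<rho> u < m" for u using assms(3,4) by (cases u) auto
  with ax assms(2) show ?case by (simp add: meval_subst)
qed auto

definition table :: "nat \<Rightarrow> nat \<Rightarrow> nat \<Rightarrow> nat \<Rightarrow> nat \<Rightarrow> nat" where
  "table m T k x y = digit m T (pr k (pr x y))"

lemma trm_code_eq [simp]: "trm_code s = trm_code t \<longleftrightarrow> s = t"
  using injD[OF inj_trm_code] by blast

lemma prov_suffix: "prov e f \<Longrightarrow> e = eqns_code es \<Longrightarrow> f = fsuffix l \<Longrightarrow>
    \<exists>es'. l = eqns_code es' \<and> set es' \<subseteq> set es"
proof (induction arbitrary: l rule: prov.induct)
  case (suffix_tl c l)
  from suffix_tl.IH[OF suffix_tl.prems(1) HOL.refl]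
  obtain es' where es': "Suc (pr c l) = eqns_code es'" "set es' \<subseteq> set es"
    using suffix_tl.prems(2) by auto
  then obtain x xs where "es' = x # xs" by (cases es') (auto simp: eqns_code_def)
  with es' suffix_tl.prems show ?case by (auto simp: eqns_code_def)
qed auto

lemma prov_suffix_mem:
  assumes "prov (eqns_code es) (fsuffix (Suc (pr (pr s t) l)))"
  shows "\<exists>s' t'. (s', t') \<in> set es \<and> s = trm_code s' \<and> t = trm_code t'"
proof -
  from prov_suffix[OF assms HOL.refl HOL.refl] obtain es' where
    es': "Suc (pr (pr s t) l) = eqns_code es'" "set es' \<subseteq> set es" by blast
  then obtain x xs where "es' = x # xs" by (cases es') (auto simp: eqns_code_def)
  with es' show ?thesis by (cases x) (auto simp: eqns_code_def eqn_code_def)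
qed

text \<open>A digit that codes no term decodes to an arbitrary one; \<open>subst_var\<close> never
  touches it, as its premise \<open>frel 0 t t\<close> is derivable only for codes.\<close>

definition decode_subst :: "nat \<Rightarrow> nat \<Rightarrow> nat \<Rightarrow> trm" where
  "decode_subst b c n = inv trm_code (digit b c n)"

lemma inv_trm_code [simp]: "inv trm_code (trm_code t) = t"
  by (simp add: inj_trm_code)

text \<open>Equality and substitution share their congruence rules, and \<open>rel_ax\<close> and
  \<open>subst_var\<close> lead from one to the other, so both are treated in one induction.\<close>

lemma prov_rel_sound:
  assumes "prov e f" "e = eqns_code es" "f = frel k s t"
  shows "\<exists>s' t'. s = trm_code s' \<and> t = trm_code t' \<and>
    (k = 0 \<longrightarrow> set es \<turnstile> (s', t')) \<and> (\<forall>b c. k = Suc (pr b c) \<longrightarrow> t' = subst (decode_subst b c) s')"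
  using assms
proof (induction arbitrary: k s t rule: prov.induct)
  case (rel_const c k')
  then consider "s = trm_code Zero" "t = trm_code Zero" | "s = trm_code One" "t = trm_code One" by auto
  then show ?case
  proof cases
    case 1
    then show ?thesis by (intro exI[of _ Zero]) (auto intro: entails.refl)
  next
    case 2
    then show ?thesis by (intro exI[of _ One]) (auto intro: entails.refl)
  qed
next
  case (rel_bin k' s1 s1' t1 t1' c)
  have k: "k' = k" using rel_bin.prems(2) by simp
  from rel_bin.IH(1)[OF rel_bin.prems(1) HOL.refl] rel_bin.IH(2)[OF rel_bin.prems(1) HOL.refl]
  obtain a a' b b' where *: "s1 = trm_code a" "s1' = trm_code a'"
    "t1 = trm_code b" "t1' = trm_code b'"
    "k = 0 \<longrightarrow> set es \<turnstile> (a, a')" "\<forall>d c. k = Suc (pr d c) \<longrightarrow> a' = subst (decode_subst d c) a"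
    "k = 0 \<longrightarrow> set es \<turnstile> (b, b')" "\<forall>d c. k = Suc (pr d c) \<longrightarrow> b' = subst (decode_subst d c) b"
    unfolding k by blast
  have "c = 3 \<or> c = 4 \<or> c = 5" using rel_bin.hyps by auto
  then show ?case
  proof (elim disjE)
    assume "c = 3"
    then show ?thesis using * rel_bin.prems
      by (intro exI[of _ "Add a b"] exI[of _ "Add a' b'"]) (auto intro: cong_Add)
  next
    assume "c = 4"
    then show ?thesis using * rel_bin.prems
      by (intro exI[of _ "Mul a b"] exI[of _ "Mul a' b'"]) (auto intro: cong_Mul)
  next
    assume "c = 5"
    then show ?thesis using * rel_bin.prems
      by (intro exI[of _ "Bin a b"] exI[of _ "Bin a' b'"]) (auto intro: cong_Bin)
  qed
next
  case (rel_un k' s1 s1' c)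
  have k: "k' = k" using rel_un.prems(2) by simp
  from rel_un.IH[OF rel_un.prems(1) HOL.refl]
  obtain a a' where *: "s1 = trm_code a" "s1' = trm_code a'"
    "k = 0 \<longrightarrow> set es \<turnstile> (a, a')" "\<forall>d c. k = Suc (pr d c) \<longrightarrow> a' = subst (decode_subst d c) a"
    unfolding k by blast
  have "c = 6 \<or> c = 7" using rel_un.hyps by auto
  then show ?case
  proof (elim disjE)
    assume "c = 6"
    then show ?thesis using * rel_un.prems
      by (intro exI[of _ "Fac a"] exI[of _ "Fac a'"]) (auto intro: cong_Fac)
  next
    assume "c = 7"
    then show ?thesis using * rel_un.prems
      by (intro exI[of _ "Exp2 a"] exI[of _ "Exp2 a'"]) (auto intro: cong_Exp2)
  qed
next
  case (rel_var n)
  then show ?case by (intro exI[of _ "Var n"]) (auto intro: entails.refl)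
next
  case (rel_sym s1 t1)
  from rel_sym.IH[OF rel_sym.prems(1) HOL.refl] rel_sym.prems(2) show ?case
    by (auto intro: entails.sym)
next
  case (rel_trans s1 t1 u1)
  from rel_trans.IH(1)[OF rel_trans.prems(1) HOL.refl] rel_trans.IH(2)[OF rel_trans.prems(1) HOL.refl]
    rel_trans.prems(2) show ?case
    by (auto intro: entails.trans)
next
  case (rel_ax s1 t1 l k1 s1' t1')
  obtain b c where k1: "k1 = pr b c" by (metis prod_decode_inverse surj_pair)
  from rel_ax.IH(2)[OF rel_ax.prems(1) HOL.refl] rel_ax.IH(3)[OF rel_ax.prems(1) HOL.refl]
  obtain a a' where *: "s1 = trm_code a" "s1' = trm_code (subst (decode_subst b c) a)"
    "t1 = trm_code a'" "t1' = trm_code (subst (decode_subst b c) a')"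
    unfolding k1 by auto
  moreover have "(a, a') \<in> set es"
    using prov_suffix_mem[of es s1 t1 l] rel_ax.hyps(1) rel_ax.prems(1) *
      injD[OF inj_trm_code] by auto
  ultimately show ?case using rel_ax.prems(2) by (auto intro: entails.ax)
next
  case (subst_var t1 b c n)
  from subst_var.IH[OF subst_var.prems(1) HOL.refl] obtain a where "t1 = trm_code a" by auto
  then show ?case using subst_var.hyps subst_var.prems(2)
    by (intro exI[of _ "Var n"] exI[of _ a]) (auto simp: decode_subst_def is_digit_iff)
qed auto

lemma prov_eval_sound:
  assumes "prov e f" "f = feval (pr m T) \<rho> s v"
  shows "m > 0 \<and> (\<exists>t. s = trm_code t \<and> v = meval (table m T) (digit m \<rho>) t)"
  using assms
proof (induction arbitrary: m T \<rho> s v rule: prov.induct)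
  case (eval_var m' \<rho>' n v' T')
  then show ?case by (auto simp: is_digit_iff intro!: exI[of _ "Var n"])
next
  case (eval_const c m' T' v' \<rho>')
  then show ?case
    by (auto simp: is_digit_iff table_def intro!: exI[of _ "if c = 1 then Zero else One"])
next
  case (eval_bin m' T' \<rho>' s1 x t1 y c v')
  from eval_bin.IH(1)[OF HOL.refl] eval_bin.IH(2)[OF HOL.refl] obtain a b where
    *: "s1 = trm_code a" "x = meval (table m' T') (digit m' \<rho>') a"
      "t1 = trm_code b" "y = meval (table m' T') (digit m' \<rho>') b" "m' > 0" by blast
  have "c = 3 \<or> c = 4 \<or> c = 5" using eval_bin.hyps by auto
  then show ?case using * eval_bin.hyps(5) eval_bin.prems
    by (auto simp: is_digit_iff table_def[symmetric]
        intro: exI[of _ "Add a b"] exI[of _ "Mul a b"] exI[of _ "Bin a b"])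
next
  case (eval_un m' T' \<rho>' s1 x c v')
  from eval_un.IH[OF HOL.refl] obtain a where
    *: "s1 = trm_code a" "x = meval (table m' T') (digit m' \<rho>') a" "m' > 0" by blast
  have "c = 6 \<or> c = 7" using eval_un.hyps by auto
  then show ?case using * eval_un.hyps(4) eval_un.prems
    by (auto simp: is_digit_iff table_def[symmetric] intro: exI[of _ "Fac a"] exI[of _ "Exp2 a"])
qed auto

lemma prov_ok_sound:
  assumes "prov e f" "f = fok (pr m T) \<rho> (eqns_code es)" "(s, t) \<in> set es"
  shows "meval (table m T) (digit m \<rho>) s = meval (table m T) (digit m \<rho>) t"
  using assms
proof (induction arbitrary: es rule: prov.induct)
  case (ok_Nil M \<rho>')
  then show ?case by (cases es) (auto simp: eqns_code_def)
next
  case (ok_Cons M \<rho>' l s1 v t1)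
  then obtain a b es' where es: "es = (a, b) # es'" by (cases es) (auto simp: eqns_code_def)
  with ok_Cons.prems(1) have *: "M = pr m T" "\<rho>' = \<rho>" "s1 = trm_code a" "t1 = trm_code b"
    "l = eqns_code es'"
    by (auto simp: eqns_code_def eqn_code_def)
  have "meval (table m T) (digit m \<rho>) a = meval (table m T) (digit m \<rho>) b"
    using prov_eval_sound[OF ok_Cons.hyps(2)] prov_eval_sound[OF ok_Cons.hyps(3)]
      injD[OF inj_trm_code] unfolding * by metis
  with ok_Cons.IH(1)[of es'] ok_Cons.prems(2) show ?case unfolding es * by auto
qed auto

lemma prov_all_sound:
  assumes "prov e f" "e = eqns_code es" "f = fall (pr m T) r" "\<rho> < r" "(s, t) \<in> set es"
  shows "meval (table m T) (digit m \<rho>) s = meval (table m T) (digit m \<rho>) t"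
  using assms
proof (induction arbitrary: r rule: prov.induct)
  case (all_Suc M r')
  then show ?case using prov_ok_sound[of e _ m T \<rho> es s t] by (cases "\<rho> = r'") auto
qed auto

lemma vars_le_code: "n \<in> vars t \<Longrightarrow> n \<le> trm_code t"
  by (induction t) (auto intro: le_pr)

lemma vars_less_code: "(s, t) \<in> set es \<Longrightarrow> n \<in> vars s \<union> vars t \<Longrightarrow> n < eqns_code es"
proof (induction es)
  case (Cons x es)
  show ?case
  proof (cases "x = (s, t)")
    case True
    have "n \<le> pr (trm_code s) (trm_code t)"
      using Cons.prems(2) by (auto dest: vars_le_code intro: le_pr)
    then have "n \<le> pr (pr (trm_code s) (trm_code t)) (eqns_code es)" by (rule le_pr(1))
    then show ?thesis using True by (simp add: eqns_code_def eqn_code_def)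
  next
    case False
    then have "n < eqns_code es" using Cons by auto
    also have "\<dots> \<le> eqns_code (x # es)" unfolding eqns_code_def by (simp add: le_pr le_SucI)
    finally show ?thesis .
  qed
qed simp

lemma prov_neg_sound:
  assumes "prov (eqns_code es) (fneg (trm_code s) (trm_code t))"
  shows "\<not> set es \<turnstile> (s, t)"
proof
  assume entails: "set es \<turnstile> (s, t)"
  let ?e = "eqns_code es"
  from assms obtain m T \<rho> x y where *: "prov ?e (fall (pr m T) (m ^ ?e))"
    "prov ?e (feval (pr m T) \<rho> (trm_code s) x)" "prov ?e (feval (pr m T) \<rho> (trm_code t) y)" "x \<noteq> y"
    by (cases rule: prov.cases) auto
  have m: "m > 0" and x: "x = meval (table m T) (digit m \<rho>) s" and y: "y = meval (table m T) (digit m \<rho>) t"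
    using prov_eval_sound[OF *(2) HOL.refl] prov_eval_sound[OF *(3) HOL.refl] injD[OF inj_trm_code] by auto
  have "meval (table m T) (digit m \<rho>) (fst (s, t)) = meval (table m T) (digit m \<rho>) (snd (s, t))"
  proof (rule meval_sound[OF entails])
    fix a b and \<rho>' :: "nat \<Rightarrow> nat" assume ab: "(a, b) \<in> set es" and \<rho>': "\<And>n. \<rho>' n < m"
    \<comment> \<open>The laws see only variables below \<open>?e\<close>, so the assignment can be
      traded for a digit sequence among those checked.\<close>
    obtain c where c: "c < m ^ ?e" "\<forall>i<?e. digit m c i = \<rho>' i"
      using digits_exist[of m ?e \<rho>'] m \<rho>' by blast
    have "meval (table m T) \<rho>' u = meval (table m T) (digit m c) u" if "vars u \<subseteq> vars a \<union> vars b" for u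
      using that c(2) vars_less_code[OF ab] by (intro meval_cong) (metis subsetD)
    then show "meval (table m T) \<rho>' a = meval (table m T) \<rho>' b"
      using prov_all_sound[OF *(1) HOL.refl HOL.refl c(1) ab] by simp
  qed (use m in \<open>auto simp: table_def digit_less\<close>)
  then show False using x y *(4) by simp
qed

section \<open>Completeness of the calculus\<close>

lemma finite_vars: "finite (vars t)"
  by (induction t) auto

lemma vars_bounded: "\<exists>B. \<forall>n \<in> vars s \<union> vars t. n < B"
  using finite_nat_set_iff_bounded[of "vars s \<union> vars t"] by (simp add: finite_vars)

lemma prov_refl: "prov e (frel 0 (trm_code t) (trm_code t))"
  by (induction t) (auto intro: prov.intros)

lemma prov_subst:
  assumes "\<And>n. n \<in> vars t \<Longrightarrow> is_digit b c n (trm_code (\<sigma> n))"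
  shows "prov e (frel (Suc (pr b c)) (trm_code t) (trm_code (subst \<sigma> t)))"
  using assms by (induction t) (auto intro: prov.intros prov_refl)

lemma prov_suffix_append: "prov e (fsuffix (eqns_code (xs @ ys))) \<Longrightarrow> prov e (fsuffix (eqns_code ys))"
  by (induction xs) (auto simp: eqns_code_def intro: suffix_tl)

lemma prov_rel_complete:
  assumes "set es \<turnstile> x"
  shows "prov (eqns_code es) (frel 0 (trm_code (fst x)) (trm_code (snd x)))"
  using assms
proof induction
  case (ax s t \<sigma>)
  then obtain xs ys where "es = xs @ (s, t) # ys" by (meson split_list)
  then have suf: "prov (eqns_code es) (fsuffix (Suc (pr (pr (trm_code s) (trm_code t)) (eqns_code ys))))"
    using prov_suffix_append[of "eqns_code es" xs "(s, t) # ys"] suffix_all[of "eqns_code es"]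
    by (simp add: eqns_code_def eqn_code_def)
  obtain B where B: "\<And>n. n \<in> vars s \<union> vars t \<Longrightarrow> n < B"
    using vars_bounded[of s t] by blast
  \<comment> \<open>A base above the codes of all terms substituted for variables below
    \<open>B\<close>.\<close>
  define b where "b = Suc (\<Sum>n<B. trm_code (\<sigma> n))"
  have "trm_code (\<sigma> n) < b" if "n < B" for n
    using member_le_sum[of n "{..<B}" "\<lambda>n. trm_code (\<sigma> n)"] that by (simp add: b_def)
  then obtain c where "\<forall>n<B. digit b c n = trm_code (\<sigma> n)"
    using digits_exist[of b B "\<lambda>n. trm_code (\<sigma> n)"] by (auto simp: b_def)
  then have dig: "is_digit b c n (trm_code (\<sigma> n))" if "n \<in> vars s \<union> vars t" for n
    using B[OF that] by (simp add: is_digit_iff b_def)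
  have "prov (eqns_code es) (frel (Suc (pr b c)) (trm_code s) (trm_code (subst \<sigma> s)))"
    "prov (eqns_code es) (frel (Suc (pr b c)) (trm_code t) (trm_code (subst \<sigma> t)))"
    using dig by (auto intro: prov_subst)
  then show ?case using rel_ax[OF suf] by simp
qed (auto intro: prov_refl rel_sym rel_trans rel_bin rel_un)

lemma prov_eval:
  assumes "m > 0"
  shows "prov e (feval (pr m T) \<rho> (trm_code t) (meval (table m T) (digit m \<rho>) t))"
proof (induction t)
  case (Var n)
  show ?case using assms by (auto intro: eval_var simp: is_digit_iff)
next
  case Zero
  show ?case using assms eval_const[of 1 m T] by (simp add: is_digit_iff table_def)
next
  case One
  show ?case using assms eval_const[of 2 m T] by (simp add: is_digit_iff table_def)
next
  case (Add s t)
  then show ?case using assms eval_bin[of e m T \<rho> _ _ _ _ 3] by (simp add: is_digit_iff table_def)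
next
  case (Mul s t)
  then show ?case using assms eval_bin[of e m T \<rho> _ _ _ _ 4] by (simp add: is_digit_iff table_def)
next
  case (Bin s t)
  then show ?case using assms eval_bin[of e m T \<rho> _ _ _ _ 5] by (simp add: is_digit_iff table_def)
next
  case (Fac s)
  then show ?case using assms eval_un[of e m T \<rho> _ _ 6] by (simp add: is_digit_iff table_def)
next
  case (Exp2 s)
  then show ?case using assms eval_un[of e m T \<rho> _ _ 7] by (simp add: is_digit_iff table_def)
qed

lemma prov_neg_complete:
  assumes F: "\<And>k x y. F k x y < m" and \<rho>: "\<And>n. \<rho> n < m"
    and valid: "\<And>s t \<rho>. (s, t) \<in> set es \<Longrightarrow> (\<And>n. \<rho> n < m) \<Longrightarrow> meval F \<rho> s = meval F \<rho> t"
    and sep: "meval F \<rho> a \<noteq> meval F \<rho> b"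
  shows "prov (eqns_code es) (fneg (trm_code a) (trm_code b))"
proof -
  let ?e = "eqns_code es"
  have m: "m > 0" using \<rho>[of 0] by simp
  \<comment> \<open>Tags are at most 7, so the table has to be right at finitely many indices
    only.\<close>
  have "finite ((\<lambda>(k, x, y). pr k (pr x y)) ` ({..7} \<times> {..<m} \<times> {..<m}))" by simp
  then obtain B where bound: "\<forall>n \<in> (\<lambda>(k, x, y). pr k (pr x y)) ` ({..7} \<times> {..<m} \<times> {..<m}). n < B"
    unfolding finite_nat_set_iff_bounded by blast
  have B: "pr k (pr x y) < B" if "k \<le> 7" "x < m" "y < m" for k x y
  proof -
    have "(k, x, y) \<in> {..7} \<times> {..<m} \<times> {..<m}" using that by simp
    from bspec[OF bound imageI[OF this]] show ?thesis by simp
  qed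
  define g where "g i = (let (k, j) = prod_decode i; (x, y) = prod_decode j in F k x y)" for i
  have g: "g (pr k (pr x y)) = F k x y" for k x y by (simp add: g_def)
  have "g i < m" for i by (simp add: g_def F split: prod.split)
  then obtain T where "\<forall>i<B. digit m T i = g i" using digits_exist[of m B g] m by blast
  then have T: "table m T k x y = F k x y" if "k \<le> 7" "x < m" "y < m" for k x y
    using B[OF that] by (simp add: table_def g)
  have eval: "meval (table m T) \<rho> t = meval F \<rho> t \<and> meval F \<rho> t < m" if "\<And>n. \<rho> n < m" for \<rho> t
    by (induction t) (use m F that in \<open>auto simp: T\<close>)
  have ok: "prov ?e (fok (pr m T) r (eqns_code es'))" if "set es' \<subseteq> set es" for r es'
    using that
  proof (induction es')
    case Nil
    show ?case by (simp add: eqns_code_def ok_Nil)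
  next
    case (Cons x es')
    obtain s t where x: "x = (s, t)" by (cases x)
    have "meval (table m T) (digit m r) s = meval (table m T) (digit m r) t"
      using valid[of s t "digit m r"] eval[of "digit m r"] Cons.prems x m by (simp add: digit_less)
    then have "prov ?e (feval (pr m T) r (trm_code t) (meval (table m T) (digit m r) s))"
      using prov_eval[OF m] by metis
    then have "prov ?e (fok (pr m T) r (Suc (pr (pr (trm_code s) (trm_code t)) (eqns_code es'))))"
      using Cons by (intro ok_Cons[OF _ prov_eval[OF m]]) auto
    then show ?case by (simp add: eqns_code_def eqn_code_def x)
  qed
  have all: "prov ?e (fall (pr m T) r)" for r
    by (induction r) (auto intro: all_0 all_Suc ok)
  obtain C where C: "\<And>n. n \<in> vars a \<union> vars b \<Longrightarrow> n < C"
    using vars_bounded[of a b] by blast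
  obtain r where r: "\<forall>i<C. digit m r i = \<rho> i" using digits_exist[of m C \<rho>] m \<rho> by blast
  have "meval (table m T) (digit m r) t = meval F \<rho> t" if "t = a \<or> t = b" for t
  proof -
    have "meval (table m T) (digit m r) t = meval (table m T) \<rho> t"
      using C r that by (intro meval_cong) auto
    then show ?thesis using eval[of \<rho>] \<rho> by simp
  qed
  then have "meval (table m T) (digit m r) a \<noteq> meval (table m T) (digit m r) b" using sep by simp
  then show ?thesis by (rule neg[OF all prov_eval[OF m] prov_eval[OF m]])
qed

section \<open>Normal forms and their leaves\<close>

abbreviation Two :: trm where "Two \<equiv> Add One One"

text \<open>Besides the simplifications given by \<^const>\<open>Omega\<close>, one further rule \<open>D! \<rightarrow> E\<close> is allowed. It
  is needed when two different terms \<open>((1 \<copyright> 1)!)\<dots>!\<close> are provably equal; taking \<open>D = E = 1 + 1\<close>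
  makes it void.\<close>

primrec nf :: "trm \<Rightarrow> trm \<Rightarrow> trm \<Rightarrow> trm" where
  "nf D E (Var n) = Var n"
| "nf D E Zero = Zero"
| "nf D E One = One"
| "nf D E (Add s t) = (if nf D E s = Zero then nf D E t else if nf D E t = Zero then nf D E s
    else Add (nf D E s) (nf D E t))"
| "nf D E (Mul s t) = (if nf D E s = Zero \<or> nf D E t = Zero then Zero
    else if nf D E s = One then nf D E t else if nf D E t = One then nf D E s
    else Mul (nf D E s) (nf D E t))"
| "nf D E (Bin s t) = (if nf D E s = Zero \<or> nf D E t = Zero then One
    else Bin (nf D E s) (nf D E t))"
| "nf D E (Fac s) = (if nf D E s = Zero \<or> nf D E s = One then One
    else if nf D E s = Two then Two else if nf D E s = D then E else Fac (nf D E s))"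
| "nf D E (Exp2 s) = (if nf D E s = Zero then One else if nf D E s = One then Two
    else Exp2 (nf D E s))"

text \<open>Irreducibility under \<open>Omega\<close> alone. The extra rule is left out, so that one
  theory of leaves serves every choice of \<open>D\<close> and \<open>E\<close>.\<close>

primrec norm :: "trm \<Rightarrow> bool" where
  "norm (Var n) \<longleftrightarrow> True"
| "norm Zero \<longleftrightarrow> True"
| "norm One \<longleftrightarrow> True"
| "norm (Add s t) \<longleftrightarrow> norm s \<and> norm t \<and> s \<noteq> Zero \<and> t \<noteq> Zero"
| "norm (Mul s t) \<longleftrightarrow> norm s \<and> norm t \<and> s \<noteq> Zero \<and> t \<noteq> Zero \<and> s \<noteq> One \<and> t \<noteq> One"
| "norm (Bin s t) \<longleftrightarrow> norm s \<and> norm t \<and> s \<noteq> Zero \<and> t \<noteq> Zero"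
| "norm (Fac s) \<longleftrightarrow> norm s \<and> s \<noteq> Zero \<and> s \<noteq> One \<and> s \<noteq> Two"
| "norm (Exp2 s) \<longleftrightarrow> norm s \<and> s \<noteq> Zero \<and> s \<noteq> One"

lemma norm_nf: "norm E \<Longrightarrow> norm (nf D E t)"
  by (induction t) auto

text \<open>The value of \<open>1 \<copyright> 1\<close> is \<open>2\<close>, but \<^const>\<open>Omega\<close> does not make it equal to \<open>1 + 1\<close>. So these terms, all of
  value \<open>2\<close>, can be pairwise inequivalent, and a bounded value does not bound the number of
  normal forms.\<close>

definition Bn :: "nat \<Rightarrow> trm" where
  "Bn n = (Fac ^^ n) (Bin One One)"

lemma Bn_0: "Bn 0 = Bin One One" and Bn_Suc: "Bn (Suc n) = Fac (Bn n)"
  by (simp_all add: Bn_def)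

lemma Bn_simps [simp]: "Bn n \<noteq> Zero" "Bn n \<noteq> One" "Bn n \<noteq> Var k" "Bn n \<noteq> Add s t"
  "Bn n \<noteq> Mul s t" "Bn n \<noteq> Exp2 s" "Bn n = Bin s t \<longleftrightarrow> n = 0 \<and> s = One \<and> t = One"
  "Bn n = Fac s \<longleftrightarrow> (\<exists>m. n = Suc m \<and> s = Bn m)"
  by (cases n; auto simp: Bn_0 Bn_Suc)+

lemma Bn_inj [simp]: "Bn m = Bn n \<longleftrightarrow> m = n"
proof (induction m arbitrary: n)
  case 0
  show ?case by (cases n) (auto simp: Bn_0 Bn_Suc)
next
  case (Suc m)
  then show ?case by (cases n) (auto simp: Bn_0 Bn_Suc)
qed

lemma norm_Bn: "norm (Bn n)"
  by (induction n) (auto simp: Bn_0 Bn_Suc)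

text \<open>With 3 for every variable, the values 0, 1 and 2 single out the terms listed in
  \<open>norm_val_le_2\<close>, and the factorial strictly increases all larger values.\<close>

abbreviation val :: "trm \<Rightarrow> nat" where "val \<equiv> nat_val (\<lambda>_. 3)"

lemma val_Bn [simp]: "val (Bn n) = 2"
  by (induction n) (auto simp: Bn_0 Bn_Suc numeral_2_eq_2)

text \<open>Pascal's rule: one summand supplies \<open>a + b\<close> by induction, the other at
  least 1. With \<open>sum_le_mult\<close> this makes the binary operations at least additive on
  normal forms, so that values bound sizes.\<close>

lemma choose_ge_sum: "1 \<le> a \<Longrightarrow> 1 \<le> b \<Longrightarrow> a + b \<le> (a + b) choose b"
proof (induction b)
  case (Suc b)
  have pos: "1 \<le> (a + b) choose Suc b" using Suc.prems by (simp add: Suc_le_eq)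
  show ?case
  proof (cases "b = 0")
    case False
    then have "a + b \<le> (a + b) choose b" using Suc by simp
    then have "a + b + 1 \<le> ((a + b) choose b) + ((a + b) choose Suc b)"
      using pos by (rule add_mono)
    then show ?thesis by simp
  qed simp
qed simp

lemma fact_gt: "3 \<le> a \<Longrightarrow> a < fact (a :: nat)"
proof (induction a rule: nat_induct_at_least)
  case base
  show ?case by (simp add: fact_numeral)
next
  case (Suc n)
  then have "Suc n * 1 < Suc n * fact n" by (intro mult_strict_left_mono) auto
  then show ?case by simp
qed

lemma sum_le_mult: "2 \<le> a \<Longrightarrow> 2 \<le> b \<Longrightarrow> a + b \<le> a * (b :: nat)"
  by (auto simp: le_iff_add algebra_simps)

text \<open>Products and powers in normal form are at least 4, and a binomial is at least the sum of
  its operands. Value 2 thus leaves \<open>Two\<close>, \<open>Bin One One\<close> and factorials of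
  terms of value 2, where \<open>Fac Two\<close> is not normal.\<close>

lemma norm_val_le_2:
  assumes "norm t"
  shows "(val t = 0 \<longrightarrow> t = Zero) \<and> (val t = 1 \<longrightarrow> t = One) \<and> (val t = 2 \<longrightarrow> t = Two \<or> (\<exists>n. t = Bn n))"
  using assms
proof (induction t)
  case (Add s t)
  then have "val s \<noteq> 0" "val t \<noteq> 0" by auto
  with Add show ?case by auto
next
  case (Mul s t)
  then have "val s \<noteq> 0" "val t \<noteq> 0" "val s \<noteq> 1" "val t \<noteq> 1" by auto
  then have "2 \<le> val s" "2 \<le> val t" by linarith+
  then have "4 \<le> val (Mul s t)" using mult_le_mono[of 2 "val s" 2 "val t"] by simp
  then show ?case by linarith
next
  case (Bin s t)
  then have *: "1 \<le> val s" "1 \<le> val t" by (auto simp: Suc_le_eq)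
  have ge: "val s + val t \<le> val (Bin s t)" using choose_ge_sum[OF *] by simp
  moreover have "Bin s t = Bn 0" if "val (Bin s t) = 2"
  proof -
    have "val s = 1" "val t = 1" using ge * that by linarith+
    then show ?thesis using Bin by (simp add: Bn_0)
  qed
  ultimately show ?case using * by fastforce
next
  case (Fac s)
  then have "val s \<noteq> 0" "val s \<noteq> 1" by auto
  then have "2 \<le> val s" by linarith
  then consider "val s = 2" | "3 \<le> val s" by linarith
  then show ?case
  proof cases
    case 1
    then obtain n where "s = Bn n" using Fac by auto
    then have "Fac s = Bn (Suc n)" by (simp add: Bn_Suc)
    then show ?thesis using 1 by (auto simp: fact_numeral)
  next
    case 2
    then show ?thesis using fact_gt[OF 2] by simp
  qed
next
  case (Exp2 s)
  then have "val s \<noteq> 0" "val s \<noteq> 1" by auto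
  then have "2 \<le> val s" by linarith
  then have "(2::nat) ^ 2 \<le> 2 ^ val s" by (rule power_increasing) simp
  then have "4 \<le> val (Exp2 s)" by simp
  then show ?case by linarith
qed auto

text \<open>Treats every \<open>Bn n\<close> as a leaf. In the remaining cases the operands are so
  large that the operations grow, which the estimates on leaves and values rely on.\<close>

lemma norm_induct [consumes 1, case_names Var Zero One Bn Add Mul Bin Fac Exp2]:
  assumes "norm t"
    and "\<And>n. P (Var n)" "P Zero" "P One" "\<And>n. P (Bn n)"
    and Add: "\<And>s t. norm s \<Longrightarrow> norm t \<Longrightarrow> 1 \<le> val s \<Longrightarrow> 1 \<le> val t \<Longrightarrow> P s \<Longrightarrow> P t \<Longrightarrow> P (Add s t)"
    and Mul: "\<And>s t. norm s \<Longrightarrow> norm t \<Longrightarrow> 2 \<le> val s \<Longrightarrow> 2 \<le> val t \<Longrightarrow> P s \<Longrightarrow> P t \<Longrightarrow> P (Mul s t)"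
    and Bin: "\<And>s t. norm s \<Longrightarrow> norm t \<Longrightarrow> 1 \<le> val s \<Longrightarrow> 1 \<le> val t \<Longrightarrow> s \<noteq> One \<or> t \<noteq> One \<Longrightarrow>
      P s \<Longrightarrow> P t \<Longrightarrow> P (Bin s t)"
    and Fac: "\<And>s. norm s \<Longrightarrow> 3 \<le> val s \<Longrightarrow> P s \<Longrightarrow> P (Fac s)"
    and Exp2: "\<And>s. norm s \<Longrightarrow> 2 \<le> val s \<Longrightarrow> P s \<Longrightarrow> P (Exp2 s)"
  shows "P t"
  using assms(1)
proof (induction t)
  case (Add s t)
  then show ?case using norm_val_le_2[of s] norm_val_le_2[of t]
    by (intro assms(6)) (auto simp: Suc_le_eq)
next
  case (Mul s t)
  then have "val s \<noteq> 0" "val t \<noteq> 0" "val s \<noteq> 1" "val t \<noteq> 1"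
    using norm_val_le_2[of s] norm_val_le_2[of t] by auto
  then show ?case using Mul by (intro assms(7)) auto
next
  case (Bin s t)
  show ?case
  proof (cases "s = One \<and> t = One")
    case True
    then show ?thesis using assms(5)[of 0] by (simp add: Bn_0)
  next
    case False
    then show ?thesis using Bin norm_val_le_2[of s] norm_val_le_2[of t]
      by (intro assms(8)) (auto simp: Suc_le_eq)
  qed
next
  case (Fac s)
  show ?case
  proof (cases "\<exists>n. s = Bn n")
    case True
    then show ?thesis using assms(5) Bn_Suc by metis
  next
    case False
    then have "val s \<noteq> 0" "val s \<noteq> 1" "val s \<noteq> 2" using Fac norm_val_le_2[of s] by auto
    then have "3 \<le> val s" by linarith
    then show ?thesis using Fac by (intro assms(9)) auto
  qed
next
  case (Exp2 s)
  then have "val s \<noteq> 0" "val s \<noteq> 1" using norm_val_le_2[of s] by auto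
  then show ?case using Exp2 by (intro assms(10)) auto
qed (use assms in auto)

text \<open>A test for the shape \<open>Bn n\<close> that primitive recursion on terms can
  use.\<close>

primrec bidx :: "trm \<Rightarrow> nat option" where
  "bidx (Var n) = None"
| "bidx Zero = None"
| "bidx One = None"
| "bidx (Add s t) = None"
| "bidx (Mul s t) = None"
| "bidx (Bin s t) = (if s = One \<and> t = One then Some 0 else None)"
| "bidx (Fac s) = map_option Suc (bidx s)"
| "bidx (Exp2 s) = None"

lemma bidx_iff: "bidx t = Some n \<longleftrightarrow> t = Bn n"
  by (induction t arbitrary: n) (auto simp: eq_commute[of _ "Bn _"])

lemma bidx_Bn [simp]: "bidx (Bn n) = Some n"
  by (simp add: bidx_iff)

lemma bidx_val_3: "3 \<le> val s \<Longrightarrow> bidx s = None"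
  by (cases "bidx s") (auto simp: bidx_iff)

text \<open>Only maximal subterms of the form \<open>Bn n\<close> count: \<open>Bn (Suc n)\<close>
  does not contribute \<open>n\<close>.\<close>

primrec leaves :: "trm \<Rightarrow> nat set" where
  "leaves (Var n) = {}"
| "leaves Zero = {}"
| "leaves One = {}"
| "leaves (Add s t) = leaves s \<union> leaves t"
| "leaves (Mul s t) = leaves s \<union> leaves t"
| "leaves (Bin s t) = (if s = One \<and> t = One then {0} else leaves s \<union> leaves t)"
| "leaves (Fac s) = (case bidx s of Some n \<Rightarrow> {Suc n} | None \<Rightarrow> leaves s)"
| "leaves (Exp2 s) = leaves s"

lemma leaves_Bn [simp]: "leaves (Bn n) = {n}"
  by (cases n) (auto simp: Bn_0 Bn_Suc)

lemma leaves_Fac [simp]: "3 \<le> val s \<Longrightarrow> leaves (Fac s) = leaves s"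
  by (simp add: bidx_val_3)

declare leaves.simps(7) [simp del]

lemma leaves_Bin: "s \<noteq> One \<or> t \<noteq> One \<Longrightarrow> leaves (Bin s t) = leaves s \<union> leaves t"
  by simp

text \<open>A leaf has value 2 and the operations are at least additive. In a class of value N a gap
  has to avoid at most N indices per term.\<close>

lemma card_leaves: "norm t \<Longrightarrow> finite (leaves t) \<and> card (leaves t) \<le> val t"
proof (induction rule: norm_induct)
  case (Add s t)
  then show ?case using card_Un_le[of "leaves s" "leaves t"] by auto
next
  case (Mul s t)
  then have "val s + val t \<le> val s * val t" by (intro sum_le_mult)
  with Mul show ?case using card_Un_le[of "leaves s" "leaves t"] by auto
next
  case (Bin s t)
  then show ?case using card_Un_le[of "leaves s" "leaves t"] choose_ge_sum[of "val s" "val t"]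
    by (auto simp: leaves_Bin)
next
  case (Fac s)
  then show ?case using fact_gt[of "val s"] by auto
next
  case (Exp2 s)
  then show ?case using less_exp[of "val s"] by (auto intro: order_trans less_imp_le)
qed auto

section \<open>Iterated factorials and the modified valuations\<close>

definition tower :: "nat \<Rightarrow> nat \<Rightarrow> nat" where
  "tower n Y = (fact ^^ n) Y"

lemma tower_0 [simp]: "tower 0 Y = Y" and tower_Suc [simp]: "tower (Suc n) Y = fact (tower n Y)"
  by (simp_all add: tower_def)

lemma tower_add: "tower (m + n) Y = tower m (tower n Y)"
  by (simp add: tower_def funpow_add)

lemma tower_mono: "m \<le> n \<Longrightarrow> tower m Y \<le> tower n Y"
  by (induction n rule: dec_induct) (auto intro: order_trans fact_ge_self)

lemma tower_ge: "Y \<le> tower n Y"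
  using tower_mono[of 0 n Y] by simp

lemma tower_less: "2 \<le> X \<Longrightarrow> X < Y \<Longrightarrow> tower n X < tower n Y"
proof (induction n)
  case (Suc n)
  then have "tower n X < tower n Y" "0 < tower n X" using tower_ge[of X n] by auto
  then show ?case using fact_less_mono_nat by simp
qed simp

text \<open>The leaves \<open>Bn n\<close> with \<open>n < h\<close> get their true value \<open>2\<close>; at \<open>h\<close> the sequence is restarted as if
  \<open>Bn 0\<close> had the value \<open>Y\<close>. This commutes with all operations except at a factorial
  of \<open>Bn (h - 1)\<close>.\<close>

primrec leaf_val :: "nat \<Rightarrow> nat \<Rightarrow> trm \<Rightarrow> nat" where
  "leaf_val h Y (Var n) = 3"
| "leaf_val h Y Zero = 0"
| "leaf_val h Y One = 1"
| "leaf_val h Y (Add s t) = leaf_val h Y s + leaf_val h Y t"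
| "leaf_val h Y (Mul s t) = leaf_val h Y s * leaf_val h Y t"
| "leaf_val h Y (Bin s t) = (if h = 0 \<and> s = One \<and> t = One then Y else (leaf_val h Y s + leaf_val h Y t) choose leaf_val h Y t)"
| "leaf_val h Y (Fac s) = (if 0 < h \<and> s = Bn (h - 1) then tower h Y else fact (leaf_val h Y s))"
| "leaf_val h Y (Exp2 s) = 2 ^ leaf_val h Y s"

lemma leaf_val_Bn [simp]: "leaf_val h Y (Bn n) = (if n < h then 2 else tower n Y)"
proof (induction n)
  case 0
  then show ?case by (auto simp: Bn_0)
next
  case (Suc n)
  then show ?case by (cases "Suc n = h") (auto simp: Bn_Suc fact_numeral)
qed

lemma leaf_val_Fac: "3 \<le> val s \<Longrightarrow> leaf_val h Y (Fac s) = fact (leaf_val h Y s)"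
  by auto

lemma leaf_val_Bin: "s \<noteq> One \<or> t \<noteq> One \<Longrightarrow> leaf_val h Y (Bin s t) = (leaf_val h Y s + leaf_val h Y t) choose leaf_val h Y t"
  by auto

declare leaf_val.simps(6,7) [simp del]

lemma choose_mono:
  assumes "a \<le> a'" "b \<le> b'"
  shows "(a + b) choose b \<le> (a' + b') choose (b' :: nat)"
proof -
  have "(a + b) choose b \<le> (a' + b) choose b"
    using assms(1) by (intro binomial_right_mono) simp
  also have "\<dots> = (b + a') choose a'"
    using binomial_symmetric[of b "a' + b"] by (simp add: add.commute)
  also have "\<dots> \<le> (b' + a') choose a'"
    using assms(2) by (intro binomial_right_mono) simp
  also have "\<dots> = (a' + b') choose b'"
    using binomial_symmetric[of b' "a' + b'"] by (simp add: add.commute)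
  finally show ?thesis .
qed

lemma leaf_val_ge_val: "norm t \<Longrightarrow> 2 \<le> Y \<Longrightarrow> val t \<le> leaf_val h Y t"
proof (induction rule: norm_induct)
  case (Bn n)
  then show ?case using tower_ge[of Y n] by auto
next
  case (Add s t)
  then show ?case by (simp add: add_mono)
next
  case (Mul s t)
  then show ?case by (simp add: mult_le_mono)
next
  case (Bin s t)
  then show ?case by (simp add: leaf_val_Bin choose_mono)
next
  case (Fac s)
  then show ?case by (simp add: leaf_val_Fac fact_mono)
next
  case (Exp2 s)
  then show ?case by (simp add: power_increasing)
qed auto

lemma leaf_val_le_V0: "norm t \<Longrightarrow> 2 \<le> Y \<Longrightarrow> leaf_val h Y t \<le> leaf_val 0 Y t"
proof (induction rule: norm_induct)
  case (Bn n)
  then show ?case using tower_ge[of Y n] by auto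
next
  case (Add s t)
  then show ?case by (simp add: add_mono)
next
  case (Mul s t)
  then show ?case by (simp add: mult_le_mono)
next
  case (Bin s t)
  then show ?case by (simp add: leaf_val_Bin choose_mono)
next
  case (Fac s)
  then show ?case by (simp add: leaf_val_Fac fact_mono)
next
  case (Exp2 s)
  then show ?case by (simp add: power_increasing)
qed auto

lemma leaf_val_eq_val: "norm t \<Longrightarrow> \<forall>j \<in> leaves t. j < h \<Longrightarrow> leaf_val h Y t = val t"
proof (induction rule: norm_induct)
  case (Bin s t)
  then show ?case by (auto simp: leaf_val_Bin leaves_Bin)
next
  case (Fac s)
  then show ?case by (simp add: leaf_val_Fac)
qed auto

text \<open>On normal forms each operation dominates its operands, so a leaf at or above
  \<open>h\<close> remains visible in the value.\<close>

lemma leaf_val_ge_T: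
  assumes "norm t" "2 \<le> Y" "j \<in> leaves t" "h \<le> j"
  shows "tower j Y \<le> leaf_val h Y t"
  using assms
proof (induction rule: norm_induct)
  case (Mul s t)
  then have "2 \<le> leaf_val h Y s" "2 \<le> leaf_val h Y t" using leaf_val_ge_val[of _ Y h] order_trans by blast+
  then have "leaf_val h Y s + leaf_val h Y t \<le> leaf_val h Y s * leaf_val h Y t" by (rule sum_le_mult)
  with Mul show ?case by auto
next
  case (Bin s t)
  then have "1 \<le> leaf_val h Y s" "1 \<le> leaf_val h Y t" using leaf_val_ge_val[of _ Y h] order_trans by blast+
  then have "leaf_val h Y s + leaf_val h Y t \<le> leaf_val h Y (Bin s t)"
    using choose_ge_sum Bin by (simp add: leaf_val_Bin)
  with Bin show ?case by (auto simp: leaves_Bin)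
next
  case (Fac s)
  then show ?case by (auto simp: leaf_val_Fac intro: order_trans fact_ge_self)
next
  case (Exp2 s)
  then show ?case by (auto intro: order_trans less_imp_le less_exp)
qed auto

section \<open>Growth estimates\<close>

lemma small_le_fact:
  assumes "9 \<le> X"
  shows "4 ^ X \<le> (fact X :: nat)"
  using assms
proof (induction X rule: nat_induct_at_least)
  case base
  show ?case by (simp add: fact_numeral)
next
  case (Suc n)
  then have "4 * 4 ^ n \<le> Suc n * fact n" by (intro mult_le_mono) auto
  then show ?case by simp
qed

lemma mult_self_le_exp: "4 \<le> (x::nat) \<Longrightarrow> x * x \<le> 2 ^ x"
proof (induction x rule: nat_induct_at_least)
  case (Suc n)
  have "Suc n * Suc n = n * n + (2 * n + 1)" by simp
  also have "2 * n + 1 \<le> n * n" using mult_le_mono1[OF Suc.hyps, of n] Suc.hyps by linarith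
  finally show ?case using Suc.IH by simp
qed simp

lemma exp_le_fact: "4 \<le> X \<Longrightarrow> 2 ^ X \<le> (fact X :: nat)"
proof (induction X rule: nat_induct_at_least)
  case base
  show ?case by (simp add: fact_numeral)
next
  case (Suc n)
  then have "2 * 2 ^ n \<le> Suc n * fact n" by (intro mult_le_mono) auto
  then show ?case by simp
qed

text \<open>Each operation costs at most one factorial on top of the larger bound and raises
  \<open>val\<close> by at least 1, so \<open>val t\<close> pays for all of them. The binomial is
  the expensive case: it needs \<open>4 ^ X \<le> fact X\<close>, which starts at 9 and causes the
  condition \<open>9 \<le> Y\<close>.\<close>

lemma leaf_val0_le_T:
  assumes "norm t" "9 \<le> Y" "\<forall>j \<in> leaves t. j \<le> L"
  shows "leaf_val 0 Y t \<le> tower (L + val t) Y"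
  using assms
proof (induction rule: norm_induct)
  case (Var n)
  then show ?case using tower_ge[of Y "L + 3"] by simp
next
  case One
  then show ?case using fact_ge_1 tower_ge[of Y "L + 1"] by (simp del: tower_Suc)
next
  case (Bn n)
  then show ?case using tower_mono[of n "L + 2" Y] by simp
next
  case (Add s t)
  define k where "k = L + max (val s) (val t)"
  have k: "Suc k \<le> L + val (Add s t)" using Add.hyps unfolding k_def by simp
  have X: "9 \<le> tower k Y" using Add.prems tower_ge[of Y k] by simp
  have "leaf_val 0 Y s \<le> tower k Y" "leaf_val 0 Y t \<le> tower k Y"
    using Add tower_mono[of "L + val s" k Y] tower_mono[of "L + val t" k Y] unfolding k_def by auto
  then have "leaf_val 0 Y (Add s t) \<le> tower k Y + tower k Y" by simp
  also have "\<dots> \<le> tower k Y * tower k Y" using X by (intro sum_le_mult) auto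
  also have "\<dots> \<le> fact (tower k Y)" using mult_self_le_exp[of "tower k Y"] exp_le_fact[of "tower k Y"] X by linarith
  also have "\<dots> \<le> tower (L + val (Add s t)) Y" using tower_mono[OF k, of Y] by simp
  finally show ?case .
next
  case (Mul s t)
  define k where "k = L + max (val s) (val t)"
  have "max (val s) (val t) < val (Mul s t)"
    using Mul.hyps sum_le_mult[OF Mul.hyps(3,4)] by (simp only: nat_val.simps)
  then have k: "Suc k \<le> L + val (Mul s t)" unfolding k_def by linarith
  have X: "9 \<le> tower k Y" using Mul.prems tower_ge[of Y k] by simp
  have "leaf_val 0 Y s \<le> tower k Y" "leaf_val 0 Y t \<le> tower k Y"
    using Mul tower_mono[of "L + val s" k Y] tower_mono[of "L + val t" k Y] unfolding k_def by auto
  then have "leaf_val 0 Y (Mul s t) \<le> tower k Y * tower k Y" by (simp add: mult_le_mono)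
  also have "\<dots> \<le> fact (tower k Y)" using mult_self_le_exp[of "tower k Y"] exp_le_fact[of "tower k Y"] X by linarith
  also have "\<dots> \<le> tower (L + val (Mul s t)) Y" using tower_mono[OF k, of Y] by simp
  finally show ?case .
next
  case (Bin s t)
  define k where "k = L + max (val s) (val t)"
  have "max (val s) (val t) < val (Bin s t)"
    using Bin.hyps choose_ge_sum[of "val s" "val t"] by simp
  then have k: "Suc k \<le> L + val (Bin s t)" unfolding k_def by linarith
  have X: "9 \<le> tower k Y" using Bin.prems tower_ge[of Y k] by simp
  have *: "leaf_val 0 Y s \<le> tower k Y" "leaf_val 0 Y t \<le> tower k Y"
    using Bin tower_mono[of "L + val s" k Y] tower_mono[of "L + val t" k Y] unfolding k_def by (auto simp: leaves_Bin)
  have "leaf_val 0 Y (Bin s t) = (leaf_val 0 Y s + leaf_val 0 Y t) choose leaf_val 0 Y t" using Bin by (simp add: leaf_val_Bin)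
  also have "\<dots> \<le> 2 ^ (leaf_val 0 Y s + leaf_val 0 Y t)" by (rule binomial_le_pow2)
  also have "\<dots> \<le> 2 ^ (2 * tower k Y)" using * by (intro power_increasing) auto
  also have "\<dots> = 4 ^ tower k Y" by (simp add: power_mult)
  also have "\<dots> \<le> fact (tower k Y)" using X by (rule small_le_fact)
  also have "\<dots> \<le> tower (L + val (Bin s t)) Y" using tower_mono[OF k, of Y] by (simp del: nat_val.simps)
  finally show ?case .
next
  case (Fac s)
  then have k: "Suc (L + val s) \<le> L + val (Fac s)" using fact_gt[of "val s"] by simp
  have "leaf_val 0 Y (Fac s) \<le> fact (tower (L + val s) Y)" using Fac by (simp add: leaf_val_Fac fact_mono)
  also have "\<dots> \<le> tower (L + val (Fac s)) Y" using tower_mono[OF k, of Y] by (simp del: nat_val.simps)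
  finally show ?case .
next
  case (Exp2 s)
  then have k: "Suc (L + val s) \<le> L + val (Exp2 s)" using less_exp[of "val s"] by (simp add: Suc_le_eq)
  have X: "9 \<le> tower (L + val s) Y" using Exp2.prems tower_ge[of Y "L + val s"] by simp
  have "leaf_val 0 Y (Exp2 s) \<le> 2 ^ tower (L + val s) Y" using Exp2 by (simp add: power_increasing)
  also have "\<dots> \<le> fact (tower (L + val s) Y)" using X by (intro exp_le_fact) simp
  also have "\<dots> \<le> tower (L + val (Exp2 s)) Y" using tower_mono[OF k, of Y] by (simp del: nat_val.simps)
  finally show ?case .
qed auto

lemma fact_pow_le: "fact b ^ z \<le> (fact (b * z) :: nat)"
proof (induction z)
  case (Suc z)
  have "fact b ^ Suc z \<le> fact b * (fact (b * z) :: nat)" using Suc by simp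
  also have "\<dots> \<le> fact (b + b * z)"
    using fact_fact_dvd_fact[of b "b * z", where ?'a = nat] by (intro dvd_imp_le) auto
  finally show ?case by simp
qed simp

text \<open>The case 0 shows the gain from raising the base by 1:
  \<open>(Y!)! ^ Y <= (Y! * Y)! <= ((Y + 1)!)!\<close>. The exponent gained lies only two levels
  below the leaf.\<close>

lemma tower_Suc_ge_pow: "2 \<le> Y \<Longrightarrow> tower (n + 2) Y ^ tower n Y \<le> tower (n + 2) (Suc Y)"
proof (induction n)
  case 0
  have "fact (fact Y) ^ Y \<le> (fact (fact Y * Y) :: nat)" by (rule fact_pow_le)
  also have "\<dots> \<le> fact (fact (Suc Y))" by (intro fact_mono_nat) simp
  finally show ?case by (simp add: numeral_2_eq_2)
next
  case (Suc n)
  define X p where "X = tower (n + 2) Y" and "p = tower n Y"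
  have X: "X = fact (fact p)" unfolding X_def p_def by (simp add: numeral_2_eq_2)
  have p: "2 \<le> p" using Suc.prems tower_ge[of Y n] unfolding p_def by simp
  have "fact p \<le> X" unfolding X by (rule fact_ge_self)
  then have "X * fact p \<le> X * X" by simp
  also have "\<dots> \<le> X ^ p" using p fact_ge_1[of "fact p", where ?'a = nat]
    by (metis X One_nat_def Suc_leI fact_gt_zero power2_eq_square power_increasing)
  also have "\<dots> \<le> tower (n + 2) (Suc Y)" using Suc unfolding X_def p_def by simp
  finally have "fact (X * fact p) \<le> (fact (tower (n + 2) (Suc Y)) :: nat)" by (rule fact_mono_nat)
  with fact_pow_le[of X "fact p"] have "fact X ^ fact p \<le> (fact (tower (n + 2) (Suc Y)) :: nat)"
    by (rule order_trans)
  then show ?case unfolding X_def p_def by simp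
qed

text \<open>The slack of \<open>N\<close> nested operations, \<open>(2 * l) ^ N\<close>, costs only
  two levels above \<open>l\<close>.\<close>

lemma pow_le_tower2:
  assumes "9 \<le> x" "2 * N \<le> x"
  shows "(2 * x) ^ N \<le> tower 2 x"
proof -
  have "(2 * x) ^ N \<le> (x * x) ^ N" using assms by (intro power_mono mult_le_mono1) auto
  also have "\<dots> = x ^ (2 * N)" by (simp add: power_mult power2_eq_square)
  also have "\<dots> \<le> x ^ x" using assms by (intro power_increasing) auto
  also have "\<dots> \<le> (2 ^ x) ^ x" using less_exp[of x] by (intro power_mono) auto
  also have "\<dots> = 2 ^ (x * x)" by (simp add: power_mult)
  also have "\<dots> \<le> 2 ^ fact x"
    using mult_self_le_exp[of x] exp_le_fact[of x] assms by (intro power_increasing) auto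
  also have "\<dots> \<le> fact (fact x)"
    using assms fact_ge_self[of x] by (intro exp_le_fact) linarith
  finally show ?thesis by (simp add: numeral_2_eq_2)
qed

text \<open>Spends one factor \<open>2 * l\<close> of the exponent on an operation whose result is
  at most the square of an operand.\<close>

lemma pow_absorb:
  assumes "x \<le> b * b" "1 \<le> (b::nat)" "1 \<le> l" "b ^ (2 * l * z) \<le> c"
  shows "x ^ z \<le> c"
proof -
  have "x ^ z \<le> (b * b) ^ z" using assms by (intro power_mono) auto
  also have "\<dots> = b ^ (2 * z)" by (simp add: power_mult power2_eq_square)
  also have "\<dots> \<le> b ^ (2 * l * z)" using assms by (intro power_increasing) auto
  finally show ?thesis using assms by simp
qed

lemma mult_absorb:
  assumes "2 \<le> (b::nat)" "2 \<le> l" "1 \<le> z"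
  shows "2 * b * z \<le> b ^ (2 * l * z)"
proof -
  have "2 * z < 2 ^ (2 * z)" by (rule less_exp)
  also have "\<dots> \<le> b ^ (2 * z)" using assms by (intro power_mono) auto
  finally have "b * (2 * z) \<le> b * b ^ (2 * z)" by simp
  also have "\<dots> = b ^ Suc (2 * z)" by simp
  also have "Suc (2 * z) \<le> 2 * z + 2 * z" using assms by simp
  then have "b ^ Suc (2 * z) \<le> b ^ (2 * 2 * z)" using assms by (intro power_increasing) auto
  also have "\<dots> \<le> b ^ (2 * l * z)" using assms by (intro power_increasing mult_le_mono) auto
  finally show ?thesis by (simp add: ac_simps)
qed

text \<open>The classical lower bound (n/k)^k for binomial coefficients, by
  \<open>k * (n choose k) = n * (n - 1 choose k - 1)\<close>.\<close>

lemma pow_le_choose: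
  assumes "q * k \<le> n" "1 \<le> q"
  shows "q ^ k \<le> n choose k"
  using assms(1)
proof (induction k arbitrary: n)
  case (Suc k)
  then have "q * k + q \<le> n" by simp
  then have "q * k \<le> n - 1" "n > 0" using assms(2) by linarith+
  then obtain m where n: "n = Suc m" and m: "q * k \<le> m" by (cases n) auto
  have "Suc k * q ^ Suc k = (q * Suc k) * q ^ k" by (simp only: power_Suc ac_simps)
  also have "\<dots> \<le> n * (m choose k)" using Suc.prems Suc.IH[OF m] by (rule mult_le_mono)
  also have "\<dots> = Suc k * (n choose Suc k)" unfolding n by (simp only: Suc_times_binomial_eq mult.commute)
  finally show ?case by (simp only: mult_le_cancel1 zero_less_Suc simp_thms)
qed simp

text \<open>Both operands are above the gap. From above, the smaller operand \<open>p\<close> goes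
  into the exponent and yields \<open>q ^ (2 * p * z)\<close>; from below,
  \<open>pow_le_choose\<close> recovers the same power of \<open>q\<close>.\<close>

lemma choose_absorb:
  assumes "p \<le> q" "2 \<le> p" "2 \<le> l" "1 \<le> z" "p ^ (2 * l * z) \<le> B" "q ^ (2 * l * z) \<le> C"
  shows "((p + q) choose p) ^ z \<le> (B + C) choose B"
proof -
  have "(p + q) choose p \<le> (p + q) ^ p" by (rule binomial_le_pow) simp
  also have "\<dots> \<le> (q * q) ^ p" using assms sum_le_mult[of q q]
    by (intro power_mono) auto
  also have "\<dots> = q ^ (2 * p)" by (simp add: power_mult power2_eq_square)
  finally have "((p + q) choose p) ^ z \<le> (q ^ (2 * p)) ^ z" by (rule power_mono) simp
  also have "\<dots> = q ^ (2 * p * z)" by (simp add: power_mult)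
  also have "\<dots> \<le> (2 * p * z + C) choose (2 * p * z)"
  proof (rule pow_le_choose)
    have "q * (2 * p * z) \<le> q * (2 * q * z)" using assms by simp
    also have "\<dots> = (2 * z) * (q * q)" by simp
    also have "\<dots> \<le> q ^ (2 * z) * q ^ 2"
    proof (rule mult_le_mono)
      have "2 * z \<le> 2 ^ (2 * z)" using less_exp[of "2 * z"] by simp
      also have "\<dots> \<le> q ^ (2 * z)" using assms by (intro power_mono) auto
      finally show "2 * z \<le> q ^ (2 * z)" .
    qed (simp add: power2_eq_square)
    also have "\<dots> = q ^ (2 * z + 2)" by (simp only: power_add)
    also have "\<dots> \<le> q ^ (2 * 2 * z)" using assms by (intro power_increasing) auto
    also have "\<dots> \<le> q ^ (2 * l * z)" using assms by (intro power_increasing mult_le_mono) auto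
    finally show "q * (2 * p * z) \<le> 2 * p * z + C" using assms(6) by simp
  qed (use assms in simp)
  also have "\<dots> \<le> (B + C) choose B"
  proof -
    have "2 * p * z \<le> B" using mult_absorb[of p l z] assms by simp
    then show ?thesis using choose_mono[of C C "2 * p * z" B] by (simp add: add.commute)
  qed
  finally show ?thesis .
qed

section \<open>Comparison of valuations across a gap\<close>

lemma larger_high:
  fixes x y l :: nat
  assumes "P \<and> l \<le> x \<or> \<not> P \<and> x \<le> l" "Q \<and> l \<le> y \<or> \<not> Q \<and> y \<le> l" "P \<or> Q"
  shows "P \<and> l \<le> x \<and> y \<le> x \<or> Q \<and> l \<le> y \<and> x \<le> y"
  using assms by (cases P; cases Q) auto

text \<open>Without a leaf at or above \<open>h\<close>, all leaves lie below
  \<open>h - (N + 5)\<close> and the operations add at most \<open>N\<close> factorials. Hence the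
  width \<open>N + 5\<close>: five levels remain for the slack.\<close>

lemma leaf_val0_dichotomy:
  assumes "9 \<le> Y" "N + 5 \<le> h" "norm t" "\<forall>j \<in> leaves t. j < h - (N + 5) \<or> h \<le> j" "val t \<le> N"
  shows "(\<exists>j \<in> leaves t. h \<le> j) \<and> tower (h - 5) Y \<le> leaf_val 0 Y t \<or> \<not> (\<exists>j \<in> leaves t. h \<le> j) \<and> leaf_val 0 Y t \<le> tower (h - 5) Y"
proof (cases "\<exists>j \<in> leaves t. h \<le> j")
  case True
  then obtain j where j: "j \<in> leaves t" "h \<le> j" by blast
  have "tower (h - 5) Y \<le> tower j Y" using j by (intro tower_mono) simp
  also have "\<dots> \<le> leaf_val 0 Y t" using assms j by (intro leaf_val_ge_T) auto
  finally show ?thesis using True by blast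
next
  case False
  have "leaf_val 0 Y t \<le> tower (h - (N + 5) + val t) Y"
    using False assms by (intro leaf_val0_le_T) auto
  also have "\<dots> \<le> tower (h - 5) Y" using assms by (intro tower_mono) simp
  finally show ?thesis using False by blast
qed

text \<open>Passing from \<open>Y\<close> to \<open>Y + 1\<close> compensates for the collapse of all small leaves to their true
  value \<open>2\<close>: a leaf \<open>tower j Y\<close> with \<open>j\<close> above the gap grows by a power that dwarfs everything
  built from leaves below the gap.  The exponent \<open>(2 l) ^ k\<close> is the slack that the
  induction consumes.\<close>

lemma leaf_val0_le_V_aux:
  assumes Y: "9 \<le> Y" "2 * N \<le> Y" and h: "N + 5 \<le> h" and l: "l = tower (h - 5) Y"
    and a: "norm a" "\<forall>j \<in> leaves a. j < h - (N + 5) \<or> h \<le> j" "\<exists>j \<in> leaves a. h \<le> j" "k + val a \<le> N"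
  shows "leaf_val 0 Y a ^ ((2 * l) ^ k) \<le> leaf_val h (Suc Y) a"
proof -
  have lY: "9 \<le> l" "2 * N \<le> l" using tower_ge[of Y "h - 5"] Y unfolding l by auto
  define gap where "gap t \<longleftrightarrow> (\<forall>j \<in> leaves t. j < h - (N + 5) \<or> h \<le> j)" for t
  define high where "high t \<longleftrightarrow> (\<exists>j \<in> leaves t. h \<le> j)" for t
  have dich: "high t \<and> l \<le> leaf_val 0 Y t \<or> \<not> high t \<and> leaf_val 0 Y t \<le> l" if "norm t" "gap t" "val t \<le> N" for t
    using leaf_val0_dichotomy[OF Y(1) h that(1) _ that(3)] that(2) unfolding gap_def high_def l by blast
  have Vh: "1 \<le> leaf_val h (Suc Y) t" if "norm t" "1 \<le> val t" for t
    using leaf_val_ge_val[OF that(1), of "Suc Y" h] that(2) Y by linarith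
  have absorb: "x ^ ((2 * l) ^ k) \<le> leaf_val h (Suc Y) s"
    if "x \<le> leaf_val 0 Y s * leaf_val 0 Y s" "l \<le> leaf_val 0 Y s" "leaf_val 0 Y s ^ ((2 * l) ^ Suc k) \<le> leaf_val h (Suc Y) s" for x s k
    using pow_absorb[OF that(1), of l "(2 * l) ^ k"] that lY by simp
  have main: "gap a \<Longrightarrow> high a \<Longrightarrow> k + val a \<le> N \<Longrightarrow> leaf_val 0 Y a ^ ((2 * l) ^ k) \<le> leaf_val h (Suc Y) a"
    using a(1)
  proof (induction a arbitrary: k rule: norm_induct)
    case (Bn n)
    then have n: "h \<le> n" "k \<le> N" by (auto simp: high_def)
    \<comment> \<open>At a leaf all slack falls due: \<open>l\<close> is at level
      \<open>h - 5\<close>, the slack at most two levels higher, and this is below level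
      \<open>n - 2\<close>, the exponent that \<open>tower_Suc_ge_pow\<close> pays for.\<close>
    have "(2 * l) ^ k \<le> (2 * l) ^ N" using n lY by (intro power_increasing) auto
    also have "\<dots> \<le> tower 2 l" using lY by (rule pow_le_tower2)
    also have "\<dots> = tower (2 + (h - 5)) Y" unfolding l tower_add ..
    also have "\<dots> \<le> tower (n - 2) Y" using n h by (intro tower_mono) linarith
    finally have "tower n Y ^ ((2 * l) ^ k) \<le> tower n Y ^ tower (n - 2) Y"
      using tower_ge[of Y n] Y by (intro power_increasing) auto
    also have "n - 2 + 2 = n" using n h by simp
    then have "tower n Y ^ tower (n - 2) Y \<le> tower n (Suc Y)"
      using tower_Suc_ge_pow[of Y "n - 2"] Y by simp
    finally show ?case using n by simp
  next
    case (Add s t)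
    have g: "gap s" "gap t" "high s \<or> high t" using Add.prems by (auto simp: gap_def high_def)
    \<comment> \<open>The operands have smaller value, which pays for the larger \<open>k\<close> in
      the induction hypothesis.\<close>
    have v: "Suc k + val s \<le> N" "Suc k + val t \<le> N" using Add.prems Add.hyps by auto
    have "high s \<and> l \<le> leaf_val 0 Y s \<or> \<not> high s \<and> leaf_val 0 Y s \<le> l"
      "high t \<and> l \<le> leaf_val 0 Y t \<or> \<not> high t \<and> leaf_val 0 Y t \<le> l"
      using dich[of s] dich[of t] Add.hyps g v by linarith+
    from larger_high[OF this g(3)]
    consider "high s" "l \<le> leaf_val 0 Y s" "leaf_val 0 Y t \<le> leaf_val 0 Y s" | "high t" "l \<le> leaf_val 0 Y t" "leaf_val 0 Y s \<le> leaf_val 0 Y t"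
      by blast
    then show ?case
    proof cases
      case 1
      have "leaf_val 0 Y (Add s t) \<le> leaf_val 0 Y s * leaf_val 0 Y s"
        using 1(2,3) lY(1) sum_le_mult[of "leaf_val 0 Y s" "leaf_val 0 Y s"] by simp
      from absorb[OF this 1(2) Add.IH(1)[OF g(1) 1(1) v(1)]]
      show ?thesis by (simp del: power_Suc)
    next
      case 2
      have "leaf_val 0 Y (Add s t) \<le> leaf_val 0 Y t * leaf_val 0 Y t"
        using 2(2,3) lY(1) sum_le_mult[of "leaf_val 0 Y t" "leaf_val 0 Y t"] by simp
      from absorb[OF this 2(2) Add.IH(2)[OF g(2) 2(1) v(2)]]
      show ?thesis by (simp del: power_Suc)
    qed
  next
    case (Mul s t)
    have g: "gap s" "gap t" "high s \<or> high t" using Mul.prems by (auto simp: gap_def high_def)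
    have "val s + val t \<le> val (Mul s t)" using Mul.hyps sum_le_mult by simp
    then have v: "Suc k + val s \<le> N" "Suc k + val t \<le> N" using Mul.prems(3) Mul.hyps by linarith+
    have "high s \<and> l \<le> leaf_val 0 Y s \<or> \<not> high s \<and> leaf_val 0 Y s \<le> l"
      "high t \<and> l \<le> leaf_val 0 Y t \<or> \<not> high t \<and> leaf_val 0 Y t \<le> l"
      using dich[of s] dich[of t] Mul.hyps g v by linarith+
    from larger_high[OF this g(3)]
    consider "high s" "l \<le> leaf_val 0 Y s" "leaf_val 0 Y t \<le> leaf_val 0 Y s" | "high t" "l \<le> leaf_val 0 Y t" "leaf_val 0 Y s \<le> leaf_val 0 Y t"
      by blast
    then show ?case
    proof cases
      case 1
      have "leaf_val 0 Y (Mul s t) \<le> leaf_val 0 Y s * leaf_val 0 Y s"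
        using 1(3) by simp
      from absorb[OF this 1(2) Mul.IH(1)[OF g(1) 1(1) v(1)]]
      have "leaf_val 0 Y (Mul s t) ^ ((2 * l) ^ k) \<le> leaf_val h (Suc Y) s" .
      also have "\<dots> \<le> leaf_val h (Suc Y) (Mul s t)" using Vh[of t] Mul.hyps by simp
      finally show ?thesis .
    next
      case 2
      have "leaf_val 0 Y (Mul s t) \<le> leaf_val 0 Y t * leaf_val 0 Y t"
        using 2(3) by simp
      from absorb[OF this 2(2) Mul.IH(2)[OF g(2) 2(1) v(2)]]
      have "leaf_val 0 Y (Mul s t) ^ ((2 * l) ^ k) \<le> leaf_val h (Suc Y) t" .
      also have "\<dots> \<le> leaf_val h (Suc Y) (Mul s t)" using Vh[of s] Mul.hyps by simp
      finally show ?thesis .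
    qed
  next
    case (Bin s t)
    have g: "gap s" "gap t" "high s \<or> high t"
      using Bin.prems Bin.hyps by (auto simp: gap_def high_def leaves_Bin)
    have "val s + val t \<le> val (Bin s t)" using Bin.hyps choose_ge_sum by simp
    then have v: "Suc k + val s \<le> N" "Suc k + val t \<le> N" using Bin.prems(3) Bin.hyps by linarith+
    let ?z = "(2 * l) ^ k"
    have z: "1 \<le> ?z" using lY by simp
    have comm: "(x + y) choose y = (y + x) choose x" for x y :: nat
      using binomial_symmetric[of y "x + y"] by (simp add: add.commute)
    \<comment> \<open>One high and one low operand. This case dictates the factor
      \<open>2 * l\<close>: the low operand is at most \<open>l\<close>, so the binomial is at most
      the high one to the power \<open>2 * l\<close>.\<close>
    have low: "((leaf_val 0 Y s + leaf_val 0 Y t) choose leaf_val 0 Y t) ^ ?z \<le> (leaf_val h (Suc Y) s + leaf_val h (Suc Y) t) choose leaf_val h (Suc Y) t"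
      if "norm s" "norm t" "1 \<le> val s" "1 \<le> val t" "l \<le> leaf_val 0 Y s" "leaf_val 0 Y t \<le> l"
        "leaf_val 0 Y s ^ ((2 * l) ^ Suc k) \<le> leaf_val h (Suc Y) s" for s t
    proof -
      let ?b = "leaf_val 0 Y s" and ?c = "leaf_val 0 Y t"
      have "(?b + ?c) choose ?c \<le> (?b + ?c) ^ ?c" by (rule binomial_le_pow) simp
      also have "\<dots> \<le> (?b * ?b) ^ ?c"
        using that lY sum_le_mult[of ?b ?b] by (intro power_mono) auto
      also have "\<dots> \<le> (?b * ?b) ^ l" using that lY by (intro power_increasing) auto
      also have "\<dots> = ?b ^ (2 * l)" by (simp add: power_mult power2_eq_square)
      finally have "((?b + ?c) choose ?c) ^ ?z \<le> (?b ^ (2 * l)) ^ ?z" by (rule power_mono) simp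
      also have "\<dots> = ?b ^ ((2 * l) ^ Suc k)" by (simp only: power_mult[symmetric] power_Suc)
      also have "\<dots> \<le> leaf_val h (Suc Y) s" by (rule that)
      also have "\<dots> \<le> (leaf_val h (Suc Y) s + leaf_val h (Suc Y) t) choose leaf_val h (Suc Y) t"
        using choose_ge_sum[of "leaf_val h (Suc Y) s" "leaf_val h (Suc Y) t"] Vh[of s] Vh[of t] that by linarith
      finally show ?thesis .
    qed
    have "high s \<and> l \<le> leaf_val 0 Y s \<or> \<not> high s \<and> leaf_val 0 Y s \<le> l"
      "high t \<and> l \<le> leaf_val 0 Y t \<or> \<not> high t \<and> leaf_val 0 Y t \<le> l"
      using dich[of s] dich[of t] Bin.hyps g v by linarith+
    then consider "high s" "high t" "l \<le> leaf_val 0 Y s" "l \<le> leaf_val 0 Y t"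
      | "high s" "l \<le> leaf_val 0 Y s" "leaf_val 0 Y t \<le> l" | "high t" "l \<le> leaf_val 0 Y t" "leaf_val 0 Y s \<le> l"
      using g(3) by blast
    then show ?case
    proof cases
      case 1
      note IH = Bin.IH(1)[OF g(1) 1(1) v(1)] Bin.IH(2)[OF g(2) 1(2) v(2)]
      have IH': "leaf_val 0 Y s ^ (2 * l * ?z) \<le> leaf_val h (Suc Y) s" "leaf_val 0 Y t ^ (2 * l * ?z) \<le> leaf_val h (Suc Y) t"
        using IH by simp_all
      show ?thesis
      proof (cases "leaf_val 0 Y s \<le> leaf_val 0 Y t")
        case True
        then show ?thesis
          using choose_absorb[of "leaf_val 0 Y s" "leaf_val 0 Y t" l ?z, OF _ _ _ z IH'] 1 lY Bin.hyps
          by (simp add: leaf_val_Bin comm[of "leaf_val 0 Y s"] comm[of "leaf_val h (Suc Y) s"] add.commute)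
      next
        case False
        then show ?thesis
          using choose_absorb[of "leaf_val 0 Y t" "leaf_val 0 Y s" l ?z, OF _ _ _ z IH'(2,1)] 1 lY Bin.hyps
          by (simp add: leaf_val_Bin add.commute)
      qed
    next
      case 2
      then show ?thesis using low[of s t] Bin.IH(1)[OF g(1) 2(1) v(1)] Bin.hyps by (simp add: leaf_val_Bin)
    next
      case 3
      then show ?thesis using low[of t s] Bin.IH(2)[OF g(2) 3(1) v(2)] Bin.hyps
        by (simp add: leaf_val_Bin comm[of "leaf_val 0 Y s"] comm[of "leaf_val h (Suc Y) s"])
    qed
  next
    case (Fac s)
    have g: "gap s" "high s" using Fac.prems Fac.hyps by (auto simp: gap_def high_def)
    have "val s < val (Fac s)" using fact_gt Fac.hyps by simp
    then have v: "Suc k + val s \<le> N" using Fac.prems(3) by linarith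
    let ?z = "(2 * l) ^ k"
    have "l \<le> leaf_val 0 Y s" using dich[of s] Fac.hyps g v by auto
    then have "leaf_val 0 Y s * ?z \<le> leaf_val 0 Y s ^ (2 * l * ?z)"
      using mult_absorb[of "leaf_val 0 Y s" l ?z] lY by simp
    also have "\<dots> \<le> leaf_val h (Suc Y) s" using Fac.IH[OF g v] by simp
    finally have "fact (leaf_val 0 Y s * ?z) \<le> (fact (leaf_val h (Suc Y) s) :: nat)" by (rule fact_mono_nat)
    with fact_pow_le[of "leaf_val 0 Y s" ?z] show ?case using Fac.hyps by (simp add: leaf_val_Fac del: fact_mono_nat)
  next
    case (Exp2 s)
    have g: "gap s" "high s" using Exp2.prems Exp2.hyps by (auto simp: gap_def high_def)
    have "val s < val (Exp2 s)" by simp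
    then have v: "Suc k + val s \<le> N" using Exp2.prems(3) by linarith
    let ?z = "(2 * l) ^ k"
    have "l \<le> leaf_val 0 Y s" using dich[of s] Exp2.hyps g v by auto
    then have "leaf_val 0 Y s * ?z \<le> leaf_val 0 Y s ^ (2 * l * ?z)"
      using mult_absorb[of "leaf_val 0 Y s" l ?z] lY by simp
    also have "\<dots> \<le> leaf_val h (Suc Y) s" using Exp2.IH[OF g v] by simp
    finally show ?case by (simp add: power_increasing flip: power_mult)
  qed (auto simp: high_def)
  show ?thesis using main a unfolding gap_def high_def by blast
qed

lemma leaf_val0_le_V:
  assumes "9 \<le> Y" "2 * N \<le> Y" "N + 5 \<le> h"
    "norm a" "\<forall>j \<in> leaves a. j < h - (N + 5) \<or> h \<le> j" "\<exists>j \<in> leaves a. h \<le> j" "val a \<le> N"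
  shows "leaf_val 0 Y a \<le> leaf_val h (Suc Y) a"
  using leaf_val0_le_V_aux[OF assms(1-3) HOL.refl assms(4-6), of 0] assms(7) by simp

section \<open>Finiteness of the normal forms in a class\<close>

lemma nat_val_subst: "nat_val \<rho> (subst \<sigma> t) = nat_val (\<lambda>n. nat_val \<rho> (\<sigma> n)) t"
  by (induction t) auto

lemma nat_val_cong: "(\<And>n. n \<in> vars t \<Longrightarrow> \<rho> n = \<rho>' n) \<Longrightarrow> nat_val \<rho> t = nat_val \<rho>' t"
  by (induction t) auto

lemma nat_val_pos: "norm t \<Longrightarrow> t \<noteq> Zero \<Longrightarrow> (\<And>n. 1 \<le> \<rho> n) \<Longrightarrow> 1 \<le> nat_val \<rho> t"
  by (induction t) (auto simp: Suc_le_eq zero_less_binomial_iff)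

text \<open>At positive values the operations dominate their operands, so a normal form really
  depends on each of its variables.\<close>

lemma nat_val_ge_var:
  assumes "norm t" "n \<in> vars t" "\<And>n. 1 \<le> \<rho> n"
  shows "\<rho> n \<le> nat_val \<rho> t"
  using assms(1,2)
proof (induction t)
  case (Mul s t)
  then have "1 \<le> nat_val \<rho> s" "1 \<le> nat_val \<rho> t" using assms(3) nat_val_pos[of s \<rho>] nat_val_pos[of t \<rho>] by auto
  then have "nat_val \<rho> s \<le> nat_val \<rho> s * nat_val \<rho> t" "nat_val \<rho> t \<le> nat_val \<rho> s * nat_val \<rho> t" by auto
  moreover have "\<rho> n \<le> nat_val \<rho> s \<or> \<rho> n \<le> nat_val \<rho> t" using Mul by auto
  ultimately show ?case by (simp only: nat_val.simps) linarith
next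
  case (Bin s t)
  then have "1 \<le> nat_val \<rho> s" "1 \<le> nat_val \<rho> t" using assms(3) nat_val_pos[of s \<rho>] nat_val_pos[of t \<rho>] by auto
  from choose_ge_sum[OF this] Bin show ?case by auto
next
  case (Fac s)
  then show ?case by (auto intro: order_trans fact_ge_self)
next
  case (Exp2 s)
  then show ?case by (auto intro: order_trans less_imp_le less_exp)
qed auto

section \<open>Finitely many normal forms of bounded leaves, variables and value\<close>

primrec subts :: "trm \<Rightarrow> trm set" where
  "subts (Var n) = {Var n}"
| "subts Zero = {Zero}"
| "subts One = {One}"
| "subts (Add s t) = insert (Add s t) (subts s \<union> subts t)"
| "subts (Mul s t) = insert (Mul s t) (subts s \<union> subts t)"
| "subts (Bin s t) = insert (Bin s t) (subts s \<union> subts t)"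
| "subts (Fac s) = insert (Fac s) (subts s)"
| "subts (Exp2 s) = insert (Exp2 s) (subts s)"

lemma finite_subts: "finite (subts t)"
  by (induction t) auto

lemma self_subts: "t \<in> subts t"
  by (cases t) auto

primrec height :: "trm \<Rightarrow> nat" where
  "height (Var n) = 0"
| "height Zero = 0"
| "height One = 0"
| "height (Add s t) = Suc (max (height s) (height t))"
| "height (Mul s t) = Suc (max (height s) (height t))"
| "height (Bin s t) = Suc (max (height s) (height t))"
| "height (Fac s) = Suc (height s)"
| "height (Exp2 s) = Suc (height s)"

lemma finite_height: "finite X \<Longrightarrow> finite {t. height t \<le> k \<and> vars t \<subseteq> X}"
proof (induction k)
  case 0
  have "{t. height t \<le> 0 \<and> vars t \<subseteq> X} \<subseteq> {Zero, One} \<union> Var ` X"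
  proof
    fix t assume "t \<in> {t. height t \<le> 0 \<and> vars t \<subseteq> X}"
    then show "t \<in> {Zero, One} \<union> Var ` X" by (cases t) auto
  qed
  then show ?case using 0 by (auto intro: finite_subset)
next
  case (Suc k)
  let ?S = "{t. height t \<le> k \<and> vars t \<subseteq> X}"
  let ?R = "{Zero, One} \<union> Var ` X \<union> Fac ` ?S \<union> Exp2 ` ?S \<union>
    (\<lambda>(s, t). Add s t) ` (?S \<times> ?S) \<union> (\<lambda>(s, t). Mul s t) ` (?S \<times> ?S) \<union> (\<lambda>(s, t). Bin s t) ` (?S \<times> ?S)"
  have "{t. height t \<le> Suc k \<and> vars t \<subseteq> X} \<subseteq> ?R"
  proof
    fix t assume "t \<in> {t. height t \<le> Suc k \<and> vars t \<subseteq> X}"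
    then show "t \<in> ?R" by (cases t) (auto simp: image_iff)
  qed
  moreover have "finite ?S" using Suc by blast
  then have "finite ?R" using Suc.prems by (intro finite_UnI finite_imageI finite_SigmaI) auto
  ultimately show ?case by (rule finite_subset)
qed

lemma height_Bn: "height (Bn n) = Suc n"
  by (induction n) (auto simp: Bn_0 Bn_Suc)

lemma height_le: "norm t \<Longrightarrow> \<forall>j \<in> leaves t. j \<le> M \<Longrightarrow> height t \<le> M + val t"
proof (induction rule: norm_induct)
  case (Mul s t)
  then have "val s + val t \<le> val (Mul s t)" using sum_le_mult by simp
  then show ?case using Mul by auto
next
  case (Bin s t)
  then have "val s + val t \<le> val (Bin s t)" using choose_ge_sum by simp
  moreover have "height s \<le> M + val s" "height t \<le> M + val t"
    using Bin by (auto simp: leaves_Bin)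
  ultimately show ?case using Bin.hyps by (simp only: height.simps)
next
  case (Fac s)
  then show ?case using fact_gt[of "val s"] by simp
next
  case (Exp2 s)
  then have "height s \<le> M + val s" by simp
  moreover have "val s < val (Exp2 s)" by simp
  ultimately show ?case unfolding height.simps by linarith
qed (auto simp: height_Bn)

lemma finite_norm:
  assumes "finite X"
  shows "finite {t. norm t \<and> vars t \<subseteq> X \<and> (\<forall>j \<in> leaves t. j \<le> M) \<and> val t = N}"
  by (rule finite_subset[OF _ finite_height[OF assms, of "M + N"]]) (auto dest: height_le)

abbreviation "nf0 \<equiv> nf Two Two"

lemma norm_nf0: "norm (nf0 t)"
  by (rule norm_nf) simp

text \<open>Normalizing first is harmless, since \<open>Omega\<close> holds for numbers. At
  \<open>h = 0\<close> the binomial equation would fail for \<open>Bin One One\<close>, whose value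
  is then \<open>Y\<close>.\<close>

lemma leaf_val_nf0_simps:
  assumes "1 \<le> h"
  shows "leaf_val h Y (nf0 (Add s t)) = leaf_val h Y (nf0 s) + leaf_val h Y (nf0 t)"
    "leaf_val h Y (nf0 (Mul s t)) = leaf_val h Y (nf0 s) * leaf_val h Y (nf0 t)"
    "leaf_val h Y (nf0 (Bin s t)) = (leaf_val h Y (nf0 s) + leaf_val h Y (nf0 t)) choose leaf_val h Y (nf0 t)"
    "nf0 s \<noteq> Bn (h - 1) \<Longrightarrow> leaf_val h Y (nf0 (Fac s)) = fact (leaf_val h Y (nf0 s))"
    "leaf_val h Y (nf0 (Exp2 s)) = 2 ^ leaf_val h Y (nf0 s)"
  using assms by (auto simp: leaf_val.simps(6,7) numeral_2_eq_2)

section \<open>Derivations as chains of steps\<close>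

locale arith_theory =
  fixes \<Sigma> :: "eqn set"
  assumes fin: "finite \<Sigma>" and valid: "\<And>e. e \<in> \<Sigma> \<Longrightarrow> nat_valid e"
    and omega: "\<And>e. e \<in> Omega \<Longrightarrow> \<Sigma> \<turnstile> e"
begin

lemma sound: "\<Sigma> \<turnstile> e \<Longrightarrow> nat_val \<rho> (fst e) = nat_val \<rho> (snd e)"
proof (induction rule: entails.induct)
  case (ax s t \<sigma>)
  then show ?case using valid[OF ax] by (simp add: nat_valid_def nat_val_subst)
qed auto

lemma sound': "\<Sigma> \<turnstile> (s, t) \<Longrightarrow> nat_val \<rho> s = nat_val \<rho> t"
  using sound[of "(s, t)"] by simp

lemma subst_entails:
  assumes "\<Sigma> \<turnstile> e"
  shows "\<Sigma> \<turnstile> (subst \<sigma> (fst e), subst \<sigma> (snd e))"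
  using assms
proof (induction rule: entails.induct)
  case (ax s t \<tau>)
  have "subst \<sigma> (subst \<tau> u) = subst (\<lambda>n. subst \<sigma> (\<tau> n)) u" for u by (induction u) auto
  then show ?case using entails.ax[OF ax] by simp
qed (auto intro: entails.intros)

lemma omega_inst:
  assumes "(s, t) \<in> Omega"
  shows "\<Sigma> \<turnstile> (subst (\<lambda>_. u) s, subst (\<lambda>_. u) t)"
  using subst_entails[OF omega[OF assms]] by simp

lemma omega_laws:
  "\<Sigma> \<turnstile> (Mul One u, u)" "\<Sigma> \<turnstile> (Mul u One, u)" "\<Sigma> \<turnstile> (Bin u Zero, One)" "\<Sigma> \<turnstile> (Bin Zero u, One)"
  "\<Sigma> \<turnstile> (Add Zero u, u)" "\<Sigma> \<turnstile> (Add u Zero, u)" "\<Sigma> \<turnstile> (Mul Zero u, Zero)" "\<Sigma> \<turnstile> (Mul u Zero, Zero)"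
  "\<Sigma> \<turnstile> (Fac Zero, One)" "\<Sigma> \<turnstile> (Fac One, One)" "\<Sigma> \<turnstile> (Exp2 Zero, One)" "\<Sigma> \<turnstile> (Exp2 One, Two)"
  "\<Sigma> \<turnstile> (Fac Two, Two)"
proof -
  note inst = omega_inst[of _ _ u]
  have "\<Sigma> \<turnstile> (Mul One u, Mul u One)" "\<Sigma> \<turnstile> (Add Zero u, Add u Zero)"
    "\<Sigma> \<turnstile> (Mul Zero u, Mul u Zero)" "\<Sigma> \<turnstile> (One, Bin Zero u)" "\<Sigma> \<turnstile> (Two, Fac Two)"
    using inst[of "Mul One (Var 0)" "Mul (Var 0) One"] inst[of "Add Zero (Var 0)" "Add (Var 0) Zero"]
      inst[of "Mul Zero (Var 0)" "Mul (Var 0) Zero"] inst[of One "Bin Zero (Var 0)"]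
      inst[of Two "Fac Two"]
    by (auto simp: Omega_def Let_def)
  moreover show "\<Sigma> \<turnstile> (Mul u One, u)" "\<Sigma> \<turnstile> (Bin u Zero, One)" "\<Sigma> \<turnstile> (Add u Zero, u)"
    "\<Sigma> \<turnstile> (Mul u Zero, Zero)" "\<Sigma> \<turnstile> (Fac Zero, One)" "\<Sigma> \<turnstile> (Fac One, One)" "\<Sigma> \<turnstile> (Exp2 Zero, One)"
    "\<Sigma> \<turnstile> (Exp2 One, Two)"
    using inst[of "Mul (Var 0) One" "Var 0"] inst[of "Bin (Var 0) Zero" One]
      inst[of "Add (Var 0) Zero" "Var 0"] inst[of "Mul (Var 0) Zero" Zero] inst[of "Fac Zero" One]
      inst[of "Fac One" One] inst[of "Exp2 Zero" One] inst[of "Exp2 One" Two]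
    by (auto simp: Omega_def Let_def)
  ultimately show "\<Sigma> \<turnstile> (Mul One u, u)" "\<Sigma> \<turnstile> (Add Zero u, u)" "\<Sigma> \<turnstile> (Mul Zero u, Zero)"
    "\<Sigma> \<turnstile> (Bin Zero u, One)" "\<Sigma> \<turnstile> (Fac Two, Two)"
    by (blast intro: entails.trans entails.sym)+
qed

lemma entails_nf:
  assumes "\<Sigma> \<turnstile> (Fac D, E)"
  shows "\<Sigma> \<turnstile> (t, nf D E t)"
proof (induction t)
  case (Add s t)
  then have *: "\<Sigma> \<turnstile> (Add s t, Add (nf D E s) (nf D E t))" by (rule cong_Add)
  show ?case using omega_laws(5)[of "nf D E t"] omega_laws(6)[of "nf D E s"]
    by (auto intro: entails.trans[OF *] entails.refl)
next
  case (Mul s t)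
  then have *: "\<Sigma> \<turnstile> (Mul s t, Mul (nf D E s) (nf D E t))" by (rule cong_Mul)
  show ?case using omega_laws(1,7)[of "nf D E t"] omega_laws(2,8)[of "nf D E s"]
    by (auto intro: entails.trans[OF *] entails.refl)
next
  case (Bin s t)
  then have *: "\<Sigma> \<turnstile> (Bin s t, Bin (nf D E s) (nf D E t))" by (rule cong_Bin)
  show ?case using omega_laws(4)[of "nf D E t"] omega_laws(3)[of "nf D E s"]
    by (auto intro: entails.trans[OF *] entails.refl)
next
  case (Fac s)
  then have *: "\<Sigma> \<turnstile> (Fac s, Fac (nf D E s))" by (rule cong_Fac)
  show ?case using omega_laws(9,10,13) assms
    by (auto intro: entails.trans[OF *] entails.refl)
next
  case (Exp2 s)
  then have *: "\<Sigma> \<turnstile> (Exp2 s, Exp2 (nf D E s))" by (rule cong_Exp2)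
  show ?case using omega_laws(11,12)
    by (auto intro: entails.trans[OF *] entails.refl)
qed (auto intro: entails.refl)

lemma entails_nf_iff:
  assumes "\<Sigma> \<turnstile> (Fac D, E)"
  shows "\<Sigma> \<turnstile> (nf D E s, nf D E t) \<longleftrightarrow> \<Sigma> \<turnstile> (s, t)"
  using entails_nf[OF assms, of s] entails_nf[OF assms, of t]
  by (blast intro: entails.trans entails.sym)

text \<open>Let one variable missing in \<open>t\<close> grow and set the others to 1: a normal form
  containing it would outgrow the fixed value of \<open>t\<close>.\<close>

lemma vars_nf:
  assumes "\<Sigma> \<turnstile> (Fac D, E)" "norm E" "\<Sigma> \<turnstile> (t, u)"
  shows "vars (nf D E u) \<subseteq> vars t"
proof
  fix n assume n: "n \<in> vars (nf D E u)"
  show "n \<in> vars t"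
  proof (rule ccontr)
    assume "n \<notin> vars t"
    define k where "k = Suc (nat_val (\<lambda>_. 1) t)"
    define \<rho> :: "nat \<Rightarrow> nat" where "\<rho> = (\<lambda>_. 1)(n := k)"
    have "k \<le> nat_val \<rho> (nf D E u)"
      using nat_val_ge_var[OF norm_nf[OF assms(2)] n, of \<rho>] by (simp add: \<rho>_def k_def)
    also have "\<dots> = nat_val \<rho> t"
      using sound'[OF assms(3)] sound'[OF entails_nf[OF assms(1)]] by metis
    also have "\<dots> = nat_val (\<lambda>_. 1) t"
      using \<open>n \<notin> vars t\<close> by (intro nat_val_cong) (auto simp: \<rho>_def)
    finally show False by (simp add: k_def)
  qed
qed

lemma val_nf: "\<Sigma> \<turnstile> (Fac D, E) \<Longrightarrow> \<Sigma> \<turnstile> (t, u) \<Longrightarrow> val (nf D E u) = val t"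
  using sound'[OF entails_nf] sound' by metis

lemma finite_nf_if_bounded:
  assumes "\<Sigma> \<turnstile> (Fac D, E)" "norm E" "\<And>u. \<Sigma> \<turnstile> (t, u) \<Longrightarrow> \<forall>j \<in> leaves (nf D E u). j \<le> M"
  shows "finite (nf D E ` {u. \<Sigma> \<turnstile> (t, u)})"
proof (rule finite_subset[OF _ finite_norm[OF finite_vars, of t M "val t"]])
  show "nf D E ` {u. \<Sigma> \<turnstile> (t, u)} \<subseteq>
    {u. norm u \<and> vars u \<subseteq> vars t \<and> (\<forall>j \<in> leaves u. j \<le> M) \<and> val u = val t}"
  proof
    fix v assume "v \<in> nf D E ` {u. \<Sigma> \<turnstile> (t, u)}"
    then obtain u where u: "\<Sigma> \<turnstile> (t, u)" "v = nf D E u" by blast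
    show "v \<in> {u. norm u \<and> vars u \<subseteq> vars t \<and> (\<forall>j \<in> leaves u. j \<le> M) \<and> val u = val t}"
      using vars_nf[OF assms(1,2) u(1)] val_nf[OF assms(1) u(1)] norm_nf[OF assms(2), of D u]
        assms(3)[OF u(1)] unfolding u(2) by blast
  qed
qed

text \<open>An index above \<open>k\<close> could only arise through \<open>Fac (Bn k)\<close>,
  which is rewritten to \<open>Bn m\<close>.\<close>

lemma collapsed_bounded:
  assumes "m \<le> k"
  shows "\<forall>j \<in> leaves (nf (Bn k) (Bn m) u). j \<le> k"
proof (induction u)
  case (Fac s)
  let ?s = "nf (Bn k) (Bn m) s"
  show ?case
  proof (cases "bidx ?s")
    case None
    then show ?thesis using Fac assms by (auto simp: leaves.simps(7))
  next
    case (Some i)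
    then have "?s = Bn i" by (simp add: bidx_iff)
    then show ?thesis using Fac assms by (auto simp: leaves.simps(7))
  qed
qed auto

text \<open>\<open>C\<close> collects the \<open>n\<close> for which a factorial inside the law is applied to \<open>Bn n\<close>; there are at most as
  many as the laws have subterms. At all other levels the law is an identity of numbers.\<close>

definition step :: "nat \<Rightarrow> trm \<Rightarrow> trm \<Rightarrow> bool" where
  "step c u v \<longleftrightarrow> \<Sigma> \<turnstile> (u, v) \<and> (\<exists>C. finite C \<and> card C \<le> c \<and>
    (\<forall>h Y. 1 \<le> h \<and> h - 1 \<notin> C \<longrightarrow> leaf_val h Y (nf0 u) = leaf_val h Y (nf0 v)))"

definition law_subts :: "trm set" where
  "law_subts = (\<Union>(s, t) \<in> \<Sigma>. subts s \<union> subts t)"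

lemma finite_law_subts: "finite law_subts"
  unfolding law_subts_def using fin finite_subts by auto

lemma step_law:
  assumes "(s, t) \<in> \<Sigma>"
  shows "step (card law_subts) (subst \<sigma> s) (subst \<sigma> t)"
proof -
  define C where "C = {n. \<exists>p \<in> law_subts. nf0 (subst \<sigma> p) = Bn n}"
  have C: "C \<subseteq> (\<lambda>p. the (bidx (nf0 (subst \<sigma> p)))) ` law_subts"
    unfolding C_def by (force simp: image_iff)
  have "finite C" "card C \<le> card law_subts"
    using finite_subset[OF C] card_mono[OF _ C] card_image_le[OF finite_law_subts] finite_law_subts
    by (auto intro: order_trans)
  moreover have "leaf_val h Y (nf0 (subst \<sigma> s)) = leaf_val h Y (nf0 (subst \<sigma> t))" if h: "1 \<le> h" "h - 1 \<notin> C" for h Y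
  proof -
    \<comment> \<open>No subterm of the law normalizes to \<open>Bn (h - 1)\<close>, so evaluation
      is a homomorphism on the law, and validity on the naturals applies to the values of the
      substituted terms.\<close>
    have ev: "leaf_val h Y (nf0 (subst \<sigma> p)) = nat_val (\<lambda>x. leaf_val h Y (nf0 (\<sigma> x))) p" if "subts p \<subseteq> law_subts" for p
      using that
    proof (induction p)
      case (Fac p)
      then have "p \<in> law_subts" using self_subts by auto
      then have "nf0 (subst \<sigma> p) \<noteq> Bn (h - 1)" using h(2) unfolding C_def by auto
      then show ?case using Fac leaf_val_nf0_simps(4)[OF h(1)] by simp
    qed (use leaf_val_nf0_simps[OF h(1)] in \<open>simp_all del: nf.simps(4-)\<close>)
    have "subts s \<subseteq> law_subts" "subts t \<subseteq> law_subts" using assms unfolding law_subts_def by auto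
    then show ?thesis using ev valid[OF assms] by (simp add: nat_valid_def)
  qed
  ultimately show ?thesis unfolding step_def using entails.ax[OF assms] by blast
qed

lemma step_sym: "step c u v \<Longrightarrow> step c v u"
  unfolding step_def by (metis entails.sym)

text \<open>Transitivity is kept outside \<open>step\<close>, so that the bound on crossed levels
  holds per law instance and does not accumulate.\<close>

definition steps :: "trm \<Rightarrow> trm \<Rightarrow> bool" where
  "steps = (step (card law_subts))\<^sup>*\<^sup>*"

lemma steps_sym: "steps u v \<Longrightarrow> steps v u"
  unfolding steps_def
  by (induction rule: rtranclp_induct) (auto intro: step_sym converse_rtranclp_into_rtranclp)

text \<open>The exceptional set \<open>C\<close> is carried over unchanged, so the bound is
  independent of the depth at which a law is applied.\<close>

lemma step_context:
  assumes "\<And>u v. \<Sigma> \<turnstile> (u, v) \<Longrightarrow> \<Sigma> \<turnstile> (f u, f v)"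
    and "\<And>h Y u v. 1 \<le> h \<Longrightarrow> \<Sigma> \<turnstile> (u, v) \<Longrightarrow> leaf_val h Y (nf0 u) = leaf_val h Y (nf0 v) \<Longrightarrow>
      leaf_val h Y (nf0 (f u)) = leaf_val h Y (nf0 (f v))"
    and "steps u v"
  shows "steps (f u) (f v)"
  using assms(3) unfolding steps_def
proof (induction rule: rtranclp_induct)
  case (step v w)
  then obtain C where C: "\<Sigma> \<turnstile> (v, w)" "finite C" "card C \<le> card law_subts"
    "\<forall>h Y. 1 \<le> h \<and> h - 1 \<notin> C \<longrightarrow> leaf_val h Y (nf0 v) = leaf_val h Y (nf0 w)"
    unfolding step_def by auto
  have "\<forall>h Y. 1 \<le> h \<and> h - 1 \<notin> C \<longrightarrow> leaf_val h Y (nf0 (f v)) = leaf_val h Y (nf0 (f w))"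
    using C(4) assms(2)[OF _ C(1)] by auto
  with C assms(1)[OF C(1)] have "step (card law_subts) (f v) (f w)"
    unfolding step_def by (intro conjI exI[of _ C]) auto
  with step.IH show ?case by simp
qed simp

text \<open>Soundness gives \<open>v\<close> the value 2, so its normal form is \<open>Two\<close>
  or some \<open>Bn n\<close>. \<open>Two\<close> is impossible: it is fixed by the factorial, which
  would identify \<open>Bn k\<close> with \<open>Bn (Suc k)\<close>.\<close>

lemma nf0_Bn_eq:
  assumes "\<forall>m n. \<Sigma> \<turnstile> (Bn m, Bn n) \<longrightarrow> m = n" "\<Sigma> \<turnstile> (u, v)" "nf0 u = Bn k"
  shows "nf0 v = Bn k"
proof -
  have uv: "\<Sigma> \<turnstile> (Bn k, nf0 v)"
    using assms(2) entails_nf_iff[OF omega_laws(13), of u v] assms(3) by simp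
  then have "val (nf0 v) = 2" using sound'[OF uv] by (metis val_Bn)
  then consider "nf0 v = Two" | n where "nf0 v = Bn n" using norm_val_le_2[OF norm_nf0] by blast
  then show ?thesis
  proof cases
    case 1
    then have two: "\<Sigma> \<turnstile> (Bn k, Two)" using uv by simp
    then have "\<Sigma> \<turnstile> (Bn (Suc k), Fac Two)" unfolding Bn_Suc by (rule cong_Fac)
    then have "\<Sigma> \<turnstile> (Bn (Suc k), Bn k)"
      using omega_laws(13) two by (blast intro: entails.trans entails.sym)
    then show ?thesis using assms(1) by force
  next
    case 2
    then show ?thesis using uv assms(1) by force
  qed
qed

lemma entails_steps:
  assumes nc: "\<forall>m n. \<Sigma> \<turnstile> (Bn m, Bn n) \<longrightarrow> m = n"
    and "\<Sigma> \<turnstile> e"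
  shows "steps (fst e) (snd e)"
  using assms(2)
proof (induction rule: entails.induct)
  case (ax s t \<sigma>)
  then show ?case unfolding steps_def by (auto intro: step_law)
next
  case (sym s t)
  then show ?case by (simp add: steps_sym)
next
  case (trans s t u)
  then show ?case unfolding steps_def by auto
next
  case (cong_Add s s' t t')
  have "steps (Add s t) (Add s' t)"
    by (rule step_context[where f = "\<lambda>u. Add u t"])
      (use cong_Add leaf_val_nf0_simps(1) in \<open>auto intro: entails.cong_Add entails.refl simp del: nf.simps\<close>)
  moreover have "steps (Add s' t) (Add s' t')"
    by (rule step_context[where f = "\<lambda>u. Add s' u"])
      (use cong_Add leaf_val_nf0_simps(1) in \<open>auto intro: entails.cong_Add entails.refl simp del: nf.simps\<close>)
  ultimately show ?case unfolding steps_def by simp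
next
  case (cong_Mul s s' t t')
  have "steps (Mul s t) (Mul s' t)"
    by (rule step_context[where f = "\<lambda>u. Mul u t"])
      (use cong_Mul leaf_val_nf0_simps(2) in \<open>auto intro: entails.cong_Mul entails.refl simp del: nf.simps\<close>)
  moreover have "steps (Mul s' t) (Mul s' t')"
    by (rule step_context[where f = "\<lambda>u. Mul s' u"])
      (use cong_Mul leaf_val_nf0_simps(2) in \<open>auto intro: entails.cong_Mul entails.refl simp del: nf.simps\<close>)
  ultimately show ?case unfolding steps_def by simp
next
  case (cong_Bin s s' t t')
  have "steps (Bin s t) (Bin s' t)"
    by (rule step_context[where f = "\<lambda>u. Bin u t"])
      (use cong_Bin leaf_val_nf0_simps(3) in \<open>auto intro: entails.cong_Bin entails.refl simp del: nf.simps\<close>)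
  moreover have "steps (Bin s' t) (Bin s' t')"
    by (rule step_context[where f = "\<lambda>u. Bin s' u"])
      (use cong_Bin leaf_val_nf0_simps(3) in \<open>auto intro: entails.cong_Bin entails.refl simp del: nf.simps\<close>)
  ultimately show ?case unfolding steps_def by simp
next
  case (cong_Fac s s')
  \<comment> \<open>A factorial around the step could cross level \<open>h - 1\<close> on one side
    only; \<open>nf0_Bn_eq\<close> excludes this, so no new exceptional level arises.\<close>
  have leaf_val: "leaf_val h Y (nf0 (Fac u)) = leaf_val h Y (nf0 (Fac v))"
    if "1 \<le> h" "\<Sigma> \<turnstile> (u, v)" "leaf_val h Y (nf0 u) = leaf_val h Y (nf0 v)" for h Y u v
  proof (cases "nf0 u = Bn (h - 1) \<or> nf0 v = Bn (h - 1)")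
    case True
    then have "nf0 u = nf0 v"
    proof
      assume u: "nf0 u = Bn (h - 1)"
      then have "nf0 v = Bn (h - 1)" by (rule nf0_Bn_eq[OF nc that(2)])
      with u show ?thesis by simp
    next
      assume v: "nf0 v = Bn (h - 1)"
      then have "nf0 u = Bn (h - 1)" by (rule nf0_Bn_eq[OF nc entails.sym[OF that(2)]])
      with v show ?thesis by simp
    qed
    then show ?thesis by (simp only: nf.simps)
  next
    case False
    then have ne: "nf0 u \<noteq> Bn (h - 1)" "nf0 v \<noteq> Bn (h - 1)" by blast+
    show ?thesis
      by (simp only: leaf_val_nf0_simps(4)[OF that(1) ne(1)] leaf_val_nf0_simps(4)[OF that(1) ne(2)] that(3))
  qed
  have "steps (Fac s) (Fac s')"
    by (rule step_context[where f = Fac]) (use cong_Fac leaf_val in \<open>auto intro: entails.cong_Fac simp del: nf.simps\<close>)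
  then show ?case by simp
next
  case (cong_Exp2 s s')
  have "steps (Exp2 s) (Exp2 s')"
    by (rule step_context[where f = Exp2])
      (use cong_Exp2 leaf_val_nf0_simps(5) in \<open>auto intro: entails.cong_Exp2 simp del: nf.simps\<close>)
  then show ?case by simp
qed (simp add: steps_def)

end

text \<open>Pigeonhole among \<open>h = i * K\<close> for \<open>c + d + 1\<close> values of
  \<open>i\<close>: an element \<open>n\<close> of \<open>C\<close> rules out at most the
  \<open>i\<close> with \<open>i * K = n + 1\<close>, an element of \<open>A\<close> only the block
  of length \<open>K\<close> that contains it.\<close>

lemma exists_gap:
  assumes "finite C" "card C \<le> c" "finite A" "card A \<le> d" "1 \<le> K"
  shows "\<exists>h. K \<le> h \<and> h \<le> (c + d + 1) * K \<and> h - 1 \<notin> C \<and> (\<forall>j \<in> A. j < h - K \<or> h \<le> j)"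
proof -
  define B where "B = (\<lambda>n. Suc n div K) ` C \<union> (\<lambda>j. Suc (j div K)) ` A"
  have "card B \<le> card ((\<lambda>n. Suc n div K) ` C) + card ((\<lambda>j. Suc (j div K)) ` A)"
    unfolding B_def by (rule card_Un_le)
  also have "\<dots> \<le> c + d"
    using card_image_le[OF assms(1)] card_image_le[OF assms(3)] assms(2,4) by (meson add_mono le_trans)
  also have "\<dots> < card {1..c + d + 1}" by simp
  finally have "\<not> {1..c + d + 1} \<subseteq> B"
    using card_mono[of B "{1..c + d + 1}"] assms unfolding B_def by auto
  then obtain i where "i \<in> {1..c + d + 1}" and "i \<notin> B" by blast
  then have i: "1 \<le> i" "i \<le> c + d + 1" "i \<notin> B" by simp_all
  obtain i' where i': "i = Suc i'" using i(1) by (cases i) auto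
  have "i * K - 1 \<notin> C"
  proof
    assume "i * K - 1 \<in> C"
    moreover have "Suc (i * K - 1) div K = i" using assms(5) i(1) by simp
    ultimately have "i \<in> B" unfolding B_def by (metis UnI1 imageI)
    with i(3) show False by simp
  qed
  moreover have "j < i * K - K \<or> i * K \<le> j" if "j \<in> A" for j
  proof (rule ccontr)
    assume "\<not> (j < i * K - K \<or> i * K \<le> j)"
    then have "i' * K \<le> j" "j < Suc i' * K" unfolding i' by auto
    then have "j div K = i'" by (intro div_nat_eqI) (auto simp: mult.commute)
    then have "i \<in> B" unfolding B_def i' using that by auto
    with i(3) show False by simp
  qed
  moreover have "K \<le> i * K" "i * K \<le> (c + d + 1) * K"
    using mult_le_mono1[OF i(1), of K] mult_le_mono1[OF i(2), of K] by simp_all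
  ultimately show ?thesis by blast
qed

text \<open>A fixed shift is overtaken by a single factorial: \<open>Y + d < 2 ^ Y <= Y!\<close> for
  large \<open>Y\<close>.\<close>

lemma tower_shift_le:
  assumes "\<And>Y. Y0 \<le> Y \<Longrightarrow> tower j Y \<le> tower k (Y + d)"
  shows "j \<le> k"
proof (rule ccontr)
  assume "\<not> j \<le> k"
  define Y where "Y = Y0 + d + 4"
  have "Y + d < 2 ^ Y" using mult_self_le_exp[of Y] mult_le_mono1[of 4 Y Y] by (simp add: Y_def)
  also have "\<dots> \<le> fact Y" by (rule exp_le_fact) (simp add: Y_def)
  finally have "tower k (Y + d) < tower k (fact Y)" by (intro tower_less) (auto simp: Y_def)
  also have "\<dots> = tower (k + 1) Y" by (simp only: tower_add) simp
  also have "\<dots> \<le> tower j Y" using \<open>\<not> j \<le> k\<close> by (intro tower_mono) simp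
  also have "\<dots> \<le> tower k (Y + d)" by (rule assms) (simp add: Y_def)
  finally show False by simp
qed

context arith_theory
begin

text \<open>One of the \<open>c + 1\<close> levels from \<open>M\<close> to \<open>M + c\<close> is
  not crossed. Restarting just above it gives \<open>u\<close> a value independent of
  \<open>Y\<close>, whereas a higher leaf would force \<open>v\<close> up to
  \<open>Y\<close>.\<close>

lemma step_jump:
  assumes "step c u v" "\<forall>j \<in> leaves (nf0 u). j \<le> M"
  shows "\<forall>j \<in> leaves (nf0 v). j \<le> M + c + 1"
proof
  fix j assume j: "j \<in> leaves (nf0 v)"
  obtain C where C: "\<Sigma> \<turnstile> (u, v)" "finite C" "card C \<le> c"
    "\<And>h Y. 1 \<le> h \<Longrightarrow> h - 1 \<notin> C \<Longrightarrow> leaf_val h Y (nf0 u) = leaf_val h Y (nf0 v)"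
    using assms(1) unfolding step_def by blast
  show "j \<le> M + c + 1"
  proof (rule ccontr)
    assume *: "\<not> j \<le> M + c + 1"
    have "\<not> {M..M + c} \<subseteq> C" using card_mono[OF C(2), of "{M..M + c}"] C(3) by auto
    then obtain h where "h \<in> {M..M + c}" and "h \<notin> C" by blast
    then have h: "M \<le> h" "h \<le> M + c" "h \<notin> C" by simp_all
    define Y where "Y = val (nf0 u) + 2"
    have "Y \<le> tower j Y" by (rule tower_ge)
    also have "\<dots> \<le> leaf_val (Suc h) Y (nf0 v)"
      using j * h by (intro leaf_val_ge_T norm_nf0) (auto simp: Y_def)
    also have "\<dots> = leaf_val (Suc h) Y (nf0 u)" using C(4)[of "Suc h" Y] h by simp
    also have "\<dots> = val (nf0 u)" using assms(2) h by (intro leaf_val_eq_val norm_nf0) auto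
    finally show False by (simp add: Y_def)
  qed
qed

text \<open>The usable level \<open>h\<close> depends on the step, so both ends are measured with
  \<open>h = 0\<close>. A leaf above \<open>h0\<close> lies above every possible gap, as
  \<open>leaf_val0_le_V\<close> demands.\<close>

lemma step_compare:
  assumes "step c u v" "val (nf0 u) = N"
    and "h0 = (c + 2 * N + 1) * (N + 5)"
    and "\<exists>j \<in> leaves (nf0 u). h0 < j" "\<exists>j \<in> leaves (nf0 v). h0 < j" "9 + 2 * N \<le> Y"
  shows "leaf_val 0 Y (nf0 v) \<le> leaf_val 0 (Suc Y) (nf0 u)"
proof -
  obtain C where C: "\<Sigma> \<turnstile> (u, v)" "finite C" "card C \<le> c"
    "\<And>h Y. 1 \<le> h \<Longrightarrow> h - 1 \<notin> C \<Longrightarrow> leaf_val h Y (nf0 u) = leaf_val h Y (nf0 v)"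
    using assms(1) unfolding step_def by blast
  have Nv: "val (nf0 v) = N"
    using val_nf[OF omega_laws(13) C(1)] val_nf[OF omega_laws(13) entails.refl, of u] assms(2) by simp
  have "finite (leaves (nf0 u) \<union> leaves (nf0 v))" "card (leaves (nf0 u) \<union> leaves (nf0 v)) \<le> 2 * N"
    using card_leaves[OF norm_nf0, of u] card_leaves[OF norm_nf0, of v] card_Un_le[of "leaves (nf0 u)" "leaves (nf0 v)"]
      assms(2) Nv by auto
  from exists_gap[OF C(2,3) this, of "N + 5"] obtain h where h: "N + 5 \<le> h" "h \<le> h0"
    "h - 1 \<notin> C" "\<forall>j \<in> leaves (nf0 u) \<union> leaves (nf0 v). j < h - (N + 5) \<or> h \<le> j"
    unfolding assms(3) by auto
  have "leaf_val 0 Y (nf0 v) \<le> leaf_val h (Suc Y) (nf0 v)"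
    using assms(4-6) h Nv by (intro leaf_val0_le_V[where N = N] norm_nf0) (auto intro: less_imp_le le_less_trans)
  also have "\<dots> = leaf_val h (Suc Y) (nf0 u)" using C(4)[of h "Suc Y"] h by simp
  also have "\<dots> \<le> leaf_val 0 (Suc Y) (nf0 u)" using assms(6) by (intro leaf_val_le_V0 norm_nf0) simp
  finally show ?thesis .
qed

text \<open>As long as some leaf index exceeds \<open>h0\<close>, every step has a level \<open>h\<close> with no crossing and a wide
  gap below it. Hence the growth rate in \<open>Y\<close> of the valuation with \<open>h = 0\<close> can only rise by a
  shift \<open>Y + d\<close>, and a shift never reaches the next iterated factorial.\<close>

lemma free_bounded:
  assumes nc: "\<forall>m n. \<Sigma> \<turnstile> (Bn m, Bn n) \<longrightarrow> m = n"
  shows "\<exists>M. \<forall>u. \<Sigma> \<turnstile> (t, u) \<longrightarrow> (\<forall>j \<in> leaves (nf0 u). j \<le> M)"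
proof -
  define c where "c = card law_subts"
  define N where "N = val t"
  define h0 where "h0 = (c + 2 * N + 1) * (N + 5)"
  have "finite (leaves (nf0 t))" using card_leaves[OF norm_nf0] by blast
  \<comment> \<open>Room for one jump out of the low region, as bounded by
    \<open>step_jump\<close>.\<close>
  then obtain M where M: "h0 + c + 1 \<le> M" "\<forall>j \<in> leaves (nf0 t). j \<le> M"
    using finite_nat_set_iff_bounded_le[of "leaves (nf0 t)"] by (metis le_trans nat_le_linear)
  define low where "low u \<longleftrightarrow> (\<forall>j \<in> leaves (nf0 u). j \<le> h0)" for u
  \<comment> \<open>In the induction, \<open>v\<close> is the start \<open>t\<close> or the first
    term after the chain last left the low region, and \<open>d\<close> counts the steps since
    then.\<close>
  define dom where "dom u \<longleftrightarrow> (\<exists>v d. \<Sigma> \<turnstile> (t, v) \<and> (\<forall>j \<in> leaves (nf0 v). j \<le> M) \<and>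
    (\<forall>Y \<ge> 9 + 2 * N. leaf_val 0 Y (nf0 u) \<le> leaf_val 0 (Y + d) (nf0 v)))" for u
  have inv: "\<Sigma> \<turnstile> (t, u) \<and> (low u \<or> dom u)" if "\<Sigma> \<turnstile> (t, u)" for u
  proof -
    have "steps t u" using entails_steps[OF nc that] by simp
    then show ?thesis unfolding steps_def
    proof (induction rule: rtranclp_induct)
      case base
      have "dom t" unfolding dom_def
        by (intro exI[of _ t] exI[of _ 0]) (auto intro: entails.refl simp: M)
      then show ?case by (auto intro: entails.refl)
    next
      case (step u v)
      have uv: "step c u v" using step.hyps unfolding c_def by simp
      have tv: "\<Sigma> \<turnstile> (t, v)" using step by (auto simp: step_def intro: entails.trans)
      consider "low v" | "low u" "\<not> low v" | "\<not> low u" "\<not> low v" by blast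
      then show ?case
      proof cases
        case 2
        then have "\<forall>j \<in> leaves (nf0 v). j \<le> M"
          using step_jump[OF uv, of h0] M unfolding low_def by fastforce
        then have "dom v" unfolding dom_def using tv by (intro exI[of _ v] exI[of _ 0]) auto
        then show ?thesis using tv by simp
      next
        case 3
        then have ex: "\<exists>j \<in> leaves (nf0 u). h0 < j" "\<exists>j \<in> leaves (nf0 v). h0 < j"
          unfolding low_def by (auto simp: not_le)
        have N: "val (nf0 u) = N"
          using val_nf[OF omega_laws(13)] step.IH unfolding N_def by blast
        obtain w d where w: "\<Sigma> \<turnstile> (t, w)" "\<forall>j \<in> leaves (nf0 w). j \<le> M"
          "\<And>Y. 9 + 2 * N \<le> Y \<Longrightarrow> leaf_val 0 Y (nf0 u) \<le> leaf_val 0 (Y + d) (nf0 w)"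
          using step.IH 3 unfolding dom_def by auto
        have "leaf_val 0 Y (nf0 v) \<le> leaf_val 0 (Y + Suc d) (nf0 w)" if "9 + 2 * N \<le> Y" for Y
          using step_compare[OF uv N h0_def ex that] w(3)[of "Suc Y"] that by simp
        then have "dom v" unfolding dom_def using w(1,2)
          by (intro exI[of _ w] exI[of _ "Suc d"]) auto
        then show ?thesis using tv by simp
      qed (use tv in simp)
    qed
  qed
  have "j \<le> M + N" if u: "\<Sigma> \<turnstile> (t, u)" and j: "j \<in> leaves (nf0 u)" for u j
  proof (cases "low u")
    case True
    then show ?thesis using j M unfolding low_def by fastforce
  next
    case False
    then obtain w d where w: "\<Sigma> \<turnstile> (t, w)" "\<forall>j \<in> leaves (nf0 w). j \<le> M"
      "\<And>Y. 9 + 2 * N \<le> Y \<Longrightarrow> leaf_val 0 Y (nf0 u) \<le> leaf_val 0 (Y + d) (nf0 w)"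
      using inv[OF u] unfolding dom_def by auto
    have Nw: "val (nf0 w) = N" using val_nf[OF omega_laws(13) w(1)] unfolding N_def .
    show ?thesis
    proof (rule tower_shift_le)
      fix Y assume Y: "9 + 2 * N \<le> Y"
      have "tower j Y \<le> leaf_val 0 Y (nf0 u)" using j Y by (intro leaf_val_ge_T norm_nf0) auto
      also have "\<dots> \<le> leaf_val 0 (Y + d) (nf0 w)" using Y by (rule w(3))
      also have "\<dots> \<le> tower (M + N) (Y + d)"
        using leaf_val0_le_T[OF norm_nf0, of "Y + d" w M] w(2) Y Nw by simp
      finally show "tower j Y \<le> tower (M + N) (Y + d)" .
    qed
  qed
  then show ?thesis by blast
qed

lemma finite_nf:
  "\<exists>D E. \<Sigma> \<turnstile> (Fac D, E) \<and> norm E \<and> finite (nf D E ` {u. \<Sigma> \<turnstile> (t, u)})"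
proof (cases "\<exists>m n. \<Sigma> \<turnstile> (Bn m, Bn n) \<and> m \<noteq> n")
  case True
  then obtain m n where mn: "\<Sigma> \<turnstile> (Bn m, Bn n)" "m < n"
    by (metis entails.sym linorder_neqE_nat)
  then obtain k where k: "n = Suc k" "m \<le> k" by (cases n) auto
  have fac: "\<Sigma> \<turnstile> (Fac (Bn k), Bn m)" using mn k entails.sym by (simp add: Bn_Suc)
  have "finite (nf (Bn k) (Bn m) ` {u. \<Sigma> \<turnstile> (t, u)})"
    using finite_nf_if_bounded[OF fac norm_Bn] collapsed_bounded[OF k(2)] by blast
  with fac norm_Bn show ?thesis by blast
next
  case False
  then have "\<forall>m n. \<Sigma> \<turnstile> (Bn m, Bn n) \<longrightarrow> m = n" by blast
  from free_bounded[OF this, of t]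
  obtain M where "\<And>u. \<Sigma> \<turnstile> (t, u) \<Longrightarrow> \<forall>j \<in> leaves (nf0 u). j \<le> M" by blast
  then have "finite (nf0 ` {u. \<Sigma> \<turnstile> (t, u)})"
    by (intro finite_nf_if_bounded[OF omega_laws(13)]) auto
  then show ?thesis using omega_laws(13) by (intro exI[of _ Two] exI[of _ Two]) simp
qed

end

section \<open>Finite models\<close>

inductive ctx :: "(trm \<Rightarrow> trm) \<Rightarrow> bool" where
  hole: "ctx (\<lambda>x. x)"
| Add1: "ctx f \<Longrightarrow> ctx (\<lambda>x. Add (f x) r)"
| Add2: "ctx f \<Longrightarrow> ctx (\<lambda>x. Add r (f x))"
| Mul1: "ctx f \<Longrightarrow> ctx (\<lambda>x. Mul (f x) r)"
| Mul2: "ctx f \<Longrightarrow> ctx (\<lambda>x. Mul r (f x))"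
| Bin1: "ctx f \<Longrightarrow> ctx (\<lambda>x. Bin (f x) r)"
| Bin2: "ctx f \<Longrightarrow> ctx (\<lambda>x. Bin r (f x))"
| Fac: "ctx f \<Longrightarrow> ctx (\<lambda>x. Fac (f x))"
| Exp2: "ctx f \<Longrightarrow> ctx (\<lambda>x. Exp2 (f x))"

lemma ctx_comp: "ctx f \<Longrightarrow> ctx g \<Longrightarrow> ctx (\<lambda>x. f (g x))"
  by (induction rule: ctx.induct) (auto intro: ctx.intros)

lemma ctx_op:
  "ctx (\<lambda>x. Add x r)" "ctx (\<lambda>x. Add r x)" "ctx (\<lambda>x. Mul x r)" "ctx (\<lambda>x. Mul r x)"
  "ctx (\<lambda>x. Bin x r)" "ctx (\<lambda>x. Bin r x)" "ctx Fac" "ctx Exp2"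
  using ctx.intros(2-9)[OF hole] by auto

lemma meval_quotient:
  fixes cls :: "trm \<Rightarrow> nat" and rep :: "nat \<Rightarrow> trm"
  assumes cong: "\<And>c u v. ctx c \<Longrightarrow> cls u = cls v \<Longrightarrow> cls (c u) = cls (c v)"
    and rep: "\<And>u. cls (rep (cls u)) = cls u"
  defines "F \<equiv> \<lambda>k x y. if k = 1 then cls Zero else if k = 2 then cls One
    else if k = 3 then cls (Add (rep x) (rep y)) else if k = 4 then cls (Mul (rep x) (rep y))
    else if k = 5 then cls (Bin (rep x) (rep y)) else if k = 6 then cls (Fac (rep x))
    else cls (Exp2 (rep x))"
  shows "meval F (\<lambda>n. cls (\<sigma> n)) t = cls (subst \<sigma> t)"
proof (induction t)
  case (Add s t)
  have "cls (Add (rep (cls u)) (rep (cls v))) = cls (Add u v)" for u v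
    using cong[OF ctx_op(1)[of "rep (cls v)"] rep[of u]] cong[OF ctx_op(2)[of u] rep[of v]] by simp
  then show ?case using Add by (simp add: F_def)
next
  case (Mul s t)
  have "cls (Mul (rep (cls u)) (rep (cls v))) = cls (Mul u v)" for u v
    using cong[OF ctx_op(3)[of "rep (cls v)"] rep[of u]] cong[OF ctx_op(4)[of u] rep[of v]] by simp
  then show ?case using Mul by (simp add: F_def)
next
  case (Bin s t)
  have "cls (Bin (rep (cls u)) (rep (cls v))) = cls (Bin u v)" for u v
    using cong[OF ctx_op(5)[of "rep (cls v)"] rep[of u]] cong[OF ctx_op(6)[of u] rep[of v]] by simp
  then show ?case using Bin by (simp add: F_def)
next
  case (Fac s)
  then show ?case using cong[OF ctx_op(7) rep] by (simp add: F_def)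
next
  case (Exp2 s)
  then show ?case using cong[OF ctx_op(8) rep] by (simp add: F_def)
qed (simp_all add: F_def)

context arith_theory
begin

lemma ctx_entails: "ctx c \<Longrightarrow> \<Sigma> \<turnstile> (u, v) \<Longrightarrow> \<Sigma> \<turnstile> (c u, c v)"
  by (induction rule: ctx.induct) (auto intro: entails.intros)

text \<open>A context either keeps the normal form of its argument visible or, after a multiplication
  by \<open>0\<close> or a binomial coefficient \<open>1\<close>, forgets the argument altogether.\<close>

lemma ctx_visible:
  assumes DE: "\<Sigma> \<turnstile> (Fac D, E)" and c: "ctx c"
    and G: "G = {Zero, One, Two} \<union> subts D" and u: "nf D E u \<notin> G"
  shows "nf D E u \<in> subts (nf D E (c u)) \<or> (\<forall>v. nf D E v \<notin> G \<longrightarrow> \<Sigma> \<turnstile> (c u, c v))"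
  using c
proof (induction rule: ctx.induct)
  case hole
  show ?case by (simp add: self_subts)
next
  case (Add1 f r)
  have "\<Sigma> \<turnstile> (Add (f u) r, Add (f v) r)" if "\<Sigma> \<turnstile> (f u, f v)" for v
    using that by (intro cong_Add entails.refl)
  then show ?case using Add1 u by (auto simp: G)
next
  case (Add2 f r)
  have "\<Sigma> \<turnstile> (Add r (f u), Add r (f v))" if "\<Sigma> \<turnstile> (f u, f v)" for v
    using that by (intro cong_Add entails.refl)
  then show ?case using Add2 u by (auto simp: G)
next
  case (Mul1 f r)
  have *: "\<Sigma> \<turnstile> (Mul (f u) r, Mul (f v) r)" if "\<Sigma> \<turnstile> (f u, f v) \<or> nf D E r = Zero" for v
  proof (cases "nf D E r = Zero")
    case True
    have "\<Sigma> \<turnstile> (Mul w r, Zero)" for w using entails_nf[OF DE, of "Mul w r"] True by simp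
    then show ?thesis by (blast intro: entails.trans entails.sym)
  qed (use that in \<open>auto intro: cong_Mul entails.refl\<close>)
  then show ?case using Mul1 u by (auto simp: G)
next
  case (Mul2 f r)
  have *: "\<Sigma> \<turnstile> (Mul r (f u), Mul r (f v))" if "\<Sigma> \<turnstile> (f u, f v) \<or> nf D E r = Zero" for v
  proof (cases "nf D E r = Zero")
    case True
    have "\<Sigma> \<turnstile> (Mul r w, Zero)" for w using entails_nf[OF DE, of "Mul r w"] True by simp
    then show ?thesis by (blast intro: entails.trans entails.sym)
  qed (use that in \<open>auto intro: cong_Mul entails.refl\<close>)
  then show ?case using Mul2 u by (auto simp: G)
next
  case (Bin1 f r)
  have *: "\<Sigma> \<turnstile> (Bin (f u) r, Bin (f v) r)" if "\<Sigma> \<turnstile> (f u, f v) \<or> nf D E r = Zero" for v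
  proof (cases "nf D E r = Zero")
    case True
    have "\<Sigma> \<turnstile> (Bin w r, One)" for w using entails_nf[OF DE, of "Bin w r"] True by simp
    then show ?thesis by (blast intro: entails.trans entails.sym)
  qed (use that in \<open>auto intro: cong_Bin entails.refl\<close>)
  then show ?case using Bin1 u by (auto simp: G)
next
  case (Bin2 f r)
  have *: "\<Sigma> \<turnstile> (Bin r (f u), Bin r (f v))" if "\<Sigma> \<turnstile> (f u, f v) \<or> nf D E r = Zero" for v
  proof (cases "nf D E r = Zero")
    case True
    have "\<Sigma> \<turnstile> (Bin r w, One)" for w using entails_nf[OF DE, of "Bin r w"] True by simp
    then show ?thesis by (blast intro: entails.trans entails.sym)
  qed (use that in \<open>auto intro: cong_Bin entails.refl\<close>)
  then show ?case using Bin2 u by (auto simp: G)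
next
  case (Fac f)
  show ?case
  proof (cases "nf D E u \<in> subts (nf D E (f u))")
    case True
    \<comment> \<open>The extra rule cannot fire here: otherwise the normal form of \<open>u\<close>
      would be a subterm of \<open>D\<close> and lie in \<open>G\<close>.\<close>
    have "nf D E (f u) \<noteq> D" using True u unfolding G by auto
    then show ?thesis using True u unfolding G by auto
  next
    case False
    then show ?thesis using Fac by (auto intro: cong_Fac)
  qed
next
  case (Exp2 f)
  show ?case
  proof (cases "nf D E u \<in> subts (nf D E (f u))")
    case True
    then show ?thesis using u unfolding G by auto
  next
    case False
    then show ?thesis using Exp2 by (auto intro: cong_Exp2)
  qed
qed

theorem finite_model:
  assumes "\<not> \<Sigma> \<turnstile> (a, b)"
  shows "\<exists>m F \<rho>. (\<forall>k x y. F k x y < m) \<and> (\<forall>n. \<rho> n < m) \<and>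
    (\<forall>s t \<rho>. (s, t) \<in> \<Sigma> \<longrightarrow> (\<forall>n. \<rho> n < m) \<longrightarrow> meval F \<rho> s = meval F \<rho> t) \<and>
    meval F \<rho> a \<noteq> meval F \<rho> b"
proof -
  obtain D E where DE: "\<Sigma> \<turnstile> (Fac D, E)" "norm E" and fin_nf: "finite (nf D E ` {u. \<Sigma> \<turnstile> (a, u)})"
    using finite_nf by blast
  define G where "G = {Zero, One, Two} \<union> subts D"
  define Q where "Q = G \<union> (\<Union>x \<in> nf D E ` {u. \<Sigma> \<turnstile> (a, u)}. subts x)"
  have finQ: "finite Q" unfolding Q_def G_def
    using finite_UN_I[OF fin_nf finite_subts] finite_subts by (intro finite_UnI) auto
  \<comment> \<open>The coarsest congruence that has the class of \<open>a\<close> as a union of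
    blocks; the empty context keeps \<open>b\<close> apart from \<open>a\<close>.\<close>
  define eqv where "eqv u = {v. \<forall>c. ctx c \<longrightarrow> (\<Sigma> \<turnstile> (a, c u) \<longleftrightarrow> \<Sigma> \<turnstile> (a, c v))}" for u
  have eqv_iff: "eqv u = eqv v \<longleftrightarrow> (\<forall>c. ctx c \<longrightarrow> (\<Sigma> \<turnstile> (a, c u) \<longleftrightarrow> \<Sigma> \<turnstile> (a, c v)))" for u v
    unfolding eqv_def by blast
  have eqv_entails: "eqv u = eqv v" if "\<Sigma> \<turnstile> (u, v)" for u v
    unfolding eqv_iff using ctx_entails[OF _ that] by (blast intro: entails.trans entails.sym)
  \<comment> \<open>The normal form of \<open>u\<close> cannot be visible in that of
    \<open>c u\<close>, since all subterms of normal forms in the class of \<open>a\<close> belong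
    to \<open>Q\<close>. So \<open>c\<close> forgets its argument.\<close>
  have outside: "\<Sigma> \<turnstile> (a, c v)" if "ctx c" "\<Sigma> \<turnstile> (a, c u)" "nf D E u \<notin> Q" "nf D E v \<notin> Q" for c u v
  proof -
    have "nf D E u \<notin> subts (nf D E (c u))" using that(2,3) unfolding Q_def by auto
    moreover have "nf D E u \<notin> G" "nf D E v \<notin> G" using that(3,4) unfolding Q_def by auto
    ultimately have "\<Sigma> \<turnstile> (c u, c v)" using ctx_visible[OF DE(1) that(1) G_def] by blast
    with that(2) show ?thesis by (rule entails.trans)
  qed
  \<comment> \<open>All terms with normal form outside \<open>Q\<close> share one key, so there are
    at most \<open>card Q + 1\<close> congruence classes.\<close>
  define key where "key u = (if nf D E u \<in> Q then Some (nf D E u) else None)" for u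
  have key: "eqv u = eqv v" if "key u = key v" for u v
  proof (cases "nf D E u \<in> Q")
    case True
    then have "nf D E u = nf D E v" using that unfolding key_def by (auto split: if_splits)
    then show ?thesis
      using eqv_entails[OF entails_nf[OF DE(1), of u]] eqv_entails[OF entails_nf[OF DE(1), of v]] by simp
  next
    case False
    then have "nf D E v \<notin> Q" using that unfolding key_def by (auto split: if_splits)
    with False show ?thesis unfolding eqv_iff using outside by blast
  qed
  have "finite (range key)"
    by (rule finite_subset[of _ "insert None (Some ` Q)"]) (auto simp: key_def finQ)
  moreover have "range eqv = (\<lambda>k. eqv (inv key k)) ` range key"
  proof -
    have "eqv (inv key (key u)) = eqv u" for u by (rule key) (simp add: f_inv_into_f)
    then show ?thesis by (auto simp: image_image)
  qed
  ultimately have "finite (range eqv)" by simp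
  then obtain g and m :: nat where g: "g ` range eqv = {i. i < m}" "inj_on g (range eqv)"
    using finite_imp_inj_to_nat_seg by blast
  define cls where "cls u = g (eqv u)" for u
  have cls_iff: "cls u = cls v \<longleftrightarrow> eqv u = eqv v" for u v
    unfolding cls_def using g(2) by (auto dest: inj_onD)
  have cls_less: "cls u < m" for u using g(1) unfolding cls_def by blast
  define rep where "rep i = (SOME u. cls u = i)" for i
  have rep: "cls (rep i) = i" if "i < m" for i
  proof -
    have "i \<in> g ` range eqv" using that g(1) by simp
    then have "\<exists>u. cls u = i" unfolding cls_def by auto
    then show ?thesis unfolding rep_def by (rule someI_ex)
  qed
  have cong: "cls (c u) = cls (c v)" if "ctx c" "cls u = cls v" for c u v
    using that ctx_comp[OF _ that(1)] unfolding cls_iff eqv_iff by blast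
  define F where "F = (\<lambda>(k :: nat) x y. if k = 1 then cls Zero else if k = 2 then cls One
    else if k = 3 then cls (Add (rep x) (rep y)) else if k = 4 then cls (Mul (rep x) (rep y))
    else if k = 5 then cls (Bin (rep x) (rep y)) else if k = 6 then cls (Fac (rep x))
    else cls (Exp2 (rep x)))"
  have eval: "meval F (\<lambda>n. cls (\<sigma> n)) t = cls (subst \<sigma> t)" for \<sigma> t
    unfolding F_def by (rule meval_quotient[OF cong]) (auto simp: rep cls_less)
  have "F k x y < m" for k x y unfolding F_def by (simp add: cls_less)
  moreover have "meval F \<rho> s = meval F \<rho> t" if "(s, t) \<in> \<Sigma>" "\<forall>n. \<rho> n < m" for s t \<rho>
  proof -
    have "\<rho> = (\<lambda>n. cls (rep (\<rho> n)))" using rep that(2) by auto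
    then have "meval F \<rho> u = cls (subst (\<lambda>n. rep (\<rho> n)) u)" for u using eval by metis
    then show ?thesis using eqv_entails[OF entails.ax[OF that(1)]] by (simp add: cls_iff)
  qed
  moreover have "meval F (\<lambda>n. cls (Var n)) a \<noteq> meval F (\<lambda>n. cls (Var n)) b"
  proof -
    have "subst Var u = u" for u by (induction u) auto
    moreover have "eqv a \<noteq> eqv b" unfolding eqv_iff using assms hole entails.refl by blast
    ultimately show ?thesis unfolding eval by (simp add: cls_iff)
  qed
  ultimately show ?thesis using cls_less by (intro exI[of _ m] exI[of _ F] exI[of _ "\<lambda>n. cls (Var n)"]) blast
qed

end

section \<open>The decision procedure\<close>

theorem corollary2p2:
  "\<exists>p. \<forall>\<Sigma>. finite \<Sigma> \<and> (\<forall>e\<in>\<Sigma>. nat_valid e) \<and> (\<forall>e\<in>Omega. \<Sigma> \<turnstile> e) \<longrightarrow>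
    (\<forall>es t\<^sub>1 t\<^sub>2. set es = \<Sigma> \<longrightarrow>
      computes p [eqns_code es, trm_code t\<^sub>1, trm_code t\<^sub>2]
        (if \<Sigma> \<turnstile> (t\<^sub>1, t\<^sub>2) then 1 else 0))"
proof -
  obtain p where p: "\<And>e a b. prov e (frel 0 a b) \<noteq> prov e (fneg a b) \<Longrightarrow>
      computes p [e, a, b] (if prov e (frel 0 a b) then 1 else 0)"
    using decider by blast
  have "computes p [eqns_code es, trm_code t, trm_code u] (if set es \<turnstile> (t, u) then 1 else 0)"
    if "\<forall>e\<in>set es. nat_valid e" "\<forall>e\<in>Omega. set es \<turnstile> e" for es t u
  proof -
    interpret arith_theory "set es" by unfold_locales (use that in auto)
    have pos: "prov (eqns_code es) (frel 0 (trm_code t) (trm_code u)) \<longleftrightarrow> set es \<turnstile> (t, u)"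
    proof
      assume "prov (eqns_code es) (frel 0 (trm_code t) (trm_code u))"
      from prov_rel_sound[OF this HOL.refl HOL.refl] show "set es \<turnstile> (t, u)" by simp
    next
      assume "set es \<turnstile> (t, u)"
      from prov_rel_complete[OF this] show "prov (eqns_code es) (frel 0 (trm_code t) (trm_code u))"
        by simp
    qed
    have neg: "prov (eqns_code es) (fneg (trm_code t) (trm_code u)) \<longleftrightarrow> \<not> set es \<turnstile> (t, u)"
    proof
      assume "\<not> set es \<turnstile> (t, u)"
      from finite_model[OF this] obtain m F \<rho> where "\<forall>k x y. F k x y < m" "\<forall>n. \<rho> n < m"
        "\<forall>s t \<rho>. (s, t) \<in> set es \<longrightarrow> (\<forall>n. \<rho> n < m) \<longrightarrow> meval F \<rho> s = meval F \<rho> t"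
        "meval F \<rho> t \<noteq> meval F \<rho> u" by blast
      then show "prov (eqns_code es) (fneg (trm_code t) (trm_code u))"
        by (intro prov_neg_complete[of F m \<rho>]) auto
    qed (rule prov_neg_sound)
    show ?thesis using p[of "eqns_code es" "trm_code t" "trm_code u"] pos neg by simp
  qed
  then show ?thesis by blast
qed

end
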